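(* Let $D$ be a local integral domain with maximal ideal $M$ such that $D$ is not a field. The following statements are equivalent. (1) $D$ is an $OAF$-domain. (2) $D$ is a $TAF$-domain. (3) $D$ is one-dimensional and every proper principal ideal of $D$ has an $OA$-factorization. (4) $D$ is one-dimensional and atomic and every irreducible element of $D$ generates an $OA$-ideal. (5) $D$ is atomic and $M^2$ is universal. (6) $(M:M)$ is a $DVR$ with maximal ideal $M$. (7) $D$ is a seminormal finitely primary domain of rank one. If these equivalent conditions are satisfied, then $D$ is a half-factorial $C$-domain and a Mori domain.
   Context: All rings are commutative with nonzero identity. Local means having exactly one maximal ideal (no Noetherian assumption). Dimension is Krull dimension. A proper ideal $I$ of a ring $R$ (i.e. $I\ne R$) is an $OA$-ideal if whenever $a,b,c\in R$ are nonunits with $abc\in I$, then $ab\in I$ or $c\in I$; it is a $TA$-ideal if whenever $a,b,c\in R$ and $abc\in I$, then $ab\in I$ or $ac\in I$ or $bc\in I$. An $OA$-factorization (resp. $TA$-factorization) of a proper ideal $I$ is an expression of $I$ as a finite product (at least one factor) of $OA$-ideals (resp. $TA$-ideals). An $OAF$-domain (resp. $TAF$-domain) is an integral domain in which every proper ideal has an $OA$-factorization (resp. $TA$-factorization). Let $D$ be an integral domain with quotient field $K$. $D$ is atomic if every nonzero nonunit is a finite product of irreducible elements. $D$ is half-factorial if $D$ is atomic and any two factorizations of the same nonzero (nonunit) element into irreducible elements have the same length. If $D$ is local with maximal ideal $M$, then $M^2$ is called universal if $M^2\subseteq uD$ for each irreducible element $u\in D$, and $(M:M)=\{x\in K\mid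 xM\subseteq M\}$. The complete integral closure of $D$ is $\widehat{D}=\{x\in K\mid$ there is a nonzero $c\in D$ with $cx^n\in D$ for all $n\in\mathbb{N}\}$, where $\mathbb{N}$ is the set of positive integers, and $(D:\widehat{D})=\{x\in D\mid x\widehat{D}\subseteq D\}$. $D$ is seminormal if for all $x\in K$ with $x^2,x^3\in D$ we have $x\in D$. $D$ is a finitely primary domain of rank one if $D$ is a local one-dimensional domain such that $\widehat{D}$ is a $DVR$ (discrete valuation ring, not a field) and $(D:\widehat{D})\neq \{0\}$. For $X\subseteq K$ let $X^{-1}=\{x\in K\mid xX\subseteq D\}$ and $X_v=(X^{-1})^{-1}$; an ideal $I$ of $D$ is divisorial if $I_v=I$; $D$ is a Mori domain if it satisfies the ascending chain condition on divisorial ideals. $D$ is a $C$-domain if the multiplicative monoid $D\setminus\{0\}$ is a $C$-monoid, in the following sense. Monoids here are commutative, cancellative, with identity, and $H^\times$ denotes the group of units of a monoid $H$. A monoid $F$ is factorial if every nonunit of $F$ is a finite product of prime elements. For a submonoid $H$ of a factorial monoid $F$, two elements $y,y'\in F$ are called $H$-equivalent if $\{x\in F\mid xy\in H\}=\{x\in F\mid xy'\in H\}$; let $[y]$ denote the class of $y$, and let $\mathcal{C}^*(H,F)=\{[y]\mid y\in (F\setminus F^\times)\cup\{1\}\}$ be the reduced class semigroup. A monoid $H$ is a $C$-monoid if it is a submonoid of some factorial monoid $F$ such that $H\cap F^\times=H^\times$ and $\mathcal{C}^*(H,F)$ is finite. *)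

theory Defs
  imports "HOL-Algebra.Algebra" "HOL-Library.Extended_Nat"
begin

section \<open>Local rings, Krull dimension, discrete valuation rings\<close>

definition local_ring :: "('a, 'b) ring_scheme \<Rightarrow> bool" where
  "local_ring R \<longleftrightarrow> cring R \<and> (\<exists>!M. maximalideal M R)"

definition krull_dim :: "('a, 'b) ring_scheme \<Rightarrow> enat" where
  "krull_dim R = Sup {enat n | n. \<exists>P :: nat \<Rightarrow> 'a set.
     (\<forall>i\<le>n. primeideal (P i) R) \<and> (\<forall>i<n. P i \<subset> P (Suc i))}"

definition DVR :: "('a, 'b) ring_scheme \<Rightarrow> bool" where
  "DVR R \<longleftrightarrow> principal_domain R \<and> local_ring R \<and> \<not> field R"


section \<open>OA- and TA-ideals and factorizations into them\<close>

definition proper_ideal :: "'a set \<Rightarrow> ('a, 'b) ring_scheme \<Rightarrow> bool" where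
  "proper_ideal I R \<longleftrightarrow> ideal I R \<and> I \<noteq> carrier R"

definition OA_ideal :: "'a set \<Rightarrow> ('a, 'b) ring_scheme \<Rightarrow> bool" where
  "OA_ideal I R \<longleftrightarrow> proper_ideal I R \<and>
     (\<forall>a \<in> carrier R - Units R. \<forall>b \<in> carrier R - Units R. \<forall>c \<in> carrier R - Units R.
        a \<otimes>\<^bsub>R\<^esub> b \<otimes>\<^bsub>R\<^esub> c \<in> I \<longrightarrow> a \<otimes>\<^bsub>R\<^esub> b \<in> I \<or> c \<in> I)"

definition TA_ideal :: "'a set \<Rightarrow> ('a, 'b) ring_scheme \<Rightarrow> bool" where
  "TA_ideal I R \<longleftrightarrow> proper_ideal I R \<and>
     (\<forall>a \<in> carrier R. \<forall>b \<in> carrier R. \<forall>c \<in> carrier R.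
        a \<otimes>\<^bsub>R\<^esub> b \<otimes>\<^bsub>R\<^esub> c \<in> I \<longrightarrow>
          a \<otimes>\<^bsub>R\<^esub> b \<in> I \<or> a \<otimes>\<^bsub>R\<^esub> c \<in> I \<or> b \<otimes>\<^bsub>R\<^esub> c \<in> I)"

text \<open>The unit of ideal multiplication is the whole ring, so the fold over a nonempty list
  of ideals is their product.\<close>

definition ideal_list_prod :: "('a, 'b) ring_scheme \<Rightarrow> 'a set list \<Rightarrow> 'a set" where
  "ideal_list_prod R Js = foldr (ideal_prod R) Js (carrier R)"

definition has_OA_factorization :: "'a set \<Rightarrow> ('a, 'b) ring_scheme \<Rightarrow> bool" where
  "has_OA_factorization I R \<longleftrightarrow>
     (\<exists>Js. Js \<noteq> [] \<and> (\<forall>J \<in> set Js. OA_ideal J R) \<and> I = ideal_list_prod R Js)"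

definition has_TA_factorization :: "'a set \<Rightarrow> ('a, 'b) ring_scheme \<Rightarrow> bool" where
  "has_TA_factorization I R \<longleftrightarrow>
     (\<exists>Js. Js \<noteq> [] \<and> (\<forall>J \<in> set Js. TA_ideal J R) \<and> I = ideal_list_prod R Js)"

definition OAF_domain :: "('a, 'b) ring_scheme \<Rightarrow> bool" where
  "OAF_domain D \<longleftrightarrow> domain D \<and> (\<forall>I. proper_ideal I D \<longrightarrow> has_OA_factorization I D)"

definition TAF_domain :: "('a, 'b) ring_scheme \<Rightarrow> bool" where
  "TAF_domain D \<longleftrightarrow> domain D \<and> (\<forall>I. proper_ideal I D \<longrightarrow> has_TA_factorization I D)"


section \<open>Factorizations of elements\<close>

text \<open>Neither \<^const>\<open>ring_irreducible\<close> nor \<^const>\<open>prime\<close> includes membership in the carrier;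
  it is required separately throughout.\<close>

definition irreducible_factorization :: "('a, 'b) ring_scheme \<Rightarrow> 'a list \<Rightarrow> 'a \<Rightarrow> bool" where
  "irreducible_factorization D us a \<longleftrightarrow>
     set us \<subseteq> carrier D \<and> (\<forall>u \<in> set us. ring_irreducible\<^bsub>D\<^esub> u) \<and>
     foldr (\<otimes>\<^bsub>D\<^esub>) us \<one>\<^bsub>D\<^esub> = a"

definition atomic_domain :: "('a, 'b) ring_scheme \<Rightarrow> bool" where
  "atomic_domain D \<longleftrightarrow> domain D \<and>
     (\<forall>a \<in> carrier D - {\<zero>\<^bsub>D\<^esub>} - Units D. \<exists>us. irreducible_factorization D us a)"

definition half_factorial_domain :: "('a, 'b) ring_scheme \<Rightarrow> bool" where
  "half_factorial_domain D \<longleftrightarrow> atomic_domain D \<and>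
     (\<forall>a \<in> carrier D - {\<zero>\<^bsub>D\<^esub>} - Units D. \<forall>us vs.
        irreducible_factorization D us a \<longrightarrow> irreducible_factorization D vs a \<longrightarrow>
        length us = length vs)"

definition universal_square :: "('a, 'b) ring_scheme \<Rightarrow> 'a set \<Rightarrow> bool" where
  "universal_square D M \<longleftrightarrow>
     (\<forall>u \<in> carrier D. ring_irreducible\<^bsub>D\<^esub> u \<longrightarrow> ideal_prod D M M \<subseteq> PIdl\<^bsub>D\<^esub> u)"


section \<open>Notions relative to the quotient field\<close>

text \<open>A domain is regarded as a subring of its quotient field \<open>K\<close>, carrying the restricted
  operations of \<open>K\<close>.\<close>

definition quotient_field :: "('a, 'b) ring_scheme \<Rightarrow> ('a, 'b) ring_scheme \<Rightarrow> bool" where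
  "quotient_field K D \<longleftrightarrow>
     field K \<and> subring (carrier D) K \<and> D = K\<lparr>carrier := carrier D\<rparr> \<and>
     (\<forall>x \<in> carrier K. \<exists>a \<in> carrier D. \<exists>b \<in> carrier D - {\<zero>\<^bsub>D\<^esub>}.
        x = a \<otimes>\<^bsub>K\<^esub> inv\<^bsub>K\<^esub> b)"

text \<open>The set \<open>(S : T)\<close>, formed in \<open>K\<close>.\<close>

definition colon :: "('a, 'b) ring_scheme \<Rightarrow> 'a set \<Rightarrow> 'a set \<Rightarrow> 'a set" where
  "colon K S T = {x \<in> carrier K. \<forall>t \<in> T. x \<otimes>\<^bsub>K\<^esub> t \<in> S}"

definition complete_integral_closure ::
    "('a, 'b) ring_scheme \<Rightarrow> ('a, 'b) ring_scheme \<Rightarrow> 'a set" where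
  "complete_integral_closure K D =
     {x \<in> carrier K. \<exists>c \<in> carrier D - {\<zero>\<^bsub>D\<^esub>}. \<forall>n::nat. n \<ge> 1 \<longrightarrow>
        c \<otimes>\<^bsub>K\<^esub> (x [^]\<^bsub>K\<^esub> n) \<in> carrier D}"

definition conductor :: "('a, 'b) ring_scheme \<Rightarrow> ('a, 'b) ring_scheme \<Rightarrow> 'a set" where
  "conductor K D =
     {x \<in> carrier D. \<forall>y \<in> complete_integral_closure K D. x \<otimes>\<^bsub>K\<^esub> y \<in> carrier D}"

definition seminormal :: "('a, 'b) ring_scheme \<Rightarrow> ('a, 'b) ring_scheme \<Rightarrow> bool" where
  "seminormal K D \<longleftrightarrow>
     (\<forall>x \<in> carrier K. x [^]\<^bsub>K\<^esub> (2::nat) \<in> carrier D \<and> x [^]\<^bsub>K\<^esub> (3::nat) \<in> carrier D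
        \<longrightarrow> x \<in> carrier D)"

definition finitely_primary_rank_one ::
    "('a, 'b) ring_scheme \<Rightarrow> ('a, 'b) ring_scheme \<Rightarrow> bool" where
  "finitely_primary_rank_one K D \<longleftrightarrow>
     domain D \<and> local_ring D \<and> krull_dim D = 1 \<and>
     DVR (K\<lparr>carrier := complete_integral_closure K D\<rparr>) \<and>
     conductor K D \<noteq> {\<zero>\<^bsub>D\<^esub>}"

definition inverse_set :: "('a, 'b) ring_scheme \<Rightarrow> ('a, 'b) ring_scheme \<Rightarrow> 'a set \<Rightarrow> 'a set" where
  "inverse_set K D S = colon K (carrier D) S"

definition v_closure :: "('a, 'b) ring_scheme \<Rightarrow> ('a, 'b) ring_scheme \<Rightarrow> 'a set \<Rightarrow> 'a set" where
  "v_closure K D S = inverse_set K D (inverse_set K D S)"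

definition divisorial_ideal ::
    "('a, 'b) ring_scheme \<Rightarrow> ('a, 'b) ring_scheme \<Rightarrow> 'a set \<Rightarrow> bool" where
  "divisorial_ideal K D I \<longleftrightarrow> ideal I D \<and> v_closure K D I = I"

definition Mori_domain :: "('a, 'b) ring_scheme \<Rightarrow> ('a, 'b) ring_scheme \<Rightarrow> bool" where
  "Mori_domain K D \<longleftrightarrow> domain D \<and>
     (\<forall>I :: nat \<Rightarrow> 'a set.
        (\<forall>n. divisorial_ideal K D (I n)) \<longrightarrow> (\<forall>n. I n \<subseteq> I (Suc n)) \<longrightarrow>
        (\<exists>N. \<forall>n\<ge>N. I n = I N))"


section \<open>C-monoids and C-domains\<close>

text \<open>The library's \<^const>\<open>factorial_monoid\<close> is phrased with irreducible elements and essential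
  uniqueness; the definition below is the one by prime elements.\<close>

definition prime_factorial_monoid :: "('a, 'b) monoid_scheme \<Rightarrow> bool" where
  "prime_factorial_monoid F \<longleftrightarrow> comm_monoid_cancel F \<and>
     (\<forall>a \<in> carrier F - Units F. \<exists>ps. set ps \<subseteq> carrier F \<and> (\<forall>p \<in> set ps. prime F p) \<and>
        foldr (\<otimes>\<^bsub>F\<^esub>) ps \<one>\<^bsub>F\<^esub> = a)"

definition submonoid_of :: "('a, 'b) monoid_scheme \<Rightarrow> ('a, 'c) monoid_scheme \<Rightarrow> bool" where
  "submonoid_of H F \<longleftrightarrow> submonoid (carrier H) F \<and> \<one>\<^bsub>H\<^esub> = \<one>\<^bsub>F\<^esub> \<and>
     (\<forall>x \<in> carrier H. \<forall>y \<in> carrier H. x \<otimes>\<^bsub>H\<^esub> y = x \<otimes>\<^bsub>F\<^esub> y)"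

definition H_equivalent ::
    "('a, 'b) monoid_scheme \<Rightarrow> ('a, 'c) monoid_scheme \<Rightarrow> 'a \<Rightarrow> 'a \<Rightarrow> bool" where
  "H_equivalent H F y y' \<longleftrightarrow>
     {x \<in> carrier F. x \<otimes>\<^bsub>F\<^esub> y \<in> carrier H} = {x \<in> carrier F. x \<otimes>\<^bsub>F\<^esub> y' \<in> carrier H}"

definition H_class ::
    "('a, 'b) monoid_scheme \<Rightarrow> ('a, 'c) monoid_scheme \<Rightarrow> 'a \<Rightarrow> 'a set" where
  "H_class H F y = {y' \<in> carrier F. H_equivalent H F y y'}"

definition reduced_class_semigroup ::
    "('a, 'b) monoid_scheme \<Rightarrow> ('a, 'c) monoid_scheme \<Rightarrow> 'a set set" where
  "reduced_class_semigroup H F = H_class H F ` ((carrier F - Units F) \<union> {\<one>\<^bsub>F\<^esub>})"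

text \<open>HOL cannot quantify over the type underlying \<open>F\<close>, so \<open>F\<close> ranges over the monoids on the
  type of \<open>H\<close>. For the nonzero elements \<open>H\<close> of a domain that is not a field this loses nothing:
  if a factorial monoid \<open>F\<close> on any type is a witness, write \<open>F = F\<^sup>\<times> \<times> \<F>(P)\<close>. The submonoid of
  \<open>F\<close> generated by the primes in \<open>P\<close> dividing an element of \<open>H\<close> and by the group generated by the
  unit parts of the elements of \<open>H\<close> is again a witness, it has the cardinality of \<open>H\<close>, and the
  complement of \<open>H\<close> in the quotient field is large enough to accommodate it.\<close>

definition C_monoid :: "('a, 'b) monoid_scheme \<Rightarrow> bool" where
  "C_monoid H \<longleftrightarrow> comm_monoid_cancel H \<and>
     (\<exists>F :: 'a monoid. prime_factorial_monoid F \<and> submonoid_of H F \<and>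
        carrier H \<inter> Units F = Units H \<and> finite (reduced_class_semigroup H F))"

definition C_domain :: "('a, 'b) ring_scheme \<Rightarrow> bool" where
  "C_domain D \<longleftrightarrow> domain D \<and> C_monoid (mult_of D)"

end

theory Submission
  imports Defs
begin

text \<open>Write \<open>V = (M : M)\<close>. If \<open>D\<close> is atomic and \<open>M\<^sup>2\<close> is universal, then \<open>M = uV\<close> for each irreducible
  \<open>u\<close>, so that every nonzero element of \<open>V\<close> is \<open>u\<^sup>n\<close> times a unit: \<open>V\<close> is a DVR with maximal
  ideal \<open>M\<close>. From such a \<open>V\<close> all other properties are read off by valuations, and a seminormal
  finitely primary domain of rank one has such an overring, namely its complete integral closure.

  In a local domain an OA-ideal is prime or contains \<open>M\<^sup>2\<close>, hence is a TA-ideal; if the dimension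
  is one, every nonzero TA-ideal contains \<open>M\<^sup>2\<close>. Factors of principal ideals are principal, which
  gives atomicity and universality. It remains to see that a local TAF-domain is one-dimensional. For a
  nonmaximal prime \<open>P\<close>, a factorization of \<open>P + x\<^sup>4D\<close> with \<open>x \<notin> P\<close> yields \<open>P = P\<^sup>2 + tP\<close> for some
  \<open>t \<notin> P\<close>, and then a factorization of \<open>P\<^sup>2 + cD\<close> with \<open>c \<in> P\<close> yields \<open>c \<in> P\<^sup>2\<close>; so \<open>P = P\<^sup>2\<close>.
  But if some prime is neither zero nor maximal, then it contains a nonzero principal TA-ideal \<open>aD\<close>, and
  either its radical or some \<open>(aD : b)\<close> is a nonmaximal prime that cannot be idempotent.\<close>

section \<open>Ideals in local domains\<close>

text \<open>Without a chain condition ideals need not be finitely generated, so Nakayama's lemma is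
  used for single elements only. A factorization \<open>J L\<close> of \<open>P + fR\<close> is
  handled through one product \<open>i l\<close> outside \<open>P + Mf\<close>: modulo
  \<open>P\<close> it is \<open>f\<close> times a unit, and cancelling \<open>i\<close> or
  \<open>l\<close> modulo the prime \<open>P\<close> determines the factors. With
  \<open>P = 0\<close> the same device shows that factors of nonzero principal ideals are principal.

  The radical of a TA-ideal \<open>I\<close> need not be prime. If it is not, some colon ideal
  \<open>(I : b)\<close> with \<open>b\<close>^2 outside \<open>I\<close> is prime, and this
  replaces any discussion of minimal primes over \<open>I\<close>.

  The equivalences are not proved in a circle. The hub is the existence of an overring
  \<open>V\<close> with a uniformizer \<open>p\<close> such that \<open>M = pV\<close>; it implies
  every statement. Statements (1) to (4) lead to (5), and each of (5), (6), (7) provides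
  \<open>V\<close>. It stays a parameter, since (7) supplies it as the complete integral closure and
  the others as \<open>(M : M)\<close>; only afterwards do both turn out to be
  \<open>V\<close>.\<close>

lemma (in cring) ideal_closedI:
  assumes "I \<subseteq> carrier R" "\<zero> \<in> I"
    and add: "\<And>x y. x \<in> I \<Longrightarrow> y \<in> I \<Longrightarrow> x \<oplus> y \<in> I"
    and mult: "\<And>x y. x \<in> carrier R \<Longrightarrow> y \<in> I \<Longrightarrow> x \<otimes> y \<in> I"
  shows "ideal I R"
proof (rule idealI[OF ring_axioms])
  show "subgroup I (add_monoid R)"
  proof (rule add.subgroupI)
    show "I \<subseteq> carrier R" by fact
    show "I \<noteq> {}" using assms(2) by blast
    show "\<ominus> x \<in> I" if "x \<in> I" for x
    proof -
      have "(\<ominus> \<one>) \<otimes> x = \<ominus> x" using that assms(1) by (auto simp: l_minus)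
      then show ?thesis using mult[of "\<ominus> \<one>" x] that by simp
    qed
    show "x \<oplus> y \<in> I" if "x \<in> I" "y \<in> I" for x y using add that .
  qed
  show "x \<otimes> a \<in> I" if "a \<in> I" "x \<in> carrier R" for a x using mult that by blast
  then show "a \<otimes> x \<in> I" if "a \<in> I" "x \<in> carrier R" for a x
    using that m_comm assms(1) by (metis subsetD)
qed

lemma (in ring) ideal_add_closed: "ideal I R \<Longrightarrow> x \<in> I \<Longrightarrow> y \<in> I \<Longrightarrow> x \<oplus> y \<in> I"
  by (simp add: additive_subgroup.a_closed ideal.axioms(1))

lemma (in ring) ideal_minus_closed: "ideal I R \<Longrightarrow> x \<in> I \<Longrightarrow> y \<in> I \<Longrightarrow> x \<ominus> y \<in> I"
  by (simp add: a_minus_def additive_subgroup.a_closed additive_subgroup.a_inv_closed ideal.axioms(1))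

lemma (in ring) ideal_zero: "ideal I R \<Longrightarrow> \<zero> \<in> I"
  by (simp add: additive_subgroup.zero_closed ideal.axioms(1))

lemma (in ring) ideal_subset: "ideal I R \<Longrightarrow> I \<subseteq> carrier R"
  by (meson ideal.Icarr subsetI)

lemma (in ring) ideal_add_cancel:
  assumes "ideal I R" "x \<in> carrier R" "y \<in> I" "x \<oplus> y \<in> I"
  shows "x \<in> I"
proof -
  have y: "y \<in> carrier R" using assms(1,3) ideal.Icarr by metis
  have "x = (x \<oplus> y) \<ominus> y" using assms(2) y by algebra
  then show ?thesis using ideal_minus_closed[OF assms(1,4,3)] by simp
qed

lemma (in cring) exists_maximalideal:
  assumes "ideal I R" "I \<noteq> carrier R"
  shows "\<exists>N. maximalideal N R \<and> I \<subseteq> N"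
proof -
  \<comment> \<open>Properness is recorded as \<open>\<one> \<notin> J\<close>, a condition that
    passes to unions of chains at once.\<close>
  let ?A = "{J. ideal J R \<and> I \<subseteq> J \<and> \<one> \<notin> J}"
  have I: "I \<in> ?A" using assms ideal.one_imp_carrier by blast
  have "\<exists>N\<in>?A. \<forall>J\<in>?A. N \<subseteq> J \<longrightarrow> J = N"
  proof (rule subset_Zorn_nonempty)
    show "?A \<noteq> {}" using I by blast
  next
    fix C assume ne: "C \<noteq> {}" and C: "subset.chain ?A C"
    have CA: "ideal J R" "I \<subseteq> J" "\<one> \<notin> J" if "J \<in> C" for J
      using that C unfolding subset.chain_def by auto
    have tot: "J \<subseteq> J' \<or> J' \<subseteq> J" if "J \<in> C" "J' \<in> C" for J J'
      using that C unfolding subset_chain_def by blast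
    have "ideal (\<Union>C) R"
    proof (rule ideal_closedI)
      show "\<Union>C \<subseteq> carrier R" using CA(1) ideal_subset by blast
      show "\<zero> \<in> \<Union>C" using ne CA(1) ideal_zero by blast
      fix x y
      show "x \<oplus> y \<in> \<Union>C" if xy: "x \<in> \<Union>C" "y \<in> \<Union>C"
      proof -
        obtain J J' where J: "J \<in> C" "x \<in> J" "J' \<in> C" "y \<in> J'" using xy by blast
        then obtain L where "L \<in> C" "x \<in> L" "y \<in> L" using tot[of J J'] by blast
        then show ?thesis using ideal_add_closed CA(1) by blast
      qed
      show "x \<otimes> y \<in> \<Union>C" if "x \<in> carrier R" "y \<in> \<Union>C"
        using that CA(1) ideal.I_l_closed by (metis Union_iff)
    qed
    moreover have "I \<subseteq> \<Union>C" "\<one> \<notin> \<Union>C" using CA ne by blast+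
    ultimately show "\<Union>C \<in> ?A" by blast
  qed
  then obtain N where N: "ideal N R" "I \<subseteq> N" "\<one> \<notin> N"
    "\<And>J. ideal J R \<Longrightarrow> I \<subseteq> J \<Longrightarrow> \<one> \<notin> J \<Longrightarrow> N \<subseteq> J \<Longrightarrow> J = N" by auto
  have "maximalideal N R"
  proof (rule maximalidealI[OF N(1)])
    show "carrier R \<noteq> N" using N(3) by auto
    fix J assume "ideal J R" "N \<subseteq> J" "J \<subseteq> carrier R"
    then show "J = N \<or> J = carrier R" using N(2,4) ideal.one_imp_carrier by (metis subset_trans)
  qed
  then show ?thesis using N(2) by blast
qed

text \<open>The assumption \<open>M \<noteq> {\<zero>}\<close> says that \<open>R\<close> is not a
  field: a domain is a field exactly if its zero ideal is maximal.\<close>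

locale local_domain = domain R for R (structure) +
  fixes M
  assumes max: "maximalideal M R"
    and unique_max: "\<And>N. maximalideal N R \<Longrightarrow> N = M"
    and not_field: "M \<noteq> {\<zero>}"
begin

lemma ideal_M: "ideal M R"
  using max maximalideal.axioms(1) by blast

lemma M_carr [simp]: "x \<in> M \<Longrightarrow> x \<in> carrier R"
  using ideal_M ideal.Icarr by metis

lemma one_notin_M: "\<one> \<notin> M"
  using max ideal.one_imp_carrier ideal_M maximalideal.I_notcarr by metis

lemma proper_subset_M:
  assumes "ideal I R" "I \<noteq> carrier R" shows "I \<subseteq> M"
  using exists_maximalideal[OF assms] unique_max by blast

lemma M_nonunits: "M = carrier R - Units R"
proof
  show "M \<subseteq> carrier R - Units R"
  proof
    fix x assume x: "x \<in> M"
    have "x \<notin> Units R"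
    proof
      assume u: "x \<in> Units R"
      then have "inv x \<otimes> x \<in> M" using Units_inv_closed[OF u] ideal.I_l_closed[OF ideal_M x] by blast
      then show False using u one_notin_M by simp
    qed
    then show "x \<in> carrier R - Units R" using x by simp
  qed
  show "carrier R - Units R \<subseteq> M"
  proof
    fix x assume x: "x \<in> carrier R - Units R"
    have "\<one> \<notin> PIdl x"
      using x m_comm unfolding cgenideal_def Units_def by auto
    then have "PIdl x \<subseteq> M" using proper_subset_M[OF cgenideal_ideal] x by auto
    then show "x \<in> M" using x cgenideal_self by blast
  qed
qed

lemma M_prime: "primeideal M R"
  using maximalideal_prime max by blast

lemma in_M_iff: "x \<in> carrier R \<Longrightarrow> x \<in> M \<longleftrightarrow> x \<notin> Units R"
  using M_nonunits by blast

lemma proper_ideal_iff: "proper_ideal I R \<longleftrightarrow> ideal I R \<and> I \<subseteq> M"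
  unfolding proper_ideal_def using proper_subset_M one_notin_M one_closed by blast

lemma M_add: "x \<in> M \<Longrightarrow> y \<in> M \<Longrightarrow> x \<oplus> y \<in> M"
  using ideal_add_closed ideal_M by blast

lemma M_mult: "x \<in> M \<Longrightarrow> y \<in> carrier R \<Longrightarrow> x \<otimes> y \<in> M"
  "x \<in> M \<Longrightarrow> y \<in> carrier R \<Longrightarrow> y \<otimes> x \<in> M"
  using ideal.I_r_closed[OF ideal_M] ideal.I_l_closed[OF ideal_M] by blast+

lemma one_minus_unit:
  assumes "m \<in> M" shows "\<one> \<ominus> m \<in> Units R"
proof -
  have "\<one> \<ominus> m \<notin> M"
  proof
    assume "\<one> \<ominus> m \<in> M"
    then have "(\<one> \<ominus> m) \<oplus> m \<in> M" using assms M_add by blast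
    moreover have "(\<one> \<ominus> m) \<oplus> m = \<one>" using assms M_carr[OF assms] by algebra
    ultimately show False using one_notin_M by simp
  qed
  then show ?thesis using assms in_M_iff by simp
qed

lemma unit_mult_in_ideal:
  assumes "ideal I R" "u \<in> Units R" "x \<in> carrier R" "u \<otimes> x \<in> I"
  shows "x \<in> I"
proof -
  have "inv u \<otimes> (u \<otimes> x) \<in> I" using ideal.I_l_closed[OF assms(1,4)] assms(2) by simp
  moreover have "inv u \<otimes> (u \<otimes> x) = x" using assms(2,3) by (metis Units_closed Units_inv_closed Units_l_inv l_one m_assoc)
  ultimately show ?thesis by simp
qed

text \<open>Since \<open>\<one> \<ominus> m\<close> is a unit,
  \<open>(\<one> \<ominus> m) \<otimes> x = y\<close> can be solved for \<open>x\<close>. Later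
  \<open>I\<close> is a prime, the square of a prime or the zero ideal.\<close>

lemma nakayama_element:
  assumes "ideal I R" "m \<in> M" "x \<in> carrier R" "y \<in> I" "x = y \<oplus> m \<otimes> x"
  shows "x \<in> I"
proof -
  have y: "y \<in> carrier R" using assms ideal.Icarr by metis
  have "(\<one> \<ominus> m) \<otimes> x = x \<ominus> m \<otimes> x" using assms(3) M_carr[OF assms(2)] by algebra
  also have "\<dots> = (y \<oplus> m \<otimes> x) \<ominus> m \<otimes> x" using assms(5) by simp
  also have "\<dots> = y" using assms(3) y M_carr[OF assms(2)] by algebra
  finally have "(\<one> \<ominus> m) \<otimes> x \<in> I" using assms(4) by simp
  then show ?thesis using unit_mult_in_ideal assms one_minus_unit by blast
qed

end
section \<open>OA- and TA-ideals\<close>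

lemma (in cring) in_PIdl_iff: "x \<in> PIdl a \<longleftrightarrow> (\<exists>r\<in>carrier R. x = r \<otimes> a)"
  unfolding cgenideal_def by blast

lemma (in ring) prod_in_ideal: "ideal I R \<Longrightarrow> x \<in> I \<Longrightarrow> y \<in> carrier R \<Longrightarrow> x \<otimes> y \<in> I"
  "ideal I R \<Longrightarrow> x \<in> I \<Longrightarrow> y \<in> carrier R \<Longrightarrow> y \<otimes> x \<in> I"
  by (simp_all add: ideal.I_r_closed ideal.I_l_closed)

lemma (in ring) ideal_prod_subsetI:
  assumes "ideal W R" "\<And>x y. x \<in> I \<Longrightarrow> y \<in> J \<Longrightarrow> x \<otimes> y \<in> W"
  shows "I \<cdot> J \<subseteq> W"
proof
  fix s assume "s \<in> I \<cdot> J"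
  then show "s \<in> W"
    by (induct s rule: ideal_prod.induct) (simp_all add: assms ideal_add_closed)
qed

context local_domain
begin

lemma OA_idealI:
  assumes "ideal I R" "I \<subseteq> M" "\<And>x y. x \<in> M \<Longrightarrow> y \<in> M \<Longrightarrow> x \<otimes> y \<in> I"
  shows "OA_ideal I R"
  unfolding OA_ideal_def proper_ideal_iff using assms M_nonunits by auto

lemma TA_idealI:
  assumes I: "ideal I R" "I \<subseteq> M" and sq: "\<And>x y. x \<in> M \<Longrightarrow> y \<in> M \<Longrightarrow> x \<otimes> y \<in> I"
  shows "TA_ideal I R"
proof -
  have "a \<otimes> b \<in> I \<or> a \<otimes> c \<in> I \<or> b \<otimes> c \<in> I"
    if abc: "a \<in> carrier R" "b \<in> carrier R" "c \<in> carrier R" "a \<otimes> b \<otimes> c \<in> I" for a b c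
  proof -
    have unit: "y \<in> I" if "u \<in> Units R" "y \<in> carrier R" "u \<otimes> y \<in> I" for u y
      using that unit_mult_in_ideal[OF I(1)] by blast
    consider "a \<in> Units R" | "b \<in> Units R" | "a \<in> M" "b \<in> M" using abc in_M_iff by blast
    then show ?thesis
    proof cases
      case 1
      then have "b \<otimes> c \<in> I" using unit[of a "b \<otimes> c"] abc by (simp add: m_assoc)
      then show ?thesis by blast
    next
      case 2
      then have "a \<otimes> c \<in> I" using unit[of b "a \<otimes> c"] abc by (simp add: m_ac)
      then show ?thesis by blast
    next
      case 3 then show ?thesis using sq by blast
    qed
  qed
  then show ?thesis unfolding TA_ideal_def proper_ideal_iff using I by blast
qed

lemma TA_ideal_prime:
  assumes "primeideal P R" shows "TA_ideal P R"
proof -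
  have P: "ideal P R" "carrier R \<noteq> P" using assms primeideal.axioms(1) primeideal.I_notcarr by blast+
  have "a \<otimes> b \<in> P \<or> c \<in> P" if "a \<in> carrier R" "b \<in> carrier R" "c \<in> carrier R" "a \<otimes> b \<otimes> c \<in> P" for a b c
    using primeideal.I_prime[OF assms m_closed[OF that(1,2)] that(3,4)] .
  then show ?thesis
    unfolding TA_ideal_def proper_ideal_def using P prod_in_ideal(2)[OF P(1)] by metis
qed

lemma OA_ideal_prime:
  assumes "primeideal P R" shows "OA_ideal P R"
proof -
  have P: "ideal P R" "carrier R \<noteq> P" using assms primeideal.axioms(1) primeideal.I_notcarr by blast+
  have "a \<otimes> b \<in> P \<or> c \<in> P" if "a \<in> carrier R" "b \<in> carrier R" "c \<in> carrier R" "a \<otimes> b \<otimes> c \<in> P" for a b c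
    using primeideal.I_prime[OF assms m_closed[OF that(1,2)] that(3,4)] .
  then show ?thesis
    unfolding OA_ideal_def proper_ideal_def using P by blast
qed

text \<open>Suppose \<open>a \<otimes> b \<in> I\<close> with \<open>a\<close>, \<open>b\<close>
  outside \<open>I\<close>; both are nonunits. For \<open>y\<close> in \<open>M\<close> the
  OA-property splits \<open>y \<otimes> a \<otimes> b\<close> before \<open>b\<close>, so
  \<open>y \<otimes> a \<in> I\<close>; then it splits \<open>x \<otimes> y \<otimes> a\<close>
  before \<open>a\<close>, so \<open>x \<otimes> y \<in> I\<close>.\<close>

lemma OA_ideal_dichotomy:
  assumes OA: "OA_ideal I R"
  shows "primeideal I R \<or> (\<forall>x\<in>M. \<forall>y\<in>M. x \<otimes> y \<in> I)"
proof (rule ccontr)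
  have I: "ideal I R" "I \<noteq> carrier R" "I \<subseteq> M"
    using OA proper_ideal_iff[of I] unfolding OA_ideal_def proper_ideal_def by blast+
  have OAM: "a \<otimes> b \<in> I \<or> c \<in> I" if "a \<in> M" "b \<in> M" "c \<in> M" "a \<otimes> b \<otimes> c \<in> I" for a b c
    using that OA M_nonunits unfolding OA_ideal_def by blast
  assume neg: "\<not> ?thesis"
  then have "\<not> primeideal I R" by blast
  then obtain a b where ab: "a \<in> carrier R" "b \<in> carrier R" "a \<otimes> b \<in> I" "a \<notin> I" "b \<notin> I"
    using primeidealI[OF I(1) is_cring] I(2) by blast
  have aM: "a \<in> M" using in_M_iff unit_mult_in_ideal[OF I(1)] ab by blast
  have bM: "b \<in> M" using in_M_iff unit_mult_in_ideal[OF I(1), of b a] ab m_comm by auto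
  have "x \<otimes> y \<in> I" if xy: "x \<in> M" "y \<in> M" for x y
  proof -
    have "x \<otimes> a \<otimes> b \<in> I" using xy ab prod_in_ideal(2)[OF I(1)] by (simp add: m_assoc)
    then have "y \<otimes> a \<in> I" if "y \<in> M" for y
      using OAM[OF that aM bM] that ab prod_in_ideal(2)[OF I(1)] by (simp add: m_assoc)
    then have "x \<otimes> y \<otimes> a \<in> I" using xy ab prod_in_ideal(2)[OF I(1)] by (simp add: m_assoc)
    then show ?thesis using OAM[OF xy aM] ab by blast
  qed
  then show False using neg by blast
qed

lemma OA_imp_TA: "OA_ideal I R \<Longrightarrow> TA_ideal I R"
  using OA_ideal_dichotomy[of I] TA_ideal_prime[of I] TA_idealI[of I] proper_ideal_iff[of I]
  unfolding OA_ideal_def by blast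

end

section \<open>Radicals and colon ideals of TA-ideals in arbitrary commutative rings\<close>

locale ta_ideal = cring R for R (structure) +
  fixes I
  assumes TA: "TA_ideal I R"
begin

lemma ideal_I: "ideal I R" using TA unfolding TA_ideal_def proper_ideal_def by blast

lemma TA_cases:
  assumes "a \<in> carrier R" "b \<in> carrier R" "c \<in> carrier R" "a \<otimes> b \<otimes> c \<in> I"
  shows "a \<otimes> b \<in> I \<or> a \<otimes> c \<in> I \<or> b \<otimes> c \<in> I"
  using TA assms unfolding TA_ideal_def by blast

lemma square_of_power:
  assumes x: "x \<in> carrier R" shows "x [^] (Suc n) \<in> I \<Longrightarrow> x \<otimes> x \<in> I"
proof (induction n)
  case 0 then show ?case using x prod_in_ideal[OF ideal_I] by simp
next
  case (Suc n)
  show ?case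
  proof (cases "n = 0")
    case True then show ?thesis using Suc.prems x by simp
  next
    case False
    then obtain k where k: "n = Suc k" using not0_implies_Suc by blast
    have "x \<otimes> x \<otimes> x [^] n \<in> I" using Suc.prems x by (simp add: m_ac)
    then have "x \<otimes> x \<in> I \<or> x \<otimes> x [^] n \<in> I" using TA_cases x by blast
    then show ?thesis using Suc.IH x by (auto simp: m_ac)
  qed
qed

text \<open>This is the radical of \<open>I\<close>: by \<open>square_of_power\<close>, an element
  with some positive power in \<open>I\<close> has its square in \<open>I\<close>.\<close>

definition "rad = {x \<in> carrier R. x \<otimes> x \<in> I}"

lemma in_rad: "x \<in> rad \<longleftrightarrow> x \<in> carrier R \<and> x \<otimes> x \<in> I" unfolding rad_def by blast

lemma I_subset_rad: "I \<subseteq> rad"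
  using in_rad prod_in_ideal[OF ideal_I] ideal_subset[OF ideal_I] by blast

text \<open>The TA-property is applied to \<open>x\<close>, \<open>y\<close> and
  \<open>x \<oplus> y\<close>. In each of its three outcomes a square in \<open>I\<close> can be
  subtracted, if necessary, and \<open>x \<otimes> y\<close> remains. Closure of \<open>rad\<close>
  under addition rests on this.\<close>

lemma rad_mult_rad:
  assumes "x \<in> rad" "y \<in> rad" shows "x \<otimes> y \<in> I"
proof -
  have c: "x \<in> carrier R" "y \<in> carrier R" and s: "x \<otimes> x \<in> I" "y \<otimes> y \<in> I" using assms in_rad by auto
  have "x \<otimes> y \<otimes> (x \<oplus> y) = (x \<otimes> x) \<otimes> y \<oplus> x \<otimes> (y \<otimes> y)" using c by algebra
  also have "\<dots> \<in> I" using c s prod_in_ideal[OF ideal_I] ideal_add_closed[OF ideal_I] by blast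
  finally consider "x \<otimes> y \<in> I" | "x \<otimes> (x \<oplus> y) \<in> I" | "y \<otimes> (x \<oplus> y) \<in> I"
    using TA_cases c by blast
  then show ?thesis
  proof cases
    case 2
    have "x \<otimes> (x \<oplus> y) = x \<otimes> y \<oplus> x \<otimes> x" using c by algebra
    then show ?thesis using 2 ideal_add_cancel[OF ideal_I _ s(1)] c by auto
  next
    case 3
    have "y \<otimes> (x \<oplus> y) = x \<otimes> y \<oplus> y \<otimes> y" using c by algebra
    then show ?thesis using 3 ideal_add_cancel[OF ideal_I _ s(2)] c by auto
  qed
qed

lemma ideal_rad: "ideal rad R"
proof (rule ideal_closedI)
  show "rad \<subseteq> carrier R" using in_rad by blast
  show "\<zero> \<in> rad" using in_rad ideal_zero[OF ideal_I] by simp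
  show "x \<oplus> y \<in> rad" if "x \<in> rad" "y \<in> rad" for x y
  proof -
    have c: "x \<in> carrier R" "y \<in> carrier R" using that in_rad by auto
    have "(x \<oplus> y) \<otimes> (x \<oplus> y) = (x \<otimes> x \<oplus> x \<otimes> y) \<oplus> (x \<otimes> y \<oplus> y \<otimes> y)" using c by algebra
    also have "\<dots> \<in> I" using that rad_mult_rad ideal_add_closed[OF ideal_I] by simp
    finally show ?thesis using c in_rad by simp
  qed
  show "x \<otimes> y \<in> rad" if "x \<in> carrier R" "y \<in> rad" for x y
  proof -
    have c: "y \<in> carrier R" "y \<otimes> y \<in> I" using that in_rad by auto
    have "(x \<otimes> y) \<otimes> (x \<otimes> y) = (x \<otimes> x) \<otimes> (y \<otimes> y)" using c that by algebra
    also have "\<dots> \<in> I" using that c prod_in_ideal[OF ideal_I] by simp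
    finally show ?thesis using c that in_rad by simp
  qed
qed

text \<open>The TA-property is used twice, for the factors \<open>b\<close>, \<open>b\<close>,
  \<open>c \<otimes> c\<close> and then for \<open>b\<close>, \<open>c\<close>, \<open>c\<close>;
  the outcomes with a square of \<open>b\<close> or \<open>c\<close> are excluded.\<close>

lemma mult_in_I:
  assumes "b \<in> carrier R" "c \<in> carrier R" "b \<notin> rad" "c \<notin> rad" "b \<otimes> c \<in> rad"
  shows "b \<otimes> c \<in> I"
proof -
  have n: "b \<otimes> b \<notin> I" "c \<otimes> c \<notin> I" using assms in_rad by auto
  have "b \<otimes> b \<otimes> (c \<otimes> c) = (b \<otimes> c) \<otimes> (b \<otimes> c)" using assms by algebra
  then have "b \<otimes> b \<otimes> (c \<otimes> c) \<in> I" using assms in_rad by simp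
  then have "b \<otimes> (c \<otimes> c) \<in> I" using TA_cases[of b b "c \<otimes> c"] assms n by auto
  then have "b \<otimes> c \<otimes> c \<in> I" using assms by (simp add: m_assoc)
  then show ?thesis using TA_cases[of b c c] assms n by auto
qed

text \<open>Modulo \<open>I\<close> the product of \<open>x \<oplus> y\<close>,
  \<open>y \<oplus> z\<close> and \<open>x \<oplus> z\<close> vanishes, while the product of any two
  of these sums reduces to the square of their common summand. The TA-property makes one of the
  squares vanish.\<close>

lemma no_orthogonal_triple:
  assumes "x \<in> carrier R" "y \<in> carrier R" "z \<in> carrier R" "x \<otimes> y \<in> I" "y \<otimes> z \<in> I" "x \<otimes> z \<in> I"
  shows "x \<in> rad \<or> y \<in> rad \<or> z \<in> rad"
proof -
  have *: "v \<in> rad" if "v \<in> carrier R" "u \<in> carrier R" "w \<in> carrier R"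
      "u \<otimes> v \<in> I" "v \<otimes> w \<in> I" "u \<otimes> w \<in> I" "(u \<oplus> v) \<otimes> (v \<oplus> w) \<in> I" for u v w
  proof -
    have "(u \<oplus> v) \<otimes> (v \<oplus> w) = v \<otimes> v \<oplus> (u \<otimes> v \<oplus> (v \<otimes> w \<oplus> u \<otimes> w))" using that by algebra
    moreover have "u \<otimes> v \<oplus> (v \<otimes> w \<oplus> u \<otimes> w) \<in> I" using that ideal_add_closed[OF ideal_I] by simp
    ultimately have "v \<otimes> v \<in> I"
      using ideal_add_cancel[OF ideal_I, of "v \<otimes> v"] that(1,7) by (metis m_closed)
    then show ?thesis using that in_rad by simp
  qed
  have "(x \<oplus> y) \<otimes> (y \<oplus> z) \<otimes> (x \<oplus> z)
    = (x \<otimes> y) \<otimes> (x \<oplus> y \<oplus> z \<oplus> z) \<oplus> ((y \<otimes> z) \<otimes> (y \<oplus> z) \<oplus> (x \<otimes> z) \<otimes> (x \<oplus> z))"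
    using assms(1-3) by algebra
  also have "\<dots> \<in> I"
    using assms prod_in_ideal(1)[OF ideal_I] ideal_add_closed[OF ideal_I] by simp
  finally consider "(x \<oplus> y) \<otimes> (y \<oplus> z) \<in> I" | "(x \<oplus> y) \<otimes> (x \<oplus> z) \<in> I" | "(y \<oplus> z) \<otimes> (x \<oplus> z) \<in> I"
    using TA_cases[of "x \<oplus> y" "y \<oplus> z" "x \<oplus> z"] assms(1-3) by auto
  then show ?thesis
  proof cases
    case 1 then show ?thesis using *[of y x z] assms by blast
  next
    case 2
    then have "(y \<oplus> x) \<otimes> (x \<oplus> z) \<in> I" using assms(1,2) a_comm by simp
    then show ?thesis using *[of x y z] assms by (simp add: m_comm)
  next
    case 3
    then have "(y \<oplus> z) \<otimes> (z \<oplus> x) \<in> I" using assms(1,3) a_comm by simp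
    then show ?thesis using *[of z y x] assms by (simp add: m_comm)
  qed
qed

text \<open>If \<open>y \<otimes> z \<otimes> b \<in> I\<close> with \<open>y\<close> and
  \<open>z\<close> outside the colon ideal, then \<open>y \<otimes> z \<in> I\<close> by the
  TA-property. It turns out that \<open>c\<close>, \<open>y\<close>, \<open>z\<close> have pairwise
  products in \<open>I\<close> and all lie outside \<open>rad\<close>, which
  \<open>no_orthogonal_triple\<close> forbids.\<close>

lemma colon_prime:
  assumes b: "b \<in> carrier R" "b \<notin> rad" and c: "c \<in> carrier R" "c \<notin> rad" and bc: "b \<otimes> c \<in> I"
  shows "primeideal {y \<in> carrier R. y \<otimes> b \<in> I} R" (is "primeideal ?P R")
proof -
  \<comment> \<open>Adding an element \<open>y\<close> of \<open>rad\<close> to \<open>c\<close>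
    keeps it outside \<open>rad\<close>, so \<open>mult_in_I\<close> applies to \<open>b\<close> and
    \<open>c \<oplus> y\<close>; subtracting \<open>b \<otimes> c\<close> leaves
    \<open>b \<otimes> y\<close> in \<open>I\<close>.\<close>
  have *: "y \<notin> rad" if y: "y \<in> carrier R" "y \<otimes> b \<notin> I" for y
  proof
    assume r: "y \<in> rad"
    have "c \<oplus> y \<notin> rad" using ideal_add_cancel[OF ideal_rad c(1) r] c(2) by blast
    moreover have yb: "b \<otimes> (c \<oplus> y) = b \<otimes> y \<oplus> b \<otimes> c" using y c b by algebra
    moreover have "b \<otimes> y \<oplus> b \<otimes> c \<in> rad"
      using bc I_subset_rad r b ideal_add_closed[OF ideal_rad] prod_in_ideal(2)[OF ideal_rad] by blast
    ultimately have "b \<otimes> y \<oplus> b \<otimes> c \<in> I" using mult_in_I[of b "c \<oplus> y"] b c y by simp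
    then have "b \<otimes> y \<in> I" using ideal_add_cancel[OF ideal_I _ bc] b y by simp
    then show False using y b m_comm by simp
  qed
  \<comment> \<open>The TA-property for \<open>y \<oplus> c\<close>, \<open>z\<close>,
    \<open>b\<close>: modulo \<open>I\<close> the three possible products are
    \<open>c \<otimes> z\<close>, \<open>y \<otimes> b\<close> and \<open>z \<otimes> b\<close>, and
    the last two are excluded.\<close>
  have **: "c \<otimes> z \<in> I" if yz: "y \<in> carrier R" "z \<in> carrier R" "y \<otimes> b \<notin> I" "z \<otimes> b \<notin> I" "y \<otimes> z \<in> I" for y z
  proof -
    have "(y \<oplus> c) \<otimes> z \<otimes> b = (y \<otimes> z) \<otimes> b \<oplus> (b \<otimes> c) \<otimes> z" using yz b c by algebra
    also have "\<dots> \<in> I" using yz bc b prod_in_ideal(1)[OF ideal_I] ideal_add_closed[OF ideal_I] by blast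
    finally consider "(y \<oplus> c) \<otimes> z \<in> I" | "(y \<oplus> c) \<otimes> b \<in> I" | "z \<otimes> b \<in> I"
      using TA_cases[of "y \<oplus> c" z b] yz b c by auto
    then show ?thesis
    proof cases
      case 1
      have "(y \<oplus> c) \<otimes> z = c \<otimes> z \<oplus> y \<otimes> z" using yz c by algebra
      then show ?thesis using 1 ideal_add_cancel[OF ideal_I _ yz(5)] c yz by simp
    next
      case 2
      have "(y \<oplus> c) \<otimes> b = y \<otimes> b \<oplus> b \<otimes> c" using yz b c by algebra
      then show ?thesis using 2 ideal_add_cancel[OF ideal_I _ bc] b yz by simp
    qed (use yz in simp)
  qed
  show ?thesis
  proof (rule primeidealI[OF _ is_cring])
    show "ideal ?P R"
    proof (rule ideal_closedI)
      show "\<zero> \<in> ?P" using b ideal_zero[OF ideal_I] by simp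
      show "x \<oplus> y \<in> ?P" if "x \<in> ?P" "y \<in> ?P" for x y
        using that b ideal_add_closed[OF ideal_I] by (simp add: l_distr)
      show "x \<otimes> y \<in> ?P" if "x \<in> carrier R" "y \<in> ?P" for x y
        using that b prod_in_ideal(2)[OF ideal_I] by (simp add: m_assoc)
    qed blast
    show "carrier R \<noteq> ?P"
    proof
      assume "carrier R = ?P"
      then have "b \<otimes> b \<in> I" using b by blast
      then show False using b in_rad by blast
    qed
    fix y z assume yz: "y \<in> carrier R" "z \<in> carrier R" "y \<otimes> z \<in> ?P"
    show "y \<in> ?P \<or> z \<in> ?P"
    proof (rule ccontr)
      assume "\<not> ?thesis"
      then have n: "y \<otimes> b \<notin> I" "z \<otimes> b \<notin> I" using yz by auto
      have p: "y \<otimes> z \<in> I" using TA_cases[of y z b] yz b n by blast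
      have "c \<otimes> z \<in> I" "c \<otimes> y \<in> I" using ** yz n p m_comm by auto
      then show False using no_orthogonal_triple[of c y z] *[of y] *[of z] c yz n p by blast
    qed
  qed
qed

text \<open>Either alternative supplies a prime containing \<open>I\<close> that is described by
  \<open>I\<close> itself, so that idempotence or maximality of this prime becomes a statement about
  \<open>I\<close>. If \<open>rad\<close> is not prime, two elements witnessing this have their
  product in \<open>I\<close> by \<open>mult_in_I\<close>, and \<open>colon_prime\<close>
  applies.\<close>

lemma dichotomy:
  "primeideal rad R \<or> (\<exists>b\<in>carrier R. b \<otimes> b \<notin> I \<and> primeideal {y \<in> carrier R. y \<otimes> b \<in> I} R)"
proof (rule disjCI)
  assume n: "\<not> (\<exists>b\<in>carrier R. b \<otimes> b \<notin> I \<and> primeideal {y \<in> carrier R. y \<otimes> b \<in> I} R)"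
  show "primeideal rad R"
  proof (rule primeidealI[OF ideal_rad is_cring])
    have "\<one> \<notin> rad"
    proof
      assume "\<one> \<in> rad"
      then have "\<one> \<in> I" using in_rad by simp
      then show False using ideal.one_imp_carrier[OF ideal_I] TA unfolding TA_ideal_def proper_ideal_def by blast
    qed
    then show "carrier R \<noteq> rad" by auto
    show "b \<in> rad \<or> c \<in> rad" if "b \<in> carrier R" "c \<in> carrier R" "b \<otimes> c \<in> rad" for b c
      using n colon_prime[of b c] mult_in_I[of b c] that in_rad by blast
  qed
qed

end
section \<open>Idempotence of primes in local TAF-domains\<close>

lemma (in ring) ideal_list_prod_ideal:
  "(\<And>J. J \<in> set Js \<Longrightarrow> ideal J R) \<Longrightarrow> ideal (ideal_list_prod R Js) R"
  unfolding ideal_list_prod_def by (induction Js) (simp_all add: oneideal ideal_prod_is_ideal)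

lemma ideal_list_prod_Cons: "ideal_list_prod R (J # Js) = ideal_prod R J (ideal_list_prod R Js)"
  and ideal_list_prod_Nil: "ideal_list_prod R [] = carrier R"
  unfolding ideal_list_prod_def by simp_all

lemma (in cring) ideal_list_prod_split:
  assumes "\<And>J. J \<in> set Js \<Longrightarrow> ideal J R" "J \<in> set Js"
  shows "\<exists>L. ideal L R \<and> ideal_list_prod R Js = J \<cdot> L"
  using assms
proof (induction Js)
  case (Cons K Js)
  have K: "ideal K R" and P: "ideal (ideal_list_prod R Js) R"
    using Cons.prems ideal_list_prod_ideal by simp_all
  show ?case
  proof (cases "J = K")
    case True then show ?thesis using P by (auto simp: ideal_list_prod_Cons)
  next
    case False
    then obtain L where L: "ideal L R" "ideal_list_prod R Js = J \<cdot> L" using Cons by auto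
    have J: "ideal J R" using Cons.prems by simp
    have "ideal_list_prod R (K # Js) = J \<cdot> (K \<cdot> L)"
      unfolding ideal_list_prod_Cons L(2)
      using ideal_prod_assoc[OF K J L(1)] ideal_prod_assoc[OF J K L(1)] ideal_prod_commute[OF K J] by simp
    then show ?thesis using ideal_prod_is_ideal[OF K L(1)] by blast
  qed
qed simp

lemma (in cring) ideal_list_prod_subset:
  assumes "\<And>J. J \<in> set Js \<Longrightarrow> ideal J R" "J \<in> set Js"
  shows "ideal_list_prod R Js \<subseteq> J"
proof -
  obtain L where "ideal L R" "ideal_list_prod R Js = J \<cdot> L" using ideal_list_prod_split[OF assms] by blast
  then show ?thesis using ideal_prod_inter[OF assms(1)[OF assms(2)]] by simp
qed

lemma (in cring) prime_contains_factor:
  assumes P: "primeideal P R"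
  shows "(\<And>J. J \<in> set Js \<Longrightarrow> ideal J R) \<Longrightarrow> ideal_list_prod R Js \<subseteq> P \<Longrightarrow> \<exists>J\<in>set Js. J \<subseteq> P"
proof (induction Js)
  case Nil
  then have "carrier R = P"
    using P ideal_subset[OF primeideal.axioms(1)[OF P]] by (auto simp: ideal_list_prod_Nil)
  then show ?case using primeideal.I_notcarr[OF P] by blast
next
  case (Cons J Js)
  have "J \<cdot> ideal_list_prod R Js \<subseteq> P" using Cons.prems(2) by (simp add: ideal_list_prod_Cons)
  then have "J \<subseteq> P \<or> ideal_list_prod R Js \<subseteq> P"
    using primeideal_divides_ideal_prod[OF P] Cons.prems(1) ideal_list_prod_ideal by simp
  then show ?case using Cons by auto
qed

text \<open>The coefficient ideal \<open>N\<close> is kept general: the whole ring gives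
  \<open>P + aR\<close>, the maximal ideal gives the \<open>P + Ma\<close> to be avoided before
  Nakayama, and a prime gives sums such as \<open>P\<close>^2 + \<open>iP\<close>.\<close>

lemma (in cring) ideal_add_multiples:
  assumes "ideal P R" "ideal N R" "a \<in> carrier R"
  shows "ideal {y. \<exists>p\<in>P. \<exists>r\<in>N. y = p \<oplus> r \<otimes> a} R"
proof (rule ideal_closedI)
  let ?W = "{y. \<exists>p\<in>P. \<exists>r\<in>N. y = p \<oplus> r \<otimes> a}"
  note P = ideal.Icarr[OF assms(1)] and N = ideal.Icarr[OF assms(2)]
  show "?W \<subseteq> carrier R" using P N assms(3) by auto
  show "\<zero> \<in> ?W" using ideal_zero[OF assms(1)] ideal_zero[OF assms(2)] assms(3) by force
  show "x \<oplus> y \<in> ?W" if xy: "x \<in> ?W" "y \<in> ?W" for x y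
  proof -
    obtain p r q s where h: "p \<in> P" "r \<in> N" "x = p \<oplus> r \<otimes> a" "q \<in> P" "s \<in> N" "y = q \<oplus> s \<otimes> a"
      using xy by blast
    have "x \<oplus> y = (p \<oplus> q) \<oplus> (r \<oplus> s) \<otimes> a"
      unfolding h using P[OF h(1)] P[OF h(4)] N[OF h(2)] N[OF h(5)] assms(3) by algebra
    then show ?thesis using h ideal_add_closed assms by blast
  qed
  show "x \<otimes> y \<in> ?W" if xy: "x \<in> carrier R" "y \<in> ?W" for x y
  proof -
    obtain p r where h: "p \<in> P" "r \<in> N" "y = p \<oplus> r \<otimes> a" using xy by blast
    have "x \<otimes> y = x \<otimes> p \<oplus> (x \<otimes> r) \<otimes> a"
      unfolding h using xy(1) P[OF h(1)] N[OF h(2)] assms(3) by algebra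
    then show ?thesis using h prod_in_ideal(2) assms xy(1) by blast
  qed
qed

lemma (in primeideal) prime_cancel:
  "a \<in> carrier R \<Longrightarrow> b \<in> carrier R \<Longrightarrow> a \<otimes> b \<in> I \<Longrightarrow> b \<notin> I \<Longrightarrow> a \<in> I"
  using I_prime by blast

context local_domain
begin

lemma TA_ideal_ideal: "TA_ideal I R \<Longrightarrow> ideal I R" "TA_ideal I R \<Longrightarrow> I \<subseteq> M"
  unfolding TA_ideal_def proper_ideal_iff by auto

lemma OA_ideal_ideal: "OA_ideal I R \<Longrightarrow> ideal I R" "OA_ideal I R \<Longrightarrow> I \<subseteq> M"
  unfolding OA_ideal_def proper_ideal_iff by auto

lemma prime_subset_M: "primeideal P R \<Longrightarrow> P \<subseteq> M"
  using proper_subset_M primeideal.axioms(1) primeideal.I_notcarr by blast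

text \<open>Let \<open>P + x\<^sup>4R = J L\<close> with \<open>J\<close> a TA-ideal. Modulo \<open>P\<close> this is a factorization of a nonzero principal
  ideal of a local domain, so \<open>J = P + iR\<close>. As \<open>x\<^sup>2 \<in> J\<close>, the complementary factor \<open>L\<close> lies in
  \<open>P + x\<^sup>2R \<subseteq> J\<close>. Hence \<open>P \<subseteq> J\<^sup>2 = P\<^sup>2 + iP + i\<^sup>2R\<close>, and \<open>t = i\<close> works.\<close>

lemma TA_factorization_divisible:
  assumes taf: "\<And>I. proper_ideal I R \<Longrightarrow> has_TA_factorization I R"
    and prime: "primeideal P R" and PM: "P \<noteq> M"
  shows "\<exists>t\<in>M - P. \<forall>p\<in>P. \<exists>q\<in>P \<cdot> P. \<exists>p'\<in>P. p = q \<oplus> t \<otimes> p'"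
proof -
  interpret P: primeideal P R by fact
  have P: "ideal P R" by (rule P.is_ideal)
  have Pc: "\<And>p. p \<in> P \<Longrightarrow> p \<in> carrier R" by (rule P.Icarr)
  have notP: "b \<in> P" if "a \<otimes> b \<in> P" "a \<in> carrier R" "b \<in> carrier R" "a \<notin> P" for a b
    using P.I_prime that by blast
  obtain x where x: "x \<in> M" "x \<notin> P" using PM prime_subset_M[OF prime] by blast
  \<comment> \<open>The exponent 4 is chosen so that \<open>f\<close> is the square of
    \<open>s\<close>: \<open>J.square_of_power\<close> brings \<open>s\<close> into
    \<open>J\<close>, and a second factor \<open>s\<close> of \<open>f\<close> is left for bounding
    \<open>L\<close>.\<close>
  define s where "s = x \<otimes> x"
  define f where "f = s \<otimes> s"
  have xc: "x \<in> carrier R" and sc: "s \<in> carrier R" and fc: "f \<in> carrier R"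
    using x unfolding s_def f_def by auto
  have fP: "f \<notin> P" unfolding f_def s_def using notP x xc by (metis m_closed)
  define I where "I = {y. \<exists>p\<in>P. \<exists>r\<in>carrier R. y = p \<oplus> r \<otimes> f}"
  have I: "ideal I R" unfolding I_def using ideal_add_multiples[OF P oneideal fc] .
  have Iin: "y \<in> I \<longleftrightarrow> (\<exists>p\<in>P. \<exists>r\<in>carrier R. y = p \<oplus> r \<otimes> f)" for y
    unfolding I_def by blast
  have PI: "P \<subseteq> I"
  proof
    fix p assume p: "p \<in> P"
    then have "p = p \<oplus> \<zero> \<otimes> f" using fc Pc by simp
    then show "p \<in> I" unfolding Iin using p by blast
  qed
  have fI: "f \<in> I"
  proof -
    have "f = \<zero> \<oplus> \<one> \<otimes> f" using fc by simp
    then show ?thesis unfolding Iin using ideal_zero[OF P] by blast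
  qed
  have "I \<subseteq> M"
  proof
    fix y assume "y \<in> I"
    then obtain p r where "p \<in> P" "r \<in> carrier R" "y = p \<oplus> r \<otimes> f" unfolding Iin by blast
    then show "y \<in> M" using prime_subset_M[OF prime] M_add M_mult x xc
      unfolding f_def s_def by (metis m_closed subsetD)
  qed
  then obtain Js0 where Js0: "Js0 \<noteq> []" "\<forall>J\<in>set Js0. TA_ideal J R" "I = ideal_list_prod R Js0"
    using taf[of I] I unfolding proper_ideal_iff has_TA_factorization_def by blast
  then obtain J Js where "Js0 = J # Js" by (cases Js0) auto
  then have JTA: "TA_ideal J R" and Js: "\<forall>J\<in>set Js. TA_ideal J R" using Js0 by auto
  define L where "L = ideal_list_prod R Js"
  have L: "ideal L R" unfolding L_def using ideal_list_prod_ideal Js TA_ideal_ideal(1) by blast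
  have IJL: "I = J \<cdot> L" unfolding L_def using Js0 \<open>Js0 = J # Js\<close> by (simp add: ideal_list_prod_Cons)
  interpret J: ta_ideal R J by unfold_locales fact
  have J: "ideal J R" by (rule J.ideal_I)
  have Jc: "\<And>p. p \<in> J \<Longrightarrow> p \<in> carrier R" using ideal.Icarr[OF J] .
  have Lc: "\<And>p. p \<in> L \<Longrightarrow> p \<in> carrier R" using ideal.Icarr[OF L] .
  have IJ: "I \<subseteq> J" unfolding IJL using ideal_prod_inter[OF J L] by blast
  have sJ: "s \<in> J"
  proof -
    have "x [^] Suc 3 = f" unfolding f_def s_def using xc by (simp add: eval_nat_numeral m_ac)
    then show ?thesis using J.square_of_power[OF xc, of 3] fI IJ unfolding s_def by auto
  qed
  \<comment> \<open>Were all products of \<open>J\<close> and \<open>L\<close> in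
    \<open>P + Mf\<close>, Nakayama would give \<open>f \<in> P\<close>. A product in
    \<open>I\<close> but outside \<open>W\<close> has the form
    \<open>p0 \<oplus> e \<otimes> f\<close> with \<open>e\<close> a unit, so it generates
    \<open>I\<close> modulo \<open>P\<close>.\<close>
  define W where "W = {y. \<exists>p\<in>P. \<exists>m\<in>M. y = p \<oplus> m \<otimes> f}"
  have W: "ideal W R" unfolding W_def by (rule ideal_add_multiples[OF P ideal_M fc])
  have "\<exists>i\<in>J. \<exists>l\<in>L. i \<otimes> l \<notin> W"
  proof (rule ccontr)
    assume "\<not> ?thesis"
    then have "I \<subseteq> W" unfolding IJL using ideal_prod_subsetI[OF W, of J L] by blast
    then obtain p m where "p \<in> P" "m \<in> M" "f = p \<oplus> m \<otimes> f" using fI unfolding W_def by blast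
    then show False using nakayama_element[OF P] fc fP by blast
  qed
  then obtain i l where il: "i \<in> J" "l \<in> L" "i \<otimes> l \<notin> W" by blast
  have ic: "i \<in> carrier R" and lc: "l \<in> carrier R" using il Jc Lc by auto
  have PW: "P \<subseteq> W"
  proof
    fix p assume p: "p \<in> P"
    then have "p = p \<oplus> \<zero> \<otimes> f" using fc Pc by simp
    then show "p \<in> W" unfolding W_def using p ideal_zero[OF ideal_M] by blast
  qed
  have iP: "i \<notin> P" and lP: "l \<notin> P"
    using il(3) PW prod_in_ideal(1)[OF P _ lc, of i] prod_in_ideal(2)[OF P _ ic, of l] by blast+
  have "i \<otimes> l \<in> I" unfolding IJL using il ideal_prod.prod by metis
  then obtain p0 e where e: "p0 \<in> P" "e \<in> carrier R" "i \<otimes> l = p0 \<oplus> e \<otimes> f" unfolding Iin by blast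
  then have eU: "e \<in> Units R" using il(3) in_M_iff unfolding W_def by blast
  \<comment> \<open>Eliminating \<open>f\<close> between the expressions for
    \<open>y \<otimes> l\<close> and \<open>i \<otimes> l\<close> leaves
    \<open>(e \<otimes> y \<ominus> r \<otimes> i) \<otimes> l\<close> in \<open>P\<close>, where
    \<open>l\<close> can be cancelled.\<close>
  have A: "\<exists>p\<in>P. \<exists>r\<in>carrier R. y = p \<oplus> r \<otimes> i" if y: "y \<in> J" for y
  proof -
    have yc: "y \<in> carrier R" using y Jc by blast
    have "y \<otimes> l \<in> I" unfolding IJL using y il ideal_prod.prod by metis
    then obtain p r where pr: "p \<in> P" "r \<in> carrier R" "y \<otimes> l = p \<oplus> r \<otimes> f" unfolding Iin by blast
    have p0c: "p0 \<in> carrier R" and pc: "p \<in> carrier R" using e pr Pc by auto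
    have "(e \<otimes> y \<ominus> r \<otimes> i) \<otimes> l = e \<otimes> (y \<otimes> l) \<ominus> r \<otimes> (i \<otimes> l)" using e(2) pr(2) yc ic lc by algebra
    also have "\<dots> = e \<otimes> p \<ominus> r \<otimes> p0" unfolding e(3) pr(3) using p0c pc e(2) pr(2) fc by algebra
    also have "\<dots> \<in> P" using ideal_minus_closed[OF P] prod_in_ideal(2)[OF P pr(1) e(2)] prod_in_ideal(2)[OF P e(1) pr(2)] .
    finally have d: "e \<otimes> y \<ominus> r \<otimes> i \<in> P" 
      by (rule P.prime_cancel[OF _ lc _ lP, rotated]) (use e(2) yc pr(2) ic in simp)
    have ie: "inv e \<in> carrier R" using eU by simp
    have "y = inv e \<otimes> e \<otimes> y" using eU yc by simp
    also have "\<dots> = inv e \<otimes> (e \<otimes> y \<ominus> r \<otimes> i) \<oplus> (inv e \<otimes> r) \<otimes> i" using ie e(2) yc pr(2) ic by algebra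
    finally show ?thesis using prod_in_ideal(2)[OF P d ie] ie pr(2) m_closed by blast
  qed
  obtain p3 r3 where s3: "p3 \<in> P" "r3 \<in> carrier R" "s = p3 \<oplus> r3 \<otimes> i" using A[OF sJ] by blast
  \<comment> \<open>In \<open>i \<otimes> y = p \<oplus> r \<otimes> f\<close> one factor
    \<open>s\<close> of \<open>f\<close> is congruent to \<open>r3 \<otimes> i\<close> modulo
    \<open>P\<close>. Cancelling \<open>i\<close> leaves \<open>y\<close> congruent to
    \<open>r \<otimes> r3 \<otimes> s\<close>, an element of \<open>J\<close>.\<close>
  have LJ: "L \<subseteq> J"
  proof
    fix y assume y: "y \<in> L"
    then have yc: "y \<in> carrier R" using Lc by blast
    have "i \<otimes> y \<in> I" unfolding IJL using y il ideal_prod.prod by metis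
    then obtain p r where pr: "p \<in> P" "r \<in> carrier R" "i \<otimes> y = p \<oplus> r \<otimes> f" unfolding Iin by blast
    have p3c: "p3 \<in> carrier R" and pc: "p \<in> carrier R" using s3 pr Pc by auto
    have "(y \<ominus> (r \<otimes> r3) \<otimes> s) \<otimes> i = i \<otimes> y \<ominus> r \<otimes> s \<otimes> (r3 \<otimes> i)" using yc pr(2) s3(2) sc ic by algebra
    also have "r3 \<otimes> i = s \<ominus> p3" using s3 p3c ic sc by (metis a_comm add.inv_solve_right' a_minus_def m_closed)
    also have "i \<otimes> y \<ominus> r \<otimes> s \<otimes> (s \<ominus> p3) = p \<oplus> (r \<otimes> s) \<otimes> p3"
      unfolding pr(3) f_def using pc p3c pr(2) sc by algebra
    also have "\<dots> \<in> P" using pr s3 sc prod_in_ideal(2)[OF P] ideal_add_closed[OF P] by simp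
    finally have d: "y \<ominus> (r \<otimes> r3) \<otimes> s \<in> P"
      by (rule P.prime_cancel[OF _ ic _ iP, rotated]) (use yc pr(2) s3(2) sc in simp)
    have "y = (y \<ominus> (r \<otimes> r3) \<otimes> s) \<oplus> (r \<otimes> r3) \<otimes> s" using yc pr(2) s3(2) sc by algebra
    moreover have "y \<ominus> (r \<otimes> r3) \<otimes> s \<in> J" using d PI IJ by blast
    ultimately show "y \<in> J"
      using ideal_add_closed[OF J] prod_in_ideal(2)[OF J sJ] pr(2) s3(2) by (metis m_closed)
  qed
  define N where "N = {y. \<exists>q\<in>P \<cdot> P. \<exists>r\<in>P. y = q \<oplus> r \<otimes> i}"
  have PP: "ideal (P \<cdot> P) R" by (rule ideal_prod_is_ideal[OF P P])
  have N: "ideal N R" unfolding N_def by (rule ideal_add_multiples[OF PP P ic])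
  define V where "V = {y. \<exists>q\<in>N. \<exists>d\<in>carrier R. y = q \<oplus> d \<otimes> (i \<otimes> i)}"
  have V: "ideal V R" unfolding V_def using ideal_add_multiples[OF N oneideal] ic by simp
  have "I \<subseteq> V" unfolding IJL
  proof (rule ideal_prod_subsetI[OF V])
    fix y z assume "y \<in> J" "z \<in> L"
    then have "y \<in> J" "z \<in> J" using LJ by auto
    then obtain p r p' r' where h: "p \<in> P" "r \<in> carrier R" "y = p \<oplus> r \<otimes> i"
      "p' \<in> P" "r' \<in> carrier R" "z = p' \<oplus> r' \<otimes> i" using A by meson
    have "y \<otimes> z = (p \<otimes> p' \<oplus> (r' \<otimes> p \<oplus> r \<otimes> p') \<otimes> i) \<oplus> (r \<otimes> r') \<otimes> (i \<otimes> i)"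
      unfolding h using h(2,5) Pc[OF h(1)] Pc[OF h(4)] ic by algebra
    moreover have "r' \<otimes> p \<oplus> r \<otimes> p' \<in> P" using h prod_in_ideal(2)[OF P] ideal_add_closed[OF P] by simp
    moreover have "p \<otimes> p' \<in> P \<cdot> P" using h ideal_prod.prod by metis
    ultimately show "y \<otimes> z \<in> V" unfolding V_def N_def using h(2,5) m_closed by blast
  qed
  \<comment> \<open>The coefficient \<open>d\<close> of \<open>i \<otimes> i\<close> in an element
    of \<open>P\<close> lies in \<open>P\<close>, because \<open>i\<close> does not; so
    \<open>d \<otimes> i\<close> joins the coefficient of \<open>i\<close>.\<close>
  have "\<exists>q\<in>P \<cdot> P. \<exists>p'\<in>P. p = q \<oplus> i \<otimes> p'" if p: "p \<in> P" for p
  proof -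
    obtain q r d where h: "q \<in> P \<cdot> P" "r \<in> P" "d \<in> carrier R" "p = q \<oplus> r \<otimes> i \<oplus> d \<otimes> (i \<otimes> i)"
      using p PI \<open>I \<subseteq> V\<close> unfolding V_def N_def by blast
    have c: "q \<in> carrier R" "r \<in> carrier R" "p \<in> carrier R" using h p Pc ideal.Icarr[OF PP] by auto
    have qP: "q \<in> P" using h(1) ideal_prod_inter[OF P P] by blast
    have "d \<otimes> (i \<otimes> i) = p \<ominus> (q \<oplus> r \<otimes> i)" unfolding h(4) using c h(3) ic by algebra
    also have "\<dots> \<in> P" using p h(2) qP ic prod_in_ideal(1)[OF P] ideal_add_closed[OF P] ideal_minus_closed[OF P] by simp
    finally have "d \<in> P"
      by (rule P.prime_cancel[OF h(3) m_closed[OF ic ic]]) (use notP[OF _ ic ic iP] iP in blast)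
    then have "r \<oplus> d \<otimes> i \<in> P" using h(2) ic prod_in_ideal(1)[OF P] ideal_add_closed[OF P] by simp
    moreover have "p = q \<oplus> i \<otimes> (r \<oplus> d \<otimes> i)" unfolding h(4) using c h(3) ic by algebra
    ultimately show ?thesis using h(1) by blast
  qed
  moreover have "i \<in> M - P" using iP il TA_ideal_ideal(2)[OF JTA] by blast
  ultimately show ?thesis by blast
qed

text \<open>For \<open>c \<in> P - P\<^sup>2\<close> let \<open>P\<^sup>2 + cR = J L\<close> with a TA-ideal \<open>J \<subseteq> P\<close>. Writing \<open>y \<in> J\<close> as \<open>q + t\<^sup>2p'\<close>, the
  TA-property turns \<open>t t p' \<in> J\<close> into \<open>t p' \<in> J\<close>; so \<open>J \<subseteq> P\<^sup>2 + tJ\<close> and \<open>c \<in> P\<^sup>2 + tcR\<close>.\<close>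

lemma TA_factorization_idempotent:
  assumes taf: "\<And>I. proper_ideal I R \<Longrightarrow> has_TA_factorization I R"
    and prime: "primeideal P R" and PM: "P \<noteq> M"
  shows "P \<cdot> P = P"
proof (rule ccontr)
  interpret P: primeideal P R by fact
  have P: "ideal P R" by (rule P.is_ideal)
  have Pc: "\<And>p. p \<in> P \<Longrightarrow> p \<in> carrier R" by (rule P.Icarr)
  have PP: "ideal (P \<cdot> P) R" by (rule ideal_prod_is_ideal[OF P P])
  have PPP: "P \<cdot> P \<subseteq> P" using ideal_prod_inter[OF P P] by blast
  have PPc: "\<And>p. p \<in> P \<cdot> P \<Longrightarrow> p \<in> carrier R" by (rule ideal.Icarr[OF PP])
  obtain t where t: "t \<in> M" "t \<notin> P" and div: "\<And>p. p \<in> P \<Longrightarrow> \<exists>q\<in>P \<cdot> P. \<exists>p'\<in>P. p = q \<oplus> t \<otimes> p'"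
    using TA_factorization_divisible[OF assms] by blast
  have tc: "t \<in> carrier R" using t by simp
  assume "P \<cdot> P \<noteq> P"
  then obtain c where c: "c \<in> P" "c \<notin> P \<cdot> P" using PPP by blast
  have cc: "c \<in> carrier R" using c Pc by blast
  define I where "I = {y. \<exists>p\<in>P \<cdot> P. \<exists>r\<in>carrier R. y = p \<oplus> r \<otimes> c}"
  have I: "ideal I R" unfolding I_def using ideal_add_multiples[OF PP oneideal cc] .
  have Iin: "y \<in> I \<longleftrightarrow> (\<exists>p\<in>P \<cdot> P. \<exists>r\<in>carrier R. y = p \<oplus> r \<otimes> c)" for y
    unfolding I_def by blast
  have IP: "I \<subseteq> P"
  proof
    fix y assume "y \<in> I"
    then obtain p r where "p \<in> P \<cdot> P" "r \<in> carrier R" "y = p \<oplus> r \<otimes> c" unfolding Iin by blast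
    then show "y \<in> P" using PPP c prod_in_ideal(2)[OF P] ideal_add_closed[OF P] by blast
  qed
  have PPI: "P \<cdot> P \<subseteq> I"
  proof
    fix p assume p: "p \<in> P \<cdot> P"
    then have "p = p \<oplus> \<zero> \<otimes> c" using cc PPc by simp
    then show "p \<in> I" unfolding Iin using p by blast
  qed
  have cI: "c \<in> I"
  proof -
    have "c = \<zero> \<oplus> \<one> \<otimes> c" using cc by simp
    then show ?thesis unfolding Iin using ideal_zero[OF PP] by blast
  qed
  obtain Js where Js: "\<forall>J\<in>set Js. TA_ideal J R" "I = ideal_list_prod R Js"
    using taf[of I] I IP prime_subset_M[OF prime] unfolding proper_ideal_iff has_TA_factorization_def by blast
  have Jsi: "\<And>J. J \<in> set Js \<Longrightarrow> ideal J R" using Js TA_ideal_ideal(1) by blast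
  obtain J where J: "J \<in> set Js" "J \<subseteq> P" using prime_contains_factor[OF prime Jsi] Js(2) IP by blast
  obtain L where L: "ideal L R" "I = J \<cdot> L" using ideal_list_prod_split[OF Jsi J(1)] Js(2) by blast
  interpret J: ta_ideal R J using Js J by unfold_locales blast
  have PPJ: "P \<cdot> P \<subseteq> J" using PPI L(2) ideal_prod_inter[OF J.ideal_I L(1)] by blast
  have A: "\<exists>q\<in>P \<cdot> P. \<exists>z\<in>J. y = q \<oplus> t \<otimes> z" if y: "y \<in> J" for y
  proof -
    obtain q p where h: "q \<in> P \<cdot> P" "p \<in> P" "y = q \<oplus> t \<otimes> p" using div y J(2) by blast
    obtain q' p' where h': "q' \<in> P \<cdot> P" "p' \<in> P" "p = q' \<oplus> t \<otimes> p'" using div h(2) by blast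
    have cs: "q \<in> carrier R" "q' \<in> carrier R" "p' \<in> carrier R" using h h' Pc PPc by auto
    have qq: "q \<oplus> t \<otimes> q' \<in> P \<cdot> P" using h h' tc prod_in_ideal(2)[OF PP] ideal_add_closed[OF PP] by simp
    have eq: "y = (q \<oplus> t \<otimes> q') \<oplus> t \<otimes> (t \<otimes> p')" unfolding h(3) h'(3) using cs tc by algebra
    have "t \<otimes> t \<otimes> p' = y \<ominus> (q \<oplus> t \<otimes> q')" unfolding eq using cs tc by algebra
    also have "\<dots> \<in> J" using y qq PPJ ideal_minus_closed[OF J.ideal_I] by blast
    finally have "t \<otimes> t \<in> J \<or> t \<otimes> p' \<in> J" using J.TA_cases[of t t p'] tc cs by blast
    moreover have "t \<otimes> t \<notin> J" using J(2) P.I_prime tc t by blast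
    ultimately show ?thesis using qq eq by blast
  qed
  \<comment> \<open>The cofactor of \<open>t\<close> found above lies in \<open>J\<close> and not
    merely in \<open>P\<close>; this keeps its products with \<open>L\<close> inside
    \<open>I\<close>, so that \<open>t\<close> multiplies \<open>c\<close> as well.\<close>
  define W where "W = {y. \<exists>q\<in>P \<cdot> P. \<exists>r\<in>carrier R. y = q \<oplus> r \<otimes> (t \<otimes> c)}"
  have W: "ideal W R" unfolding W_def using ideal_add_multiples[OF PP oneideal] tc cc by simp
  have "I \<subseteq> W" unfolding L(2)
  proof (rule ideal_prod_subsetI[OF W])
    fix y z assume y: "y \<in> J" and z: "z \<in> L"
    obtain q y' where h: "q \<in> P \<cdot> P" "y' \<in> J" "y = q \<oplus> t \<otimes> y'" using A[OF y] by blast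
    have "y' \<otimes> z \<in> I" unfolding L(2) using h z ideal_prod.prod by metis
    then obtain q' r where h': "q' \<in> P \<cdot> P" "r \<in> carrier R" "y' \<otimes> z = q' \<oplus> r \<otimes> c" unfolding Iin by blast
    have cs: "q \<in> carrier R" "q' \<in> carrier R" "y' \<in> carrier R" "z \<in> carrier R"
      using h h' z PPc ideal.Icarr[OF L(1)] ideal.Icarr[OF J.ideal_I] by auto
    have "y \<otimes> z = q \<otimes> z \<oplus> t \<otimes> (y' \<otimes> z)" unfolding h using cs tc by algebra
    also have "\<dots> = (q \<otimes> z \<oplus> t \<otimes> q') \<oplus> r \<otimes> (t \<otimes> c)" unfolding h'(3) using cs tc cc h'(2) by algebra
    finally have "y \<otimes> z = (q \<otimes> z \<oplus> t \<otimes> q') \<oplus> r \<otimes> (t \<otimes> c)" .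
    moreover have "q \<otimes> z \<oplus> t \<otimes> q' \<in> P \<cdot> P"
      using ideal_add_closed[OF PP] prod_in_ideal(1)[OF PP h(1) cs(4)] prod_in_ideal(2)[OF PP h'(1) tc] .
    ultimately show "y \<otimes> z \<in> W" unfolding W_def using h'(2) by blast
  qed
  then obtain q r where h: "q \<in> P \<cdot> P" "r \<in> carrier R" "c = q \<oplus> r \<otimes> (t \<otimes> c)"
    using cI unfolding W_def by blast
  then have "c = q \<oplus> (r \<otimes> t) \<otimes> c" using tc cc by (simp add: m_assoc)
  then have "c \<in> P \<cdot> P" using nakayama_element[OF PP M_mult(2)[OF t(1) h(2)] cc h(1)] by blast
  then show False using c by blast
qed

end
section \<open>Consequences of OA- and TA-factorizations\<close>

lemma (in monoid) foldr_mult_append: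
  "set us \<subseteq> carrier G \<Longrightarrow> set vs \<subseteq> carrier G \<Longrightarrow>
    foldr (\<otimes>) (us @ vs) \<one> = foldr (\<otimes>) us \<one> \<otimes> foldr (\<otimes>) vs \<one>"
proof (induction us)
  case (Cons u us)
  have "foldr (\<otimes>) us \<one> \<in> carrier G" "foldr (\<otimes>) vs \<one> \<in> carrier G"
    using Cons.prems multlist_closed by simp_all
  then show ?case using Cons by (simp add: m_assoc)
qed (use multlist_closed in simp)

lemma (in ring) irreducible_factorization_append:
  assumes "irreducible_factorization R us a" "irreducible_factorization R vs b"
  shows "irreducible_factorization R (us @ vs) (a \<otimes> b)"
  using assms foldr_mult_append[of us vs] unfolding irreducible_factorization_def by auto

lemma (in ring) irreducible_factorization_foldr:
  assumes "\<And>a. a \<in> set as \<Longrightarrow> \<exists>us. irreducible_factorization R us a"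
  shows "\<exists>us. irreducible_factorization R us (foldr (\<otimes>) as \<one>)"
  using assms
proof (induction as)
  case Nil
  have "irreducible_factorization R [] \<one>" unfolding irreducible_factorization_def by simp
  then show ?case by auto
next
  case (Cons a as)
  then obtain us vs where "irreducible_factorization R us a"
      "irreducible_factorization R vs (foldr (\<otimes>) as \<one>)" by fastforce
  then show ?case using irreducible_factorization_append by (simp only: foldr.simps comp_apply) blast
qed

lemma (in ring) irreducible_factorization_single:
  "a \<in> carrier R \<Longrightarrow> ring_irreducible a \<Longrightarrow> irreducible_factorization R [a] a"
  unfolding irreducible_factorization_def by simp

section \<open>Dimension one and factors of principal ideals in local domains\<close>

context local_domain
begin

lemma ring_irreducible_iff:
  assumes "u \<in> carrier R"
  shows "ring_irreducible u \<longleftrightarrow> u \<noteq> \<zero> \<and> u \<in> M \<and> (\<forall>a\<in>M. \<forall>b\<in>M. u \<noteq> a \<otimes> b)"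
proof
  assume "ring_irreducible u"
  then show "u \<noteq> \<zero> \<and> u \<in> M \<and> (\<forall>a\<in>M. \<forall>b\<in>M. u \<noteq> a \<otimes> b)"
    using ring_irreducibleE[OF assms] in_M_iff[OF assms] M_nonunits by blast
next
  assume "u \<noteq> \<zero> \<and> u \<in> M \<and> (\<forall>a\<in>M. \<forall>b\<in>M. u \<noteq> a \<otimes> b)"
  then show "ring_irreducible u"
    using ring_irreducibleI[of u] assms in_M_iff by blast
qed

lemma krull_dim_one_iff: "krull_dim R = 1 \<longleftrightarrow> (\<forall>P. primeideal P R \<longrightarrow> P = {\<zero>} \<or> P = M)"
proof -
  let ?S = "{enat n | n. \<exists>P :: nat \<Rightarrow> 'a set.
     (\<forall>i\<le>n. primeideal (P i) R) \<and> (\<forall>i<n. P i \<subset> P (Suc i))}"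
  have zM: "{\<zero>} \<subset> M" using ideal_zero[OF ideal_M] not_field by blast
  have zP: "{\<zero>} \<subseteq> P" if "primeideal P R" for P using that ideal_zero[OF primeideal.axioms(1)] by blast
  show ?thesis
  proof
    assume d: "krull_dim R = 1"
    show "\<forall>P. primeideal P R \<longrightarrow> P = {\<zero>} \<or> P = M"
    proof (intro allI impI, rule ccontr)
      fix P assume P: "primeideal P R" and n: "\<not> (P = {\<zero>} \<or> P = M)"
      \<comment> \<open>\<open>krull_dim\<close> counts the inclusions in a chain, so three primes
        give dimension at least 2.\<close>
      define Q where "Q i = (if i = 0 then {\<zero>} else if i = 1 then P else M)" for i :: nat
      have "\<forall>i\<le>2. primeideal (Q i) R" unfolding Q_def using P zeroprimeideal M_prime by simp
      moreover have "\<forall>i<2. Q i \<subset> Q (Suc i)"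
        unfolding Q_def using n zP[OF P] prime_subset_M[OF P] by (auto simp: less_2_cases_iff)
      ultimately have "enat 2 \<in> ?S" by blast
      then have "enat 2 \<le> krull_dim R" unfolding krull_dim_def by (rule Sup_upper)
      then show False using d by (simp add: one_enat_def)
    qed
  next
    assume h: "\<forall>P. primeideal P R \<longrightarrow> P = {\<zero>} \<or> P = M"
    show "krull_dim R = 1" unfolding krull_dim_def
    proof (rule antisym)
      show "Sup ?S \<le> 1"
      proof (rule Sup_least)
        fix e assume "e \<in> ?S"
        then obtain n P where P: "e = enat n" "\<forall>i\<le>n. primeideal (P i) R" "\<forall>i<n. P i \<subset> P (Suc i)" by blast
        have "n \<le> 1"
        proof (rule ccontr)
          assume n: "\<not> n \<le> 1"
          then have p: "primeideal (P 0) R" "primeideal (P 1) R" "primeideal (P 2) R" using P(2) by auto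
          have s: "P 0 \<subset> P 1" "P 1 \<subset> P 2" using P(3) n by (auto simp: numeral_2_eq_2)
          have "P 1 \<noteq> {\<zero>}" using s(1) zP[OF p(1)] by blast
          then have "P 1 = M" using h p(2) by blast
          then show False using s(2) prime_subset_M[OF p(3)] by blast
        qed
        then show "e \<le> 1" using P(1) by (simp add: one_enat_def)
      qed
      define Q where "Q i = (if i = 0 then {\<zero>} else M)" for i :: nat
      have "\<forall>i\<le>1. primeideal (Q i) R" "\<forall>i<1. Q i \<subset> Q (Suc i)"
        unfolding Q_def using zeroprimeideal M_prime zM by simp_all
      then have "enat 1 \<in> ?S" by blast
      then show "1 \<le> Sup ?S" unfolding one_enat_def by (rule Sup_upper)
    qed
  qed
qed

text \<open>By Nakayama not all products of \<open>I\<close> and \<open>J\<close> lie in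
  \<open>Ma\<close>; one outside is a unit multiple of \<open>a\<close>. Cancellation in the domain
  then shows that its two factors generate \<open>I\<close> and \<open>J\<close>.\<close>

lemma factors_of_principal_ideal:
  assumes I: "ideal I R" and J: "ideal J R" and a: "a \<in> carrier R" "a \<noteq> \<zero>" and IJ: "I \<cdot> J = PIdl a"
  shows "\<exists>i\<in>I. \<exists>j\<in>J. I = PIdl i \<and> J = PIdl j \<and> i \<otimes> j = a"
proof -
  define W where "W = {y. \<exists>p\<in>{\<zero>}. \<exists>m\<in>M. y = p \<oplus> m \<otimes> a}"
  have W: "ideal W R" unfolding W_def by (rule ideal_add_multiples[OF zeroideal ideal_M a(1)])
  have "\<exists>i\<in>I. \<exists>j\<in>J. i \<otimes> j \<notin> W"
  proof (rule ccontr)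
    assume "\<not> ?thesis"
    then have "PIdl a \<subseteq> W" unfolding IJ[symmetric] using ideal_prod_subsetI[OF W, of I J] by blast
    then have "a \<in> W" using cgenideal_self[OF a(1)] by blast
    then obtain m where "m \<in> M" "a = \<zero> \<oplus> m \<otimes> a" unfolding W_def by blast
    then have "a \<in> {\<zero>}" using nakayama_element[OF zeroideal] a by blast
    then show False using a by blast
  qed
  then obtain i j where ij: "i \<in> I" "j \<in> J" "i \<otimes> j \<notin> W" by blast
  have c: "i \<in> carrier R" "j \<in> carrier R" using ij ideal.Icarr[OF I] ideal.Icarr[OF J] by auto
  have "i \<otimes> j \<in> PIdl a" unfolding IJ[symmetric] using ij ideal_prod.prod by metis
  then obtain e where e: "e \<in> carrier R" "i \<otimes> j = e \<otimes> a" using in_PIdl_iff by blast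
  have "e \<notin> M"
  proof
    assume "e \<in> M"
    moreover have "e \<otimes> a = \<zero> \<oplus> e \<otimes> a" using e a by simp
    ultimately have "e \<otimes> a \<in> W" unfolding W_def by blast
    then show False using ij(3) e(2) by simp
  qed
  then have eU: "e \<in> Units R" using e in_M_iff by blast
  \<comment> \<open>The unit \<open>e\<close> is moved into the second factor, so that the
    generators multiply to \<open>a\<close> itself and not just to an associate.\<close>
  define k where "k = inv e \<otimes> j"
  have kc: "k \<in> carrier R" unfolding k_def using eU c by simp
  have kJ: "k \<in> J" unfolding k_def using prod_in_ideal(2)[OF J ij(2)] eU by simp
  have "i \<otimes> k = inv e \<otimes> (i \<otimes> j)" unfolding k_def using c eU by (simp add: m_lcomm)
  also have "\<dots> = (inv e \<otimes> e) \<otimes> a" unfolding e(2) using eU e(1) a by (simp add: m_assoc del: Units_l_inv)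
  finally have ik: "i \<otimes> k = a" using eU a by simp
  have nz: "i \<noteq> \<zero>" "k \<noteq> \<zero>" using ik a c kc by auto
  have "I \<subseteq> PIdl i"
  proof
    fix y assume y: "y \<in> I"
    have yc: "y \<in> carrier R" using y ideal.Icarr[OF I] by blast
    have "y \<otimes> k \<in> PIdl a" unfolding IJ[symmetric] using y kJ ideal_prod.prod by metis
    then obtain r where r: "r \<in> carrier R" "y \<otimes> k = r \<otimes> (i \<otimes> k)" using in_PIdl_iff ik by blast
    then have "y \<otimes> k = (r \<otimes> i) \<otimes> k" using c kc by (simp add: m_assoc)
    then have "y = r \<otimes> i" using m_rcancel[OF nz(2) kc yc] r c by blast
    then show "y \<in> PIdl i" using in_PIdl_iff r by blast
  qed
  moreover have "J \<subseteq> PIdl k"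
  proof
    fix y assume y: "y \<in> J"
    have yc: "y \<in> carrier R" using y ideal.Icarr[OF J] by blast
    have "i \<otimes> y \<in> PIdl a" unfolding IJ[symmetric] using y ij ideal_prod.prod by metis
    then obtain r where r: "r \<in> carrier R" "i \<otimes> y = r \<otimes> (i \<otimes> k)" using in_PIdl_iff ik by blast
    then have "i \<otimes> y = i \<otimes> (r \<otimes> k)" using c kc by (simp add: m_lcomm)
    then have "y = r \<otimes> k" using m_lcancel[OF nz(1) c(1) yc] r kc by blast
    then show "y \<in> PIdl k" using in_PIdl_iff r by blast
  qed
  ultimately show ?thesis
    using ik ij(1) kJ cgenideal_minimal[OF I ij(1)] cgenideal_minimal[OF J kJ] by blast
qed

text \<open>The list must be nonempty: the empty product of ideals is the whole ring, which any unit
  \<open>a\<close> generates, whereas the empty product of elements is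
  \<open>\<one>\<close>.\<close>

lemma factors_of_principal_ideal_list:
  assumes "Js \<noteq> []" "\<And>J. J \<in> set Js \<Longrightarrow> ideal J R" "a \<in> carrier R" "a \<noteq> \<zero>" "ideal_list_prod R Js = PIdl a"
  shows "\<exists>as. set as \<subseteq> carrier R \<and> Js = map (\<lambda>a. PIdl a) as \<and> foldr (\<otimes>) as \<one> = a"
  using assms
proof (induction Js arbitrary: a rule: list_nonempty_induct)
  case (single J)
  then have "J = PIdl a" using ideal_prod_one[of J] by (simp add: ideal_list_prod_Cons ideal_list_prod_Nil)
  then have "set [a] \<subseteq> carrier R \<and> [J] = map (\<lambda>a. PIdl a) [a] \<and> foldr (\<otimes>) [a] \<one> = a" using single by simp
  then show ?case by (rule exI)
next
  case (cons J Js)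
  have J: "ideal J R" and L: "ideal (ideal_list_prod R Js) R"
    using cons.prems ideal_list_prod_ideal by simp_all
  obtain i j where ij: "i \<in> J" "j \<in> ideal_list_prod R Js" "J = PIdl i" "ideal_list_prod R Js = PIdl j" "i \<otimes> j = a"
    using factors_of_principal_ideal[OF J L cons.prems(2,3)] cons.prems(4) by (auto simp: ideal_list_prod_Cons)
  have c: "i \<in> carrier R" "j \<in> carrier R" using ij ideal.Icarr[OF J] ideal.Icarr[OF L] by auto
  have "j \<noteq> \<zero>" using ij(5) cons.prems(3) c by auto
  then obtain as where as: "set as \<subseteq> carrier R" "Js = map (\<lambda>a. PIdl a) as" "foldr (\<otimes>) as \<one> = j"
    using cons.IH[OF _ c(2) _ ij(4)] cons.prems(1) by auto
  have "set (i # as) \<subseteq> carrier R \<and> J # Js = map (\<lambda>a. PIdl a) (i # as) \<and> foldr (\<otimes>) (i # as) \<one> = a"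
    using as c ij by simp
  then show ?case by (rule exI)
qed

text \<open>Let \<open>J = aR\<close> be the principal TA-ideal inside \<open>P\<close>. If its
  radical is idempotent, it equals \<open>aR\<close>, and \<open>a\<close> is a multiple of its own
  square. If \<open>Q = (aR : b)\<close> is idempotent, then \<open>Q b \<subseteq> aR\<close> gives
  \<open>Q\<close>^2 \<open>b \<subseteq> aQ\<close>; as \<open>a \<in> Q\<close>, this yields
  \<open>a b = a q\<close> with \<open>q \<in> Q\<close>, so \<open>b \<in> Q\<close> although
  \<open>b\<close>^2 is not in \<open>aR\<close>.\<close>

lemma primes_of_TAF_domain:
  assumes taf: "\<And>I. proper_ideal I R \<Longrightarrow> has_TA_factorization I R"
    and prime: "primeideal P R"
  shows "P = {\<zero>} \<or> P = M"
proof (rule ccontr)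
  assume n: "\<not> ?thesis"
  have P: "ideal P R" by (rule primeideal.axioms(1)[OF prime])
  obtain x where x: "x \<in> P" "x \<noteq> \<zero>" using n ideal_zero[OF P] by blast
  have xc: "x \<in> carrier R" using x ideal.Icarr[OF P] by blast
  have xP: "PIdl x \<subseteq> P" by (rule cgenideal_minimal[OF P x(1)])
  obtain Js where Js: "Js \<noteq> []" "\<forall>J\<in>set Js. TA_ideal J R" "PIdl x = ideal_list_prod R Js"
    using taf[of "PIdl x"] cgenideal_ideal[OF xc] xP prime_subset_M[OF prime]
    unfolding proper_ideal_iff has_TA_factorization_def by blast
  have Jsi: "\<And>J. J \<in> set Js \<Longrightarrow> ideal J R" using Js TA_ideal_ideal(1) by blast
  obtain as where as: "set as \<subseteq> carrier R" "Js = map (\<lambda>a. PIdl a) as"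
    using factors_of_principal_ideal_list[OF Js(1) Jsi xc x(2) Js(3)[symmetric]] by blast
  obtain J where J: "J \<in> set Js" "J \<subseteq> P" using prime_contains_factor[OF prime Jsi] Js(3) xP by blast
  then obtain a where a: "a \<in> carrier R" "J = PIdl a" using as by auto
  have xJ: "x \<in> J" using ideal_list_prod_subset[OF Jsi J(1)] Js(3) cgenideal_self[OF xc] by blast
  have az: "a \<noteq> \<zero>"
  proof
    assume "a = \<zero>"
    then have "x = \<zero>" using xJ a in_PIdl_iff by auto
    then show False using x by blast
  qed
  have aJ: "a \<in> J" using a cgenideal_self by blast
  interpret J: ta_ideal R J using Js J by unfold_locales blast
  from J.dichotomy show False
  proof
    assume p: "primeideal J.rad R"
    have "J.rad \<subseteq> P"
    proof
      fix y assume "y \<in> J.rad"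
      then have "y \<in> carrier R" "y \<otimes> y \<in> P" using J.in_rad J by auto
      then show "y \<in> P" using primeideal.I_prime[OF prime] by blast
    qed
    then have "J.rad \<noteq> M" using n prime_subset_M[OF prime] by blast
    then have idem: "J.rad \<cdot> J.rad = J.rad" using TA_factorization_idempotent[OF taf p] by blast
    have radJ: "J.rad \<subseteq> J"
      using ideal_prod_subsetI[OF J.ideal_I, of J.rad J.rad] J.rad_mult_rad idem by blast
    have aa: "ideal (PIdl (a \<otimes> a)) R" using cgenideal_ideal a by simp
    have "J.rad \<cdot> J.rad \<subseteq> PIdl (a \<otimes> a)"
    proof (rule ideal_prod_subsetI[OF aa])
      fix y z assume "y \<in> J.rad" "z \<in> J.rad"
      then have "y \<in> PIdl a" "z \<in> PIdl a" using radJ a(2) by auto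
      then obtain r s where h: "r \<in> carrier R" "y = r \<otimes> a" "s \<in> carrier R" "z = s \<otimes> a"
        unfolding in_PIdl_iff by blast
      have "y \<otimes> z = (r \<otimes> s) \<otimes> (a \<otimes> a)" unfolding h using h(1,3) a(1) by algebra
      then show "y \<otimes> z \<in> PIdl (a \<otimes> a)" using in_PIdl_iff h by blast
    qed
    then have "a \<in> PIdl (a \<otimes> a)" using idem aJ J.I_subset_rad by blast
    then obtain r where r: "r \<in> carrier R" "a = r \<otimes> (a \<otimes> a)" using in_PIdl_iff by blast
    have "a = \<zero> \<oplus> (r \<otimes> a) \<otimes> a" using r a(1) by (metis l_zero m_assoc m_closed)
    moreover have "r \<otimes> a \<in> M" using aJ J(2) prime_subset_M[OF prime] M_mult(2) r by blast
    ultimately have "a \<in> {\<zero>}" using nakayama_element[OF zeroideal _ a(1)] by blast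
    then show False using az by blast
  next
    assume "\<exists>b\<in>carrier R. b \<otimes> b \<notin> J \<and> primeideal {y \<in> carrier R. y \<otimes> b \<in> J} R"
    then obtain b where b: "b \<in> carrier R" "b \<otimes> b \<notin> J" and
      p: "primeideal {y \<in> carrier R. y \<otimes> b \<in> J} R" (is "primeideal ?Q R") by blast
    have Q: "ideal ?Q R" by (rule primeideal.axioms(1)[OF p])
    \<comment> \<open>As \<open>b \<otimes> b \<notin> J\<close>, the element \<open>b\<close> is
      outside \<open>?Q\<close>. If \<open>?Q\<close> were \<open>M\<close>, then \<open>b\<close>
      would be a unit and \<open>M \<subseteq> J \<subseteq> P\<close>.\<close>
    have "?Q \<noteq> M"
    proof
      assume QM: "?Q = M"
      then have "b \<in> Units R" using b in_M_iff by blast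
      have "y \<in> J" if "y \<in> M" for y
      proof -
        have "y \<in> carrier R" "y \<otimes> b \<in> J" using that QM by auto
        then show ?thesis using unit_mult_in_ideal[OF J.ideal_I \<open>b \<in> Units R\<close>] m_comm[OF _ b(1)] by simp
      qed
      then show False using n J(2) prime_subset_M[OF prime] by blast
    qed
    then have idem: "?Q \<cdot> ?Q = ?Q" using TA_factorization_idempotent[OF taf p] by blast
    \<comment> \<open>This is the colon ideal \<open>(aQ : b)\<close>, where \<open>Q\<close> is
      \<open>?Q\<close>; that \<open>a\<close> belongs to it permits cancelling
      \<open>a\<close>.\<close>
    define W where "W = {y \<in> carrier R. \<exists>q\<in>?Q. y \<otimes> b = a \<otimes> q}"
    have W: "ideal W R"
    proof (rule ideal_closedI)
      show "W \<subseteq> carrier R" unfolding W_def by blast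
      have "\<zero> \<otimes> b = a \<otimes> \<zero>" using a b by simp
      then show "\<zero> \<in> W" unfolding W_def using ideal_zero[OF Q] zero_closed by blast
      show "y \<oplus> z \<in> W" if yz: "y \<in> W" "z \<in> W" for y z
      proof -
        obtain q q' where h: "y \<in> carrier R" "z \<in> carrier R" "q \<in> ?Q" "q' \<in> ?Q" "y \<otimes> b = a \<otimes> q" "z \<otimes> b = a \<otimes> q'"
          using yz unfolding W_def by auto
        have "(y \<oplus> z) \<otimes> b = a \<otimes> (q \<oplus> q')" using h a b by (simp add: l_distr r_distr)
        then show ?thesis unfolding W_def using h(1,2) ideal_add_closed[OF Q h(3,4)] by blast
      qed
      show "y \<otimes> z \<in> W" if yz: "y \<in> carrier R" "z \<in> W" for y z
      proof -
        obtain q where h: "z \<in> carrier R" "q \<in> ?Q" "z \<otimes> b = a \<otimes> q" using yz unfolding W_def by auto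
        have "(y \<otimes> z) \<otimes> b = a \<otimes> (y \<otimes> q)" using h a b yz by (simp add: m_assoc m_lcomm)
        then show ?thesis unfolding W_def using h(1) yz(1) prod_in_ideal(2)[OF Q h(2) yz(1)] by blast
      qed
    qed
    have "?Q \<cdot> ?Q \<subseteq> W"
    proof (rule ideal_prod_subsetI[OF W])
      fix y z assume y: "y \<in> ?Q" and z: "z \<in> ?Q"
      obtain d where d: "d \<in> carrier R" "y \<otimes> b = d \<otimes> a" using y a in_PIdl_iff by blast
      have "(y \<otimes> z) \<otimes> b = (y \<otimes> b) \<otimes> z" using y z b by (simp add: m_ac)
      also have "\<dots> = a \<otimes> (d \<otimes> z)" unfolding d(2) using d z a by (simp add: m_ac)
      finally show "y \<otimes> z \<in> W" unfolding W_def using y z prod_in_ideal(2)[OF Q z d(1)] by blast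
    qed
    moreover have "a \<in> ?Q" using a b aJ prod_in_ideal(1)[OF J.ideal_I] by blast
    ultimately have "a \<in> W" using idem by blast
    then obtain q where q: "q \<in> ?Q" "a \<otimes> b = a \<otimes> q" unfolding W_def by blast
    have "b = q" using m_lcancel[OF az a(1) b(1)] q by blast
    then show False using q b by blast
  qed
qed

text \<open>The prime given by \<open>dichotomy\<close> contains the nonzero ideal \<open>I\<close>,
  so it is \<open>M\<close>. If it is the radical, \<open>rad_mult_rad\<close> finishes. If it is
  \<open>(I : b)\<close>, then \<open>b\<close> is outside it and hence a unit, so even
  \<open>M \<subseteq> I\<close>.\<close>

lemma square_in_nonzero_TA_ideal:
  assumes dim: "\<And>P. primeideal P R \<Longrightarrow> P = {\<zero>} \<or> P = M"
    and I: "TA_ideal I R" "I \<noteq> {\<zero>}" and xy: "x \<in> M" "y \<in> M"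
  shows "x \<otimes> y \<in> I"
proof -
  interpret ta_ideal R I by unfold_locales fact
  have full: "P = M" if "primeideal P R" "I \<subseteq> P" for P
    using dim[OF that(1)] that(2) I(2) ideal_zero[OF ideal_I] by blast
  from dichotomy show ?thesis
  proof
    assume "primeideal rad R"
    then have "rad = M" using full I_subset_rad by blast
    then show ?thesis using rad_mult_rad xy by blast
  next
    assume "\<exists>b\<in>carrier R. b \<otimes> b \<notin> I \<and> primeideal {y \<in> carrier R. y \<otimes> b \<in> I} R"
    then obtain b where b: "b \<in> carrier R" "b \<otimes> b \<notin> I" and p: "primeideal {y \<in> carrier R. y \<otimes> b \<in> I} R" by blast
    have Q: "{y \<in> carrier R. y \<otimes> b \<in> I} = M"
      using full[OF p] b prod_in_ideal(1)[OF ideal_I] ideal_subset[OF ideal_I] by blast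
    then have "b \<in> Units R" using b in_M_iff by blast
    have "y \<in> I" if "y \<in> M" for y
    proof -
      have "y \<in> carrier R" "y \<otimes> b \<in> I" using that Q by auto
      then show ?thesis using unit_mult_in_ideal[OF ideal_I \<open>b \<in> Units R\<close>] m_comm[OF _ b(1)] by simp
    qed
    then show ?thesis using xy M_mult by simp
  qed
qed

lemma TAF_imp_one_dim_OAF:
  assumes "TAF_domain R"
  shows "krull_dim R = 1" "proper_ideal I R \<Longrightarrow> has_OA_factorization I R"
proof -
  have taf: "\<And>I. proper_ideal I R \<Longrightarrow> has_TA_factorization I R" using assms unfolding TAF_domain_def by blast
  have dim: "\<And>P. primeideal P R \<Longrightarrow> P = {\<zero>} \<or> P = M" using primes_of_TAF_domain[OF taf] by blast
  then show "krull_dim R = 1" unfolding krull_dim_one_iff by blast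
  have "OA_ideal J R" if J: "TA_ideal J R" for J
  proof (cases "J = {\<zero>}")
    case True then show ?thesis using OA_ideal_prime zeroprimeideal by blast
  next
    case False
    then show ?thesis using OA_idealI[OF TA_ideal_ideal[OF J]] square_in_nonzero_TA_ideal[OF dim J] by blast
  qed
  then show "proper_ideal I R \<Longrightarrow> has_OA_factorization I R"
    using taf unfolding has_TA_factorization_def has_OA_factorization_def by blast
qed

lemma OAF_imp_TAF: "OAF_domain R \<Longrightarrow> TAF_domain R"
  unfolding OAF_domain_def TAF_domain_def has_TA_factorization_def has_OA_factorization_def
  using OA_imp_TA by meson

lemma square_in_nonzero_OA_ideal:
  assumes dim: "krull_dim R = 1"
    and OA: "OA_ideal I R" "I \<noteq> {\<zero>}" and xy: "x \<in> M" "y \<in> M"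
  shows "x \<otimes> y \<in> I"
  using OA_ideal_dichotomy[OF OA(1)] dim OA(2) xy M_mult(1) unfolding krull_dim_one_iff by auto

lemma universal_squareI:
  assumes "\<And>u x y. \<lbrakk>u \<in> carrier R; ring_irreducible u; x \<in> M; y \<in> M\<rbrakk> \<Longrightarrow> x \<otimes> y \<in> PIdl u"
  shows "universal_square R M"
  unfolding universal_square_def using ideal_prod_subsetI[OF cgenideal_ideal] assms by simp

lemma PIdl_nonzero: "a \<in> carrier R \<Longrightarrow> a \<noteq> \<zero> \<Longrightarrow> PIdl a \<noteq> {\<zero>}"
  using cgenideal_self by blast

lemma irreducible_OA_imp_universal:
  assumes "krull_dim R = 1" "\<And>u. u \<in> carrier R \<Longrightarrow> ring_irreducible u \<Longrightarrow> OA_ideal (PIdl u) R"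
  shows "universal_square R M"
proof (rule universal_squareI)
  fix u x y assume u: "u \<in> carrier R" "ring_irreducible u" and xy: "x \<in> M" "y \<in> M"
  show "x \<otimes> y \<in> PIdl u"
    using square_in_nonzero_OA_ideal[OF assms(1) assms(2)[OF u] _ xy] PIdl_nonzero[OF u(1)]
      ring_irreducibleE(1)[OF u] by blast
qed

text \<open>Writing \<open>b = e f d\<close> with three nonunits would give \<open>e f \<in> M\<^sup>2 \<subseteq> e f d R\<close>; so \<open>b\<close> is a product
  of at most two irreducible elements.\<close>

lemma short_factorization:
  assumes b: "b \<in> M" "b \<noteq> \<zero>" and sq: "\<And>x y. x \<in> M \<Longrightarrow> y \<in> M \<Longrightarrow> x \<otimes> y \<in> PIdl b"
  shows "\<exists>us. irreducible_factorization R us b"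
proof (cases "ring_irreducible b")
  case True then show ?thesis using irreducible_factorization_single[OF M_carr[OF b(1)]] by blast
next
  case False
  then obtain c d where cd: "c \<in> M" "d \<in> M" "b = c \<otimes> d" using ring_irreducible_iff b by auto
  have no3: False if efd: "e \<in> M" "f \<in> M" "d \<in> M" "b = (e \<otimes> f) \<otimes> d" for e f d
  proof -
    have c: "e \<in> carrier R" "f \<in> carrier R" "d \<in> carrier R" using efd by auto
    have nz: "e \<otimes> f \<noteq> \<zero>" using b(2) efd(4) c by auto
    obtain r where r: "r \<in> carrier R" "e \<otimes> f = r \<otimes> ((e \<otimes> f) \<otimes> d)" using sq[OF efd(1,2)] in_PIdl_iff efd(4) by blast
    have "e \<otimes> f = \<zero> \<oplus> (r \<otimes> d) \<otimes> (e \<otimes> f)"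
      using r(1) c by (subst r(2)) (simp add: m_ac)
    then have "e \<otimes> f \<in> {\<zero>}"
      using nakayama_element[OF zeroideal M_mult(2)[OF efd(3) r(1)], of "e \<otimes> f" \<zero>] c by blast
    then show False using nz by blast
  qed
  have nz: "c \<noteq> \<zero>" "d \<noteq> \<zero>" using cd b(2) by auto
  have c: "c \<in> carrier R" "d \<in> carrier R" using cd by auto
  have "ring_irreducible c" using ring_irreducible_iff[OF c(1)] nz cd no3 by blast
  moreover have "ring_irreducible d"
  proof -
    have "b = d \<otimes> c" using cd c m_comm by blast
    then show ?thesis using ring_irreducible_iff[OF c(2)] nz cd(1,2) no3 by blast
  qed
  ultimately show ?thesis
    using irreducible_factorization_append[OF irreducible_factorization_single irreducible_factorization_single] c cd(3)
    by blast
qed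

text \<open>An OA-factorization of \<open>aR\<close> is a factorization of \<open>a\<close> into
  generators \<open>b\<close> with \<open>M\<close>^2 inside \<open>bR\<close>.
  \<open>short_factorization\<close> refines each \<open>b\<close> into irreducible elements, and an
  irreducible \<open>a\<close> is associated to one of them.\<close>

lemma principal_OA_imp_atomic_universal:
  assumes dim: "krull_dim R = 1"
    and OAF: "\<And>I. principalideal I R \<Longrightarrow> proper_ideal I R \<Longrightarrow> has_OA_factorization I R"
  shows "atomic_domain R" "universal_square R M"
proof -
  have fact: "\<exists>as. as \<noteq> [] \<and> foldr (\<otimes>) as \<one> = a \<and>
      (\<forall>b\<in>set as. b \<in> M \<and> b \<noteq> \<zero> \<and> (\<forall>x\<in>M. \<forall>y\<in>M. x \<otimes> y \<in> PIdl b))"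
    if a: "a \<in> M" "a \<noteq> \<zero>" for a
  proof -
    have ac: "a \<in> carrier R" using a by simp
    obtain Js where Js: "Js \<noteq> []" "\<forall>J\<in>set Js. OA_ideal J R" "PIdl a = ideal_list_prod R Js"
      using OAF[of "PIdl a"] cgenideal_is_principalideal[OF ac] cgenideal_ideal[OF ac]
        cgenideal_minimal[OF ideal_M a(1)]
      unfolding proper_ideal_iff has_OA_factorization_def by blast
    have Jsi: "\<And>J. J \<in> set Js \<Longrightarrow> ideal J R" using Js OA_ideal_ideal(1) by blast
    obtain as where as: "set as \<subseteq> carrier R" "Js = map (\<lambda>a. PIdl a) as" "foldr (\<otimes>) as \<one> = a"
      using factors_of_principal_ideal_list[OF Js(1) Jsi ac a(2) Js(3)[symmetric]] by blast
    have "b \<in> M \<and> b \<noteq> \<zero> \<and> (\<forall>x\<in>M. \<forall>y\<in>M. x \<otimes> y \<in> PIdl b)" if b: "b \<in> set as" for b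
    proof -
      have bc: "b \<in> carrier R" using b as by blast
      have bJ: "PIdl b \<in> set Js" using b as by simp
      have "a \<in> PIdl b" using ideal_list_prod_subset[OF Jsi bJ] Js(3) cgenideal_self[OF ac] by blast
      then have bz: "b \<noteq> \<zero>" using a(2) in_PIdl_iff by auto
      have OA: "OA_ideal (PIdl b) R" using bJ Js by blast
      have "b \<in> M" using OA_ideal_ideal(2)[OF OA] cgenideal_self[OF bc] by blast
      then show ?thesis using bz square_in_nonzero_OA_ideal[OF dim OA PIdl_nonzero[OF bc bz]] by blast
    qed
    then show ?thesis using as Js(1) by blast
  qed
  show "atomic_domain R" unfolding atomic_domain_def
  proof (intro conjI ballI)
    show "domain R" by (rule domain_axioms)
    fix a assume "a \<in> carrier R - {\<zero>} - Units R"
    then have "a \<in> M" "a \<noteq> \<zero>" using M_nonunits by auto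
    then obtain as where as: "foldr (\<otimes>) as \<one> = a"
      "\<forall>b\<in>set as. b \<in> M \<and> b \<noteq> \<zero> \<and> (\<forall>x\<in>M. \<forall>y\<in>M. x \<otimes> y \<in> PIdl b)" using fact by blast
    have "\<exists>us. irreducible_factorization R us b" if "b \<in> set as" for b
      using short_factorization[of b] as(2) that by blast
    then show "\<exists>us. irreducible_factorization R us a" using irreducible_factorization_foldr[of as] as(1) by blast
  qed
  show "universal_square R M"
  proof (rule universal_squareI)
    fix u x y assume u: "u \<in> carrier R" "ring_irreducible u" and xy: "x \<in> M" "y \<in> M"
    have uM: "u \<noteq> \<zero>" "u \<in> M" "\<And>a b. a \<in> M \<Longrightarrow> b \<in> M \<Longrightarrow> u \<noteq> a \<otimes> b" using ring_irreducible_iff u by auto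
    obtain as where as: "as \<noteq> []" "foldr (\<otimes>) as \<one> = u"
      "\<forall>b\<in>set as. b \<in> M \<and> b \<noteq> \<zero> \<and> (\<forall>x\<in>M. \<forall>y\<in>M. x \<otimes> y \<in> PIdl b)" using fact[OF uM(2,1)] by blast
    then obtain b bs where bs: "as = b # bs" by (cases as) auto
    define v where "v = foldr (\<otimes>) bs \<one>"
    have bsc: "set bs \<subseteq> carrier R" using as(3) bs by auto
    have vc: "v \<in> carrier R" unfolding v_def using multlist_closed[OF bsc] .
    have bM: "b \<in> M" and ubv: "u = b \<otimes> v" using as bs unfolding v_def by auto
    \<comment> \<open>As \<open>u\<close> is irreducible and \<open>b\<close> a nonunit, the product
      \<open>v\<close> of the remaining factors is a unit; so \<open>bR \<subseteq> uR\<close> and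
      \<open>u\<close> inherits universality from \<open>b\<close>.\<close>
    then have "v \<in> Units R" using uM(3) in_M_iff vc by blast
    then have "b = inv v \<otimes> u" using ubv bM vc by (simp add: m_ac flip: m_assoc)
    then have "b \<in> PIdl u" using in_PIdl_iff \<open>v \<in> Units R\<close> by blast
    then have "PIdl b \<subseteq> PIdl u" using cgenideal_minimal cgenideal_ideal u(1) by blast
    then show "x \<otimes> y \<in> PIdl u" using as(3) bs xy by auto
  qed
qed

end

section \<open>Local domains with a DVR overring sharing the maximal ideal\<close>

lemma (in cring) PIdl_zero: "PIdl \<zero> = {\<zero>}"
  using cgenideal_self[OF zero_closed] in_PIdl_iff by auto

section \<open>Uniformizers and discrete valuation rings\<close>

context domain
begin

text \<open>An element-wise form of a discrete valuation with \<open>n\<close> as the value of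
  \<open>x\<close>. It is stated for any domain, so that a ring can be recognized as a DVR through
  it.\<close>

definition uniformizer :: "'a \<Rightarrow> bool" where
  "uniformizer p \<longleftrightarrow> p \<in> carrier R \<and> p \<noteq> \<zero> \<and> p \<notin> Units R \<and>
     (\<forall>x\<in>carrier R. x \<noteq> \<zero> \<longrightarrow> (\<exists>n::nat. \<exists>e\<in>Units R. x = p [^] n \<otimes> e))"

text \<open>\<open>S\<close> is only a set, because it will also be an ideal of a subring or the
  union of a chain of such ideals. For the same reason the unit \<open>e\<close> cannot be removed
  from the element of least value.\<close>

lemma uniformizer_minimal:
  assumes p: "uniformizer p" and S: "S \<subseteq> carrier R" and x: "x \<in> S" "x \<noteq> \<zero>"
  shows "\<exists>n::nat. \<exists>e\<in>Units R. p [^] n \<otimes> e \<in> S \<and> (\<forall>y\<in>S. \<exists>v\<in>carrier R. y = p [^] n \<otimes> v)"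
proof -
  let ?Q = "\<lambda>n::nat. \<exists>e\<in>Units R. p [^] n \<otimes> e \<in> S"
  have pc: "p \<in> carrier R" using p unfolding uniformizer_def by blast
  have rep: "\<exists>n::nat. \<exists>e\<in>Units R. x = p [^] n \<otimes> e" if "x \<in> S" "x \<noteq> \<zero>" for x
    using p S that unfolding uniformizer_def by blast
  have "\<exists>n. ?Q n" using rep[OF x] x by blast
  then have Q: "?Q (Least ?Q)" by (rule LeastI_ex)
  then obtain e where e: "e \<in> Units R" "p [^] (Least ?Q) \<otimes> e \<in> S" by blast
  have "\<exists>v\<in>carrier R. y = p [^] (Least ?Q) \<otimes> v" if y: "y \<in> S" for y
  proof (cases "y = \<zero>")
    case True then show ?thesis using pc by (intro bexI[of _ \<zero>]) simp_all
  next
    case False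
    obtain m :: nat and d where d: "d \<in> Units R" "y = p [^] m \<otimes> d" using rep[OF y False] by blast
    then have "Least ?Q \<le> m" using y by (intro Least_le) blast
    then obtain k where k: "m = Least ?Q + k" using le_Suc_ex by blast
    have "p [^] m = p [^] (Least ?Q) \<otimes> p [^] k" unfolding k using nat_pow_mult[OF pc] by simp
    then have "y = p [^] (Least ?Q) \<otimes> (p [^] k \<otimes> d)"
      unfolding d(2) using Units_closed[OF d(1)] pc by (simp add: m_assoc)
    then show ?thesis using d(1) pc by blast
  qed
  then show ?thesis using e by blast
qed

lemma DVR_of_uniformizer:
  assumes p: "uniformizer p"
  shows "DVR R" "maximalideal (PIdl p) R"
proof -
  have pc: "p \<in> carrier R" "p \<noteq> \<zero>" "p \<notin> Units R" using p unfolding uniformizer_def by blast+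
  have princ: "\<exists>a\<in>carrier R. I = PIdl a" if I: "ideal I R" for I
  proof (cases "I = {\<zero>}")
    case True
    then show ?thesis using PIdl_zero zero_closed by metis
  next
    case False
    have Ic: "I \<subseteq> carrier R" by (rule ideal_subset[OF I])
    obtain x where "x \<in> I" "x \<noteq> \<zero>" using False ideal_zero[OF I] by blast
    then obtain n :: nat and e where e: "e \<in> Units R" "p [^] n \<otimes> e \<in> I"
      and m: "\<And>y. y \<in> I \<Longrightarrow> \<exists>v\<in>carrier R. y = p [^] n \<otimes> v"
      using uniformizer_minimal[OF p Ic] by blast
    have "p [^] n \<otimes> e \<otimes> inv e \<in> I" using prod_in_ideal(1)[OF I e(2)] e(1) by simp
    then have "p [^] n \<in> I" using e(1) Units_closed[OF e(1)] pc by (simp add: m_assoc)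
    then have "PIdl (p [^] n) \<subseteq> I" by (rule cgenideal_minimal[OF I])
    moreover have "I \<subseteq> PIdl (p [^] n)" using m in_PIdl_iff m_comm pc(1) by (metis nat_pow_closed subsetI)
    ultimately show ?thesis using pc(1) by blast
  qed
  have pd: "principal_domain R" by unfold_locales (rule princ)
  have nu: "x \<in> PIdl p" if x: "x \<in> carrier R" "x \<notin> Units R" for x
  proof (cases "x = \<zero>")
    case True then show ?thesis using ideal_zero[OF cgenideal_ideal[OF pc(1)]] by simp
  next
    case False
    then obtain n :: nat and e where e: "e \<in> Units R" "x = p [^] n \<otimes> e"
      using p x unfolding uniformizer_def by blast
    have "n \<noteq> 0" using e x(2) by (intro notI) simp
    then obtain k where "n = Suc k" using not0_implies_Suc by blast
    then have "x = (p [^] k \<otimes> e) \<otimes> p" using e Units_closed[OF e(1)] pc by (simp add: m_ac)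
    then show ?thesis using in_PIdl_iff e pc by blast
  qed
  have P: "ideal (PIdl p) R" by (rule cgenideal_ideal[OF pc(1)])
  have one: "\<one> \<notin> PIdl p"
  proof
    assume "\<one> \<in> PIdl p"
    then obtain r where "r \<in> carrier R" "\<one> = r \<otimes> p" using in_PIdl_iff by blast
    then show False using pc m_comm unfolding Units_def by auto
  qed
  have sub: "I \<subseteq> PIdl p" if I: "ideal I R" "I \<noteq> carrier R" for I
  proof
    fix x assume x: "x \<in> I"
    have xc: "x \<in> carrier R" using x ideal_subset[OF I(1)] by blast
    have "x \<notin> Units R"
    proof
      assume u: "x \<in> Units R"
      then have "x \<otimes> inv x \<in> I" using prod_in_ideal(1)[OF I(1) x] Units_inv_closed[OF u] by blast
      then show False using ideal.one_imp_carrier[OF I(1)] u I(2) by simp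
    qed
    then show "x \<in> PIdl p" using nu xc by blast
  qed
  show max: "maximalideal (PIdl p) R"
  proof (rule maximalidealI[OF P])
    show "carrier R \<noteq> PIdl p" using one one_closed by blast
    show "J = PIdl p \<or> J = carrier R" if "ideal J R" "PIdl p \<subseteq> J" for J
      using sub[OF that(1)] that(2) by blast
  qed
  have uniq: "N = PIdl p" if N: "maximalideal N R" for N
  proof -
    have "N \<subseteq> PIdl p" using sub maximalideal.axioms(1)[OF N] maximalideal.I_notcarr[OF N] by blast
    then show ?thesis using maximalideal.I_maximal[OF N P] ideal_subset[OF P] one one_closed by blast
  qed
  have "local_ring R" unfolding local_ring_def using is_cring max uniq by blast
  moreover have "\<not> field R" using field.field_Units pc by fastforce
  ultimately show "DVR R" unfolding DVR_def using pd by blast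
qed

end

lemma (in domain) field_iff_zero_maximal: "field R \<longleftrightarrow> maximalideal {\<zero>} R"
  using zeromaximalideal_eq_field by blast

lemma local_domainI:
  assumes "domain R" "local_ring R" "maximalideal M R" "\<not> field R"
  shows "local_domain R M"
proof -
  interpret domain R by fact
  have "M \<noteq> {\<zero>\<^bsub>R\<^esub>}" using assms(3,4) field_iff_zero_maximal by (metis (no_types))
  then show ?thesis
  proof (intro local_domain.intro local_domain_axioms.intro)
    show "N = M" if "maximalideal N R" for N
      using that assms(2,3) unfolding local_ring_def by (metis (no_types))
  qed (use domain_axioms assms(3) in blast)+
qed

text \<open>The point is that the powers of \<open>p\<close> have zero intersection. This
  intersection is principal, say \<open>gR\<close>; writing \<open>g = h p\<close>, the element
  \<open>h\<close> is again in it, so \<open>h = s g\<close> and \<open>g = (s p) g\<close>, whence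
  \<open>g = 0\<close> by Nakayama.\<close>

lemma uniformizer_of_DVR:
  fixes R (structure)
  assumes "DVR R" "maximalideal M R"
  shows "\<exists>p. domain.uniformizer R p \<and> M = PIdl p"
proof -
  interpret principal_domain R using assms unfolding DVR_def by blast
  interpret local_domain R M using local_domainI[OF domain_axioms] assms unfolding DVR_def by blast
  obtain p where pc: "p \<in> carrier R" and Mp: "M = PIdl p" using exists_gen[OF ideal_M] by blast
  have pM: "p \<in> M" using Mp cgenideal_self[OF pc] by blast
  have pz: "p \<noteq> \<zero>"
    using not_field Mp PIdl_zero by metis
  define I where "I = (\<Inter>n::nat. PIdl (p [^] n))"
  have I: "ideal I R" unfolding I_def by (rule i_Intersect) (use cgenideal_ideal pc in auto)
  then obtain g where g: "g \<in> carrier R" "I = PIdl g" using exists_gen by blast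
  have gI: "g \<in> I" using g cgenideal_self by blast
  have pow: "\<exists>r\<in>carrier R. g = r \<otimes> p [^] n" for n :: nat
  proof -
    have "g \<in> PIdl (p [^] n)" using gI unfolding I_def by (rule INT_D) simp
    then show ?thesis unfolding in_PIdl_iff .
  qed
  obtain h where h: "h \<in> carrier R" "g = h \<otimes> p" using pow[of 1] pc by auto
  have "h \<in> PIdl (p [^] n)" for n :: nat
  proof -
    obtain r where r: "r \<in> carrier R" "g = r \<otimes> p [^] Suc n" using pow by blast
    then have "h \<otimes> p = (r \<otimes> p [^] n) \<otimes> p" using h pc by (simp add: m_assoc)
    then have "h = r \<otimes> p [^] n" using m_rcancel[OF pz pc h(1)] r(1) pc by simp
    then show ?thesis using in_PIdl_iff r(1) by auto
  qed
  then have "h \<in> I" unfolding I_def by (rule INT_I)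
  then have "h \<in> PIdl g" unfolding g(2) .
  then obtain s where s: "s \<in> carrier R" "h = s \<otimes> g" using in_PIdl_iff by blast
  have "g = \<zero> \<oplus> (s \<otimes> p) \<otimes> g"
  proof -
    have "g = s \<otimes> g \<otimes> p" by (subst s(2)[symmetric]) (rule h(2))
    also have "\<dots> = \<zero> \<oplus> (s \<otimes> p) \<otimes> g" using s(1) g(1) pc by (simp add: m_ac)
    finally show ?thesis .
  qed
  then have "g \<in> {\<zero>}" using nakayama_element[OF zeroideal M_mult(2)[OF pM s(1)] g(1)] by blast
  then have I0: "I = {\<zero>}" unfolding g(2) using PIdl_zero by simp
  have "\<exists>n::nat. \<exists>e\<in>Units R. x = p [^] n \<otimes> e" if x: "x \<in> carrier R" "x \<noteq> \<zero>" for x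
  proof -
    have ex: "\<exists>n::nat. x \<notin> PIdl (p [^] n)" using x I0 unfolding I_def by auto
    \<comment> \<open>The least power of \<open>p\<close> not dividing \<open>x\<close> is nonzero,
      and the exponent below it is the value of \<open>x\<close>: the cofactor is not divisible by
      \<open>p\<close>, hence a unit.\<close>
    define n where "n = (LEAST n::nat. x \<notin> PIdl (p [^] n))"
    have n: "x \<notin> PIdl (p [^] n)" unfolding n_def by (rule LeastI_ex[OF ex])
    have "n \<noteq> 0"
    proof
      assume "n = 0"
      then have "x \<notin> PIdl \<one>" using n by simp
      moreover have "x = x \<otimes> \<one>" using x by simp
      ultimately show False using x(1) unfolding in_PIdl_iff by blast
    qed
    then obtain k where k: "n = Suc k" using not0_implies_Suc by blast
    have "x \<in> PIdl (p [^] k)" using not_less_Least[of k "\<lambda>n. x \<notin> PIdl (p [^] n)"] k unfolding n_def by auto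
    then obtain e where e: "e \<in> carrier R" "x = e \<otimes> p [^] k" using in_PIdl_iff by blast
    have "e \<notin> M"
    proof
      assume "e \<in> M"
      then obtain r where r: "r \<in> carrier R" "e = r \<otimes> p" using Mp in_PIdl_iff by blast
      then have "x = r \<otimes> p [^] n" unfolding e(2) k using pc by (simp add: m_ac)
      then show False using n in_PIdl_iff r by blast
    qed
    then have "e \<in> Units R" using in_M_iff e by blast
    moreover have "x = p [^] k \<otimes> e" using e pc m_comm by simp
    ultimately show ?thesis by blast
  qed
  then have "uniformizer p" unfolding uniformizer_def using pc pz pM in_M_iff by blast
  then show ?thesis using Mp by blast
qed

lemma (in field) Units_subring:
  assumes "subring V R"
  shows "Units (R\<lparr>carrier := V\<rparr>) = {e \<in> V. e \<noteq> \<zero> \<and> inv e \<in> V}"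
proof -
  note V = subringE[OF assms]
  have "inv e \<in> V" if "e \<in> V" "f \<in> V" "f \<otimes> e = \<one>" for e f
    using that V(1) comm_inv_char[of e f] m_comm by (metis subsetD)
  moreover have "e \<noteq> \<zero>" if "e \<in> V" "f \<in> V" "f \<otimes> e = \<one>" for e f
    using that V(1) by (metis r_null subsetD zero_not_one)
  moreover have "inv e \<otimes> e = \<one> \<and> e \<otimes> inv e = \<one>" if "e \<in> V" "e \<noteq> \<zero>" for e
    using that V(1) field_Units by auto
  ultimately show ?thesis unfolding Units_def by auto blast+
qed

lemma (in primeideal) prime_power:
  assumes "x \<in> carrier R" shows "x [^] (n::nat) \<in> I \<Longrightarrow> x \<in> I"
proof (induction n)
  case 0 then show ?case using one_imp_carrier I_notcarr by simp
next
  case (Suc n)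
  then show ?case using I_prime[of "x [^] n" x] assms by auto
qed

text \<open>The setting in which everything about \<open>A\<close> is computed by values in
  \<open>V\<close>. A uniformizer is assumed in place of the DVR property so that these values are
  at hand. That \<open>V\<close> is both \<open>(M : M)\<close> and the complete integral closure of
  \<open>A\<close> is derived in \<open>colon_M\<close> and
  \<open>complete_integral_closure_D\<close>.\<close>

locale dvr_overring = field K for K (structure) +
  fixes A V M p
  assumes subring_A: "subring A K" and subring_V: "subring V K" and A_subset_V: "A \<subseteq> V"
    and fraction: "\<And>x. x \<in> carrier K \<Longrightarrow> \<exists>a\<in>A. \<exists>b\<in>A - {\<zero>}. x = a \<otimes> inv b"
    and unif: "domain.uniformizer (K\<lparr>carrier := V\<rparr>) p"
    and M_eq: "M = {p \<otimes> v | v. v \<in> V}" and M_subset_A: "M \<subseteq> A"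
    and local_A: "local_domain (K\<lparr>carrier := A\<rparr>) M"
begin

abbreviation "D \<equiv> K\<lparr>carrier := A\<rparr>"

sublocale A: local_domain "K\<lparr>carrier := A\<rparr>" M
  rewrites "carrier (K\<lparr>carrier := A\<rparr>) = A"
    and "monoid.mult (K\<lparr>carrier := A\<rparr>) = monoid.mult K" and "monoid.one (K\<lparr>carrier := A\<rparr>) = monoid.one K"
    and "ring.zero (K\<lparr>carrier := A\<rparr>) = ring.zero K" and "ring.add (K\<lparr>carrier := A\<rparr>) = ring.add K"
  using local_A by simp_all

sublocale V: domain "K\<lparr>carrier := V\<rparr>"
  rewrites "carrier (K\<lparr>carrier := V\<rparr>) = V"
    and "monoid.mult (K\<lparr>carrier := V\<rparr>) = monoid.mult K" and "monoid.one (K\<lparr>carrier := V\<rparr>) = monoid.one K"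
    and "ring.zero (K\<lparr>carrier := V\<rparr>) = ring.zero K" and "ring.add (K\<lparr>carrier := V\<rparr>) = ring.add K"
  using subring_is_domain[OF subring_V] by simp_all

definition "U = {e \<in> V. e \<noteq> \<zero> \<and> inv e \<in> V}"

lemma V_carr [simp]: "x \<in> V \<Longrightarrow> x \<in> carrier K"
  using subringE(1)[OF subring_V] by blast

lemma A_V [simp]: "x \<in> A \<Longrightarrow> x \<in> V" using A_subset_V by blast
lemma M_A [simp]: "x \<in> M \<Longrightarrow> x \<in> A" using M_subset_A by blast
lemma U_V [simp]: "e \<in> U \<Longrightarrow> e \<in> V" unfolding U_def by blast
lemma U_nonzero: "e \<in> U \<Longrightarrow> e \<noteq> \<zero>" unfolding U_def by blast

lemma Units_V: "Units (K\<lparr>carrier := V\<rparr>) = U"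
  unfolding U_def using Units_subring[OF subring_V] .

lemma Units_A: "Units D = {e \<in> A. e \<noteq> \<zero> \<and> inv e \<in> A}"
  using Units_subring[OF subring_A] .

lemma U_carr [simp]: "e \<in> U \<Longrightarrow> e \<in> carrier K" by simp

lemma field_inv [simp]:
  assumes "x \<in> carrier K" "x \<noteq> \<zero>"
  shows "inv x \<in> carrier K" "inv x \<noteq> \<zero>" "inv x \<otimes> x = \<one>" "x \<otimes> inv x = \<one>" "inv (inv x) = x"
proof -
  have x: "x \<in> Units K" using assms field_Units by blast
  show "inv x \<in> carrier K" "inv x \<otimes> x = \<one>" "x \<otimes> inv x = \<one>" "inv (inv x) = x" using x by simp_all
  show "inv x \<noteq> \<zero>" using Units_inv_Units[OF x] field_Units by blast
qed

lemma U_inv: "e \<in> U \<Longrightarrow> inv e \<in> U" unfolding U_def by simp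

lemma U_cancel [simp]: "e \<in> U \<Longrightarrow> inv e \<otimes> e = \<one>" "e \<in> U \<Longrightarrow> e \<otimes> inv e = \<one>"
  using U_nonzero by simp_all

lemma U_inv_V [simp]: "e \<in> U \<Longrightarrow> inv e \<in> V" unfolding U_def by blast

lemma U_I: "x \<in> V \<Longrightarrow> y \<in> V \<Longrightarrow> x \<otimes> y = \<one> \<Longrightarrow> x \<in> U"
  unfolding U_def using comm_inv_char[of x y] l_null[of y] by auto

lemma p_V [simp]: "p \<in> V" and p_nonzero: "p \<noteq> \<zero>" and p_notin_U: "p \<notin> U"
  using unif Units_V unfolding V.uniformizer_def by blast+

lemma p_pow_V [simp]: "p [^] (n::nat) \<in> V"
  by (induction n) simp_all

lemma V_pow [simp]: "x \<in> V \<Longrightarrow> x [^] (n::nat) \<in> V"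
  by (induction n) simp_all

lemma p_pow_nonzero [simp]: "p [^] (n::nat) \<noteq> \<zero>"
  by (induction n) (simp_all add: integral_iff p_nonzero)

lemma rep:
  assumes "x \<in> V" "x \<noteq> \<zero>" shows "\<exists>n::nat. \<exists>e\<in>U. x = p [^] n \<otimes> e"
  using unif assms unfolding V.uniformizer_def Units_V by (simp flip: nat_pow_consistent)

lemma minimal_element:
  assumes "S \<subseteq> V" "x \<in> S" "x \<noteq> \<zero>"
  shows "\<exists>n::nat. \<exists>e\<in>U. p [^] n \<otimes> e \<in> S \<and> (\<forall>y\<in>S. \<exists>v\<in>V. y = p [^] n \<otimes> v)"
  using V.uniformizer_minimal[OF unif assms] unfolding Units_V by (simp flip: nat_pow_consistent)

lemma p_mult_M: "v \<in> V \<Longrightarrow> p \<otimes> v \<in> M" unfolding M_eq by blast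

lemma M_E: "m \<in> M \<Longrightarrow> \<exists>v\<in>V. m = p \<otimes> v" unfolding M_eq by blast

lemma p_M: "p \<in> M" using p_mult_M[of \<one>] by simp

lemma M_mult_V: "m \<in> M \<Longrightarrow> v \<in> V \<Longrightarrow> m \<otimes> v \<in> M" 
proof -
  assume "m \<in> M" "v \<in> V"
  then obtain w where "w \<in> V" "m = p \<otimes> w" using M_E by blast
  then show "m \<otimes> v \<in> M" using p_mult_M[of "w \<otimes> v"] \<open>v \<in> V\<close> by (simp add: m_assoc)
qed

lemma U_notin_M: "e \<in> U \<Longrightarrow> e \<notin> M"
proof
  assume e: "e \<in> U" "e \<in> M"
  have "e \<otimes> inv e \<in> M" by (rule M_mult_V[OF e(2) U_inv_V[OF e(1)]])
  then show False using e A.one_notin_M by simp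
qed

lemma V_cases:
  assumes "x \<in> V" shows "x \<in> M \<or> x \<in> U"
proof (cases "x = \<zero>")
  case True then show ?thesis using ideal_zero A.M_nonunits p_mult_M[of \<zero>] by simp
next
  case False
  then obtain n :: nat and e where e: "e \<in> U" "x = p [^] n \<otimes> e" using rep assms by blast
  show ?thesis
  proof (cases n)
    case 0 then show ?thesis using e by simp
  next
    case (Suc k)
    then have "x = p \<otimes> (p [^] k \<otimes> e)" using e by (simp add: m_ac)
    then show ?thesis using p_mult_M[of "p [^] k \<otimes> e"] e by simp
  qed
qed

text \<open>A nonunit of \<open>A\<close> lies in \<open>M = pV\<close>, which contains no unit of
  \<open>V\<close>.\<close>

lemma U_A_inv:
  assumes "x \<in> U" "x \<in> A" shows "inv x \<in> A"
  using A.in_M_iff[OF assms(2)] U_notin_M[OF assms(1)] Units_A by blast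

text \<open>Comparing the values of numerator and denominator: if \<open>x\<close> is outside
  \<open>V\<close>, the denominator has strictly larger value, and this strictness puts the inverse
  into \<open>M\<close> and not only into \<open>V\<close>.\<close>

lemma valuation:
  assumes x: "x \<in> carrier K" "x \<notin> V" shows "x \<noteq> \<zero>" "inv x \<in> M"
proof -
  show nz: "x \<noteq> \<zero>" using x(2) by auto
  obtain a b where ab: "a \<in> A" "b \<in> A" "b \<noteq> \<zero>" "x = a \<otimes> inv b" using fraction[OF x(1)] by blast
  have az: "a \<noteq> \<zero>" using nz ab by auto
  obtain n :: nat and e where e: "e \<in> U" "a = p [^] n \<otimes> e" using rep[of a] ab az by auto
  obtain m :: nat and f where f: "f \<in> U" "b = p [^] m \<otimes> f" using rep[of b] ab by auto
  have xb: "x \<otimes> b = a" unfolding ab(4) using ab(1-3) by (simp add: m_assoc)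
  have "\<not> m \<le> n"
  proof
    assume "m \<le> n"
    then obtain k where k: "n = m + k" using le_Suc_ex by blast
    have "p [^] n = p [^] m \<otimes> p [^] k" unfolding k using nat_pow_mult[of p m k] by simp
    moreover have "(p [^] k \<otimes> e \<otimes> inv f) \<otimes> b = (p [^] m \<otimes> p [^] k) \<otimes> e \<otimes> (inv f \<otimes> f)"
      unfolding f(2) using e(1) f(1) by (simp add: m_ac del: U_cancel)
    ultimately have "(p [^] k \<otimes> e \<otimes> inv f) \<otimes> b = a" unfolding e(2) using e(1) f(1) by simp
    then have "x = p [^] k \<otimes> e \<otimes> inv f"
      using m_rcancel[OF ab(3), of x "p [^] k \<otimes> e \<otimes> inv f"] xb x(1) ab(2) e(1) f(1) by simp
    then show False using x(2) e(1) f(1) by simp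
  qed
  then obtain k where k: "m = n + Suc k" using less_imp_Suc_add[of n m] by auto
  have pm: "p [^] m = p [^] n \<otimes> (p \<otimes> p [^] k)"
    unfolding k using nat_pow_mult[of p n "Suc k"] by (simp add: m_ac)
  \<comment> \<open>This is \<open>b\<close> divided by \<open>a\<close>, read off from the two
    representations.\<close>
  define y where "y = p \<otimes> (p [^] k \<otimes> (f \<otimes> inv e))"
  have yV: "y \<in> V" unfolding y_def using e(1) f(1) by simp
  have "a \<otimes> y = p [^] n \<otimes> (p \<otimes> p [^] k) \<otimes> f \<otimes> (e \<otimes> inv e)"
    unfolding y_def e(2) using e(1) f(1) by (simp add: m_ac del: U_cancel)
  then have "a \<otimes> y = b" unfolding f(2) pm using e(1) f(1) by simp
  moreover have "(x \<otimes> y) \<otimes> b = (x \<otimes> b) \<otimes> y" using x(1) yV ab(2) by (simp add: m_ac)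
  ultimately have "(x \<otimes> y) \<otimes> b = \<one> \<otimes> b" using xb ab(2) by simp
  then have "x \<otimes> y = \<one>" using m_rcancel[OF ab(3), of "x \<otimes> y" \<one>] x(1) yV ab(2) by simp
  then have "inv x = y" using comm_inv_char[of x y] x(1) yV by simp
  then show "inv x \<in> M" using p_mult_M[of "p [^] k \<otimes> (f \<otimes> inv e)"] e(1) f(1) unfolding y_def by simp
qed

lemma val_unique:
  assumes "e \<in> U" "f \<in> U" "p [^] (n::nat) \<otimes> e = p [^] (m::nat) \<otimes> f" shows "n = m"
proof -
  have *: False if h: "e \<in> U" "f \<in> U" "p [^] (n::nat) \<otimes> e = p [^] (n + Suc k) \<otimes> f" for e f n k
  proof -
    have "p [^] (n + Suc k) \<otimes> f = p [^] n \<otimes> (p \<otimes> (p [^] k \<otimes> f))"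
      using nat_pow_mult[of p n "Suc k", symmetric] h(2) by (simp add: m_ac)
    then have "e = p \<otimes> (p [^] k \<otimes> f)"
      using m_lcancel[of "p [^] n" e "p \<otimes> (p [^] k \<otimes> f)"] h by simp
    then have "e \<in> M" using p_mult_M[of "p [^] k \<otimes> f"] h(2) by simp
    then show False using U_notin_M h(1) by blast
  qed
  show ?thesis
  proof (rule linorder_cases[of n m])
    assume "n < m"
    then obtain k where "m = n + Suc k" using less_imp_Suc_add by auto
    then show ?thesis using *[of e f n k] assms by blast
  next
    assume "m < n"
    then obtain k where "n = m + Suc k" using less_imp_Suc_add by auto
    then show ?thesis using *[of f e m k] assms by auto
  qed
qed

end

section \<open>Factorizations, ideals and closures of \<open>D\<close> computed by values\<close>

context dvr_overring
begin

lemma one_U: "\<one> \<in> U"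
  by (rule U_I[of \<one> \<one>]) simp_all

text \<open>The irreducible elements are those of value one. An element \<open>p \<otimes> v\<close>
  with \<open>v\<close> in \<open>M\<close> splits into the nonunits \<open>p\<close> and
  \<open>v\<close> of \<open>A\<close>; conversely a product of two elements of \<open>M\<close>
  lies in \<open>pM\<close>.\<close>

lemma A_irreducible_iff:
  "u \<in> A \<Longrightarrow> ring_irreducible\<^bsub>D\<^esub> u \<longleftrightarrow> (\<exists>e\<in>U. u = p \<otimes> e)"
proof
  assume u: "u \<in> A" "ring_irreducible\<^bsub>D\<^esub> u"
  then have irr: "u \<in> M" "\<And>a b. a \<in> M \<Longrightarrow> b \<in> M \<Longrightarrow> u \<noteq> a \<otimes> b"
    using A.ring_irreducible_iff by auto
  obtain v where v: "v \<in> V" "u = p \<otimes> v" using M_E irr(1) by blast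
  then have "v \<in> U" using V_cases irr(2) p_M by blast
  then show "\<exists>e\<in>U. u = p \<otimes> e" using v by blast
next
  assume "u \<in> A" "\<exists>e\<in>U. u = p \<otimes> e"
  then obtain e where e: "e \<in> U" "u = p \<otimes> e" by blast
  have "u \<noteq> a \<otimes> b" if ab: "a \<in> M" "b \<in> M" for a b
  proof
    assume uab: "u = a \<otimes> b"
    obtain v where v: "v \<in> V" "a = p \<otimes> v" using M_E ab by blast
    have "p \<otimes> e = p \<otimes> (b \<otimes> v)" using uab e(2) v ab by (simp add: m_ac)
    then have "e = b \<otimes> v" using m_lcancel[of p e "b \<otimes> v"] e v ab p_nonzero by simp
    then show False using M_mult_V ab v U_notin_M e by blast
  qed
  moreover have "u \<in> M" using e p_mult_M by simp
  moreover have "u \<noteq> \<zero>" using e U_nonzero p_nonzero by (simp add: integral_iff)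
  ultimately show "ring_irreducible\<^bsub>D\<^esub> u" using A.ring_irreducible_iff \<open>u \<in> A\<close> by blast
qed

lemma p_irreducible: "ring_irreducible\<^bsub>D\<^esub> p"
proof -
  have "p = p \<otimes> \<one>" by simp
  then show ?thesis using A_irreducible_iff[of p] p_M one_U by (metis M_A)
qed

lemma p_mult_U_A: "e \<in> U \<Longrightarrow> p \<otimes> e \<in> A"
  using p_mult_M by simp

lemma irreducible_factorization_exists:
  "e \<in> U \<Longrightarrow> \<exists>us. irreducible_factorization D us (p [^] Suc n \<otimes> e)"
proof (induction n)
  case 0
  then show ?case using A.irreducible_factorization_single[of "p \<otimes> e"] p_mult_U_A A_irreducible_iff by auto
next
  case (Suc n)
  obtain us where us: "irreducible_factorization D us (p [^] Suc n \<otimes> e)" using Suc by blast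
  have "irreducible_factorization D [p] p"
    using A.irreducible_factorization_single[of p] p_M p_irreducible by simp
  from A.irreducible_factorization_append[OF this us]
  have "irreducible_factorization D ([p] @ us) (p [^] Suc (Suc n) \<otimes> e)" using Suc.prems by (simp add: m_ac)
  then show ?case by blast
qed

text \<open>Each irreducible factor contributes one to the value, so the length is the value of
  \<open>a\<close>; with \<open>val_unique\<close> this gives half-factoriality.\<close>

lemma irreducible_factorization_length:
  "irreducible_factorization D us a \<Longrightarrow> \<exists>e\<in>U. a = p [^] length us \<otimes> e"
proof (induction us arbitrary: a)
  case Nil
  then have a: "a = \<one>" unfolding irreducible_factorization_def by simp
  show ?case unfolding a by (rule bexI[OF _ one_U]) simp
next
  case (Cons u us)
  define b where "b = foldr (\<otimes>) us \<one>"
  have h: "u \<in> A" "ring_irreducible\<^bsub>D\<^esub> u" "irreducible_factorization D us b" "a = u \<otimes> b"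
    using Cons.prems unfolding irreducible_factorization_def b_def by auto
  obtain e where e: "e \<in> U" "u = p \<otimes> e" using h A_irreducible_iff by blast
  obtain f where f: "f \<in> U" "b = p [^] length us \<otimes> f" using Cons.IH[OF h(3)] by blast
  have "e \<otimes> f \<in> U"
  proof (rule U_I)
    show "(e \<otimes> f) \<otimes> (inv e \<otimes> inv f) = \<one>"
    proof -
      have "(e \<otimes> f) \<otimes> (inv e \<otimes> inv f) = (e \<otimes> inv e) \<otimes> (f \<otimes> inv f)"
        using e f by (simp add: m_ac del: U_cancel)
      then show ?thesis using e f by simp
    qed
  qed (use e f in simp_all)
  moreover have "a = p [^] length (u # us) \<otimes> (e \<otimes> f)"
    unfolding h(4) e(2) f(2) using e(1) f(1) by (simp add: m_ac)
  ultimately show ?case by blast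
qed

lemma M_rep:
  assumes "x \<in> M" "x \<noteq> \<zero>" shows "\<exists>n::nat. \<exists>e\<in>U. x = p [^] Suc n \<otimes> e"
proof -
  obtain n :: nat and e where e: "e \<in> U" "x = p [^] n \<otimes> e" using rep[of x] assms by auto
  have "n \<noteq> 0" using e U_notin_M assms(1) by (intro notI) simp
  then show ?thesis using e not0_implies_Suc by blast
qed

lemma atomic: "atomic_domain D"
  unfolding atomic_domain_def
proof (intro conjI ballI)
  show "domain D" by (rule A.domain_axioms)
  fix a assume "a \<in> carrier D - {\<zero>\<^bsub>D\<^esub>} - Units D"
  then have "a \<in> M" "a \<noteq> \<zero>" using A.M_nonunits by auto
  then show "\<exists>us. irreducible_factorization D us a" using M_rep irreducible_factorization_exists by metis
qed

lemma half_factorial: "half_factorial_domain D"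
  unfolding half_factorial_domain_def
  using atomic irreducible_factorization_length val_unique by metis

text \<open>Of the two factors \<open>p\<close> in \<open>x \<otimes> y\<close> one goes into
  \<open>p \<otimes> e\<close>. The other makes the quotient an element of \<open>pV = M\<close>, so
  that it lies in \<open>A\<close>.\<close>

lemma square_divisible:
  assumes "x \<in> M" "y \<in> M" "e \<in> U" shows "x \<otimes> y \<in> PIdl\<^bsub>D\<^esub> (p \<otimes> e)"
proof -
  obtain v w where v: "v \<in> V" "x = p \<otimes> v" "w \<in> V" "y = p \<otimes> w" using M_E assms by meson
  have "x \<otimes> y = (p \<otimes> (v \<otimes> w \<otimes> inv e)) \<otimes> p \<otimes> (inv e \<otimes> e) \<otimes> e"
  proof -
    have "(p \<otimes> (v \<otimes> w \<otimes> inv e)) \<otimes> p \<otimes> (inv e \<otimes> e) \<otimes> e = p \<otimes> v \<otimes> (p \<otimes> w) \<otimes> (inv e \<otimes> e) \<otimes> (inv e \<otimes> e)"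
      using v assms(3) by (simp add: m_ac del: U_cancel)
    then show ?thesis using v assms(3) by simp
  qed
  then have "x \<otimes> y = (p \<otimes> (v \<otimes> w \<otimes> inv e)) \<otimes> (p \<otimes> e)" using v assms(3) by (simp add: m_assoc)
  moreover have "p \<otimes> (v \<otimes> w \<otimes> inv e) \<in> A" using p_mult_M v assms(3) by simp
  ultimately show ?thesis using A.in_PIdl_iff by blast
qed

lemma irreducible_OA:
  assumes "u \<in> A" "ring_irreducible\<^bsub>D\<^esub> u" shows "OA_ideal (PIdl\<^bsub>D\<^esub> u) D"
proof -
  obtain e where e: "e \<in> U" "u = p \<otimes> e" using assms A_irreducible_iff by blast
  show ?thesis
  proof (rule A.OA_idealI)
    show "ideal (PIdl\<^bsub>D\<^esub> u) D" by (rule A.cgenideal_ideal[OF assms(1)])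
    show "PIdl\<^bsub>D\<^esub> u \<subseteq> M" using A.cgenideal_minimal[OF A.ideal_M] p_mult_M e by simp
  qed (use square_divisible e in blast)
qed

lemma krull_dim_one: "krull_dim D = 1"
  unfolding A.krull_dim_one_iff
proof (intro allI impI)
  fix P assume prime: "primeideal P D"
  have P: "ideal P D" by (rule primeideal.axioms(1)[OF prime])
  have PA: "P \<subseteq> A" using A.ideal_subset[OF P] .
  show "P = {\<zero>} \<or> P = M"
  proof (rule disjCI)
    assume "P \<noteq> M"
    show "P = {\<zero>}"
    proof (rule ccontr)
      assume "P \<noteq> {\<zero>}"
      then obtain a where a: "a \<in> P" "a \<noteq> \<zero>" using A.ideal_zero[OF P] by blast
      obtain n :: nat and e where e: "e \<in> U" "a = p [^] n \<otimes> e" using rep[of a] a PA A_subset_V by blast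
      have "M \<subseteq> P"
      proof
        fix m assume m: "m \<in> M"
        then obtain v where v: "v \<in> V" "m = p \<otimes> v" using M_E by blast
        \<comment> \<open>The exponent exceeds the value \<open>n\<close> of \<open>a\<close> by
          one: after division by \<open>a\<close> a factor \<open>p\<close> is left, which puts the
          quotient into \<open>M \<subseteq> A\<close>.\<close>
        have "m [^] Suc n = p [^] Suc n \<otimes> v [^] Suc n"
          unfolding v(2) using nat_pow_distrib[of p v "Suc n"] v(1) by simp
        also have "\<dots> = (p \<otimes> (v [^] Suc n \<otimes> inv e)) \<otimes> a"
        proof -
          have "(p \<otimes> (v [^] Suc n \<otimes> inv e)) \<otimes> a = p [^] Suc n \<otimes> v [^] Suc n \<otimes> (inv e \<otimes> e)"
            unfolding e(2) using v(1) e(1) by (simp add: m_ac del: U_cancel)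
          then show ?thesis using v(1) e(1) by simp
        qed
        also have "\<dots> \<in> P"
          using ideal.I_l_closed[OF P a(1), of "p \<otimes> (v [^] Suc n \<otimes> inv e)"] p_mult_M v(1) e(1) by simp
        finally have "m [^] Suc n \<in> P" .
        then show "m \<in> P"
          using primeideal.prime_power[OF prime, of m "Suc n"] m by (simp flip: nat_pow_consistent)
      qed
      then show False using A.prime_subset_M[OF prime] \<open>P \<noteq> M\<close> by blast
    qed
  qed
qed

text \<open>With \<open>n + 1\<close> the least valuation of an element of \<open>I\<close>, the ideal \<open>p\<^bsup>-n\<^esup>I\<close> lies between
  \<open>M\<^sup>2\<close> and \<open>M\<close>, so it is an OA-ideal, and \<open>I = (pA)\<^sup>n p\<^bsup>-n\<^esup>I\<close>.\<close>

lemma OAF: "OAF_domain D"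
  unfolding OAF_domain_def
proof (intro conjI allI impI)
  show "domain D" by (rule A.domain_axioms)
  fix I assume "proper_ideal I D"
  then have I: "ideal I D" "I \<subseteq> M" using A.proper_ideal_iff by auto
  show "has_OA_factorization I D"
  proof (cases "I = {\<zero>}")
    case True
    then have OA: "OA_ideal I D" using A.OA_ideal_prime A.zeroprimeideal by simp
    have "I = ideal_list_prod D [I]"
      using A.ideal_prod_one[OF I(1)] unfolding ideal_list_prod_def by simp
    then show ?thesis unfolding has_OA_factorization_def using OA
      by (intro exI[of _ "[I]"]) simp
  next
    case False
    have IV: "I \<subseteq> V" using I(2) M_subset_A A_subset_V by blast
    obtain x where x: "x \<in> I" "x \<noteq> \<zero>" using False A.ideal_zero[OF I(1)] by blast
    obtain m :: nat and e where e: "e \<in> U" "p [^] m \<otimes> e \<in> I" and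
      min: "\<And>y. y \<in> I \<Longrightarrow> \<exists>v\<in>V. y = p [^] m \<otimes> v" using minimal_element[OF IV x] by blast
    have "m \<noteq> 0" using e I(2) U_notin_M by (intro notI) auto
    then obtain n where n: "m = Suc n" using not0_implies_Suc by blast
    \<comment> \<open>The restriction to \<open>M\<close> loses nothing, since every element of
      \<open>I\<close> has value at least \<open>m = Suc n\<close>.\<close>
    define J where "J = {x \<in> M. p [^] n \<otimes> x \<in> I}"
    have J: "ideal J D"
    proof (rule A.ideal_closedI)
      show "J \<subseteq> A" unfolding J_def using M_subset_A by blast
      show "\<zero> \<in> J" unfolding J_def using A.ideal_zero[OF I(1)] A.ideal_zero[OF A.ideal_M] by simp
      show "x \<oplus> y \<in> J" if "x \<in> J" "y \<in> J" for x y
        using that A.M_add A.ideal_add_closed[OF I(1)] unfolding J_def by (auto simp: r_distr)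
      show "x \<otimes> y \<in> J" if xy: "x \<in> A" "y \<in> J" for x y
      proof -
        have "x \<otimes> (p [^] n \<otimes> y) \<in> I" using xy A.prod_in_ideal(2)[OF I(1)] unfolding J_def by blast
        then have "p [^] n \<otimes> (x \<otimes> y) \<in> I" using xy unfolding J_def by (simp add: m_ac)
        then show ?thesis using xy A.M_mult(2) unfolding J_def by blast
      qed
    qed
    have JOA: "OA_ideal J D"
    proof (rule A.OA_idealI[OF J])
      show "J \<subseteq> M" unfolding J_def by blast
      fix x y assume xy: "x \<in> M" "y \<in> M"
      obtain v w where v: "v \<in> V" "x = p \<otimes> v" "w \<in> V" "y = p \<otimes> w" using M_E xy by meson
      have "p [^] n \<otimes> (x \<otimes> y) = (p \<otimes> (v \<otimes> w \<otimes> inv e)) \<otimes> (p [^] m \<otimes> e)"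
      proof -
        have "(p \<otimes> (v \<otimes> w \<otimes> inv e)) \<otimes> (p [^] m \<otimes> e) = p [^] n \<otimes> (p \<otimes> v \<otimes> (p \<otimes> w)) \<otimes> (inv e \<otimes> e)"
          unfolding n using v(1,3) e(1) by (simp add: m_ac del: U_cancel)
        then show ?thesis using v e(1) by simp
      qed
      also have "\<dots> \<in> I"
        using A.prod_in_ideal(2)[OF I(1) e(2)] p_mult_M v(1,3) e(1) by simp
      finally show "x \<otimes> y \<in> J" unfolding J_def using A.M_mult(1) xy by simp
    qed
    have pOA: "OA_ideal (PIdl\<^bsub>D\<^esub> p) D"
      using irreducible_OA[of p] p_irreducible p_M by simp
    have pid: "ideal (PIdl\<^bsub>D\<^esub> p) D" using A.OA_ideal_ideal(1)[OF pOA] .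
    \<comment> \<open>\<open>J\<close> stays fixed while the number of factors grows. It also keeps
      the list nonempty when \<open>n\<close> is 0.\<close>
    have prod: "ideal_list_prod D (replicate k (PIdl\<^bsub>D\<^esub> p) @ [J]) = {p [^] k \<otimes> x | x. x \<in> J}" for k
    proof (induction k)
      case 0
      have "{\<one> \<otimes> x | x. x \<in> J} = J" using A.ideal_subset[OF J] by force
      then show ?case using A.ideal_prod_one[OF J] unfolding ideal_list_prod_def by simp
    next
      case (Suc k)
      define L where "L = ideal_list_prod D (replicate k (PIdl\<^bsub>D\<^esub> p) @ [J])"
      have L: "ideal L D" unfolding L_def
        by (rule A.ideal_list_prod_ideal) (use J pid in auto)
      have Jc: "\<And>x. x \<in> J \<Longrightarrow> x \<in> A" using A.ideal_subset[OF J] by blast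
      have Leq: "L = {p [^] k \<otimes> x | x. x \<in> J}" unfolding L_def by (rule Suc)
      have "ideal_prod D (PIdl\<^bsub>D\<^esub> p) L = {p [^] Suc k \<otimes> x | x. x \<in> J}" (is "_ = ?R")
      proof
        have R: "ideal ?R D"
        proof (rule A.ideal_closedI)
          show "?R \<subseteq> A"
          proof
            fix y assume "y \<in> ?R"
            then obtain x where x: "x \<in> J" "y = p [^] Suc k \<otimes> x" by blast
            then have "y = p \<otimes> (p [^] k \<otimes> x)" using Jc by (simp add: m_ac)
            then show "y \<in> A" using p_mult_M[of "p [^] k \<otimes> x"] x Jc by simp
          qed
          have "\<zero> = p [^] Suc k \<otimes> \<zero>" by simp
          then show "\<zero> \<in> ?R" using A.ideal_zero[OF J] by blast
          show "y \<oplus> z \<in> ?R" if yz: "y \<in> ?R" "z \<in> ?R" for y z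
          proof -
            obtain x x' where h: "x \<in> J" "x' \<in> J" "y = p [^] Suc k \<otimes> x" "z = p [^] Suc k \<otimes> x'"
              using yz by blast
            then have "y \<oplus> z = p [^] Suc k \<otimes> (x \<oplus> x')" using Jc by (simp add: r_distr)
            then show ?thesis using A.ideal_add_closed[OF J] h by blast
          qed
          show "y \<otimes> z \<in> ?R" if yz: "y \<in> A" "z \<in> ?R" for y z
          proof -
            obtain x where h: "x \<in> J" "z = p [^] Suc k \<otimes> x" using yz by blast
            then have "y \<otimes> z = p [^] Suc k \<otimes> (y \<otimes> x)" using Jc yz(1) by (simp add: m_ac)
            then show ?thesis using A.prod_in_ideal(2)[OF J h(1) yz(1)] by blast
          qed
        qed
        show "ideal_prod D (PIdl\<^bsub>D\<^esub> p) L \<subseteq> ?R"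
        proof (rule A.ideal_prod_subsetI[OF R])
          fix y z assume "y \<in> PIdl\<^bsub>D\<^esub> p" "z \<in> L"
          then obtain r x where h: "r \<in> A" "y = r \<otimes> p" "x \<in> J" "z = p [^] k \<otimes> x"
            using A.in_PIdl_iff Leq by blast
          then have "y \<otimes> z = p [^] Suc k \<otimes> (r \<otimes> x)" using Jc by (simp add: m_ac)
          then show "y \<otimes> z \<in> ?R" using A.prod_in_ideal(2)[OF J h(3,1)] by blast
        qed
        show "?R \<subseteq> ideal_prod D (PIdl\<^bsub>D\<^esub> p) L"
        proof
          fix y assume "y \<in> ?R"
          then obtain x where x: "x \<in> J" "y = p [^] Suc k \<otimes> x" by blast
          then have y: "y = p \<otimes> (p [^] k \<otimes> x)" using Jc by (simp add: m_ac)
          have "p \<in> PIdl\<^bsub>D\<^esub> p" using A.cgenideal_self p_M by simp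
          moreover have "p [^] k \<otimes> x \<in> L" unfolding Leq using x by blast
          ultimately show "y \<in> ideal_prod D (PIdl\<^bsub>D\<^esub> p) L"
            unfolding y using ideal_prod.prod[of p "PIdl\<^bsub>D\<^esub> p" "p [^] k \<otimes> x" L D] by simp
        qed
      qed
      then show ?case unfolding L_def by (simp add: ideal_list_prod_Cons)
    qed
    have "I = {p [^] n \<otimes> x | x. x \<in> J}"
    proof
      show "{p [^] n \<otimes> x | x. x \<in> J} \<subseteq> I" unfolding J_def by blast
      show "I \<subseteq> {p [^] n \<otimes> x | x. x \<in> J}"
      proof
        fix y assume y: "y \<in> I"
        then obtain v where v: "v \<in> V" "y = p [^] m \<otimes> v" using min by blast
        then have "y = p [^] n \<otimes> (p \<otimes> v)" unfolding n by (simp add: m_ac)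
        moreover have "p \<otimes> v \<in> J" unfolding J_def using y calculation p_mult_M[OF v(1)] by simp
        ultimately show "y \<in> {p [^] n \<otimes> x | x. x \<in> J}" by blast
      qed
    qed
    then have "I = ideal_list_prod D (replicate n (PIdl\<^bsub>D\<^esub> p) @ [J])" using prod by simp
    moreover have "\<forall>L\<in>set (replicate n (PIdl\<^bsub>D\<^esub> p) @ [J]). OA_ideal L D" using pOA JOA by auto
    ultimately show ?thesis unfolding has_OA_factorization_def by blast
  qed
qed

text \<open>If \<open>x\<close> is a unit of \<open>V\<close>, then its square is a unit of
  \<open>V\<close> in \<open>A\<close>, hence a unit of \<open>A\<close>, and \<open>x\<close> is
  the cube divided by the square. Otherwise \<open>x\<close> lies in \<open>M\<close>.\<close>

lemma square_cube_in_A: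
  assumes "x \<in> V" "x [^] (2::nat) \<in> A" "x [^] (3::nat) \<in> A" shows "x \<in> A"
proof -
  from V_cases[OF assms(1)] show ?thesis
  proof
    assume x: "x \<in> U"
    have "(x \<otimes> x) \<otimes> (inv x \<otimes> inv x) = (x \<otimes> inv x) \<otimes> (x \<otimes> inv x)"
      using x by (simp add: m_ac del: U_cancel)
    then have "x \<otimes> x \<in> U" using U_I[of "x \<otimes> x" "inv x \<otimes> inv x"] x by simp
    moreover have x2: "x [^] (2::nat) = x \<otimes> x" using x by (simp add: numeral_2_eq_2)
    ultimately have i: "inv (x \<otimes> x) \<in> A" "x \<otimes> x \<in> U" using U_A_inv assms(2) by simp_all
    have "x [^] (3::nat) = (x \<otimes> x) \<otimes> x" using x by (simp add: numeral_3_eq_3)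
    then have "inv (x \<otimes> x) \<otimes> x [^] (3::nat) = (inv (x \<otimes> x) \<otimes> (x \<otimes> x)) \<otimes> x"
      using x i by (simp add: m_assoc del: U_cancel)
    then have "inv (x \<otimes> x) \<otimes> x [^] (3::nat) = x" using i x by simp
    then show ?thesis using A.m_closed[OF i(1) assms(3)] by simp
  qed simp
qed

lemma seminormal_D: "seminormal K D"
  unfolding seminormal_def
proof (intro ballI impI)
  fix x assume x: "x \<in> carrier K" and "x [^] (2::nat) \<in> carrier D \<and> x [^] (3::nat) \<in> carrier D"
  then have p: "x [^] (2::nat) \<in> A" "x [^] (3::nat) \<in> A" by auto
  have "x \<in> V"
  proof (rule ccontr)
    assume n: "x \<notin> V"
    note val = valuation[OF x n]
    \<comment> \<open>Outside \<open>V\<close> the element \<open>x\<close> would be the product of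
      its inverse, which lies in \<open>M\<close>, and its square, which lies in \<open>V\<close>;
      so it would be in \<open>M\<close> after all.\<close>
    have "inv x \<otimes> x [^] (2::nat) = (inv x \<otimes> x) \<otimes> x"
      using x val by (simp add: numeral_2_eq_2 m_assoc del: field_inv(3))
    then have "inv x \<otimes> x [^] (2::nat) = x" using x val by simp
    then have "x \<in> M" using M_mult_V[OF val(2), of "x [^] (2::nat)"] p by simp
    then show False using n by simp
  qed
  then show "x \<in> carrier D" using square_cube_in_A[OF _ p] by simp
qed

text \<open>For all of \<open>V\<close> the element \<open>p\<close> is a common denominator,
  because \<open>pV = M \<subseteq> A\<close>. Conversely the powers of an element outside
  \<open>V\<close> have values that no fixed \<open>c\<close> can compensate.\<close>

lemma complete_integral_closure_D: "complete_integral_closure K D = V"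
proof
  show "V \<subseteq> complete_integral_closure K D"
  proof
    fix x assume x: "x \<in> V"
    have "p \<in> A - {\<zero>}" using p_M p_nonzero by simp
    moreover have "p \<otimes> x [^] n \<in> A" for n :: nat using p_mult_M x by simp
    ultimately show "x \<in> complete_integral_closure K D"
      unfolding complete_integral_closure_def using x by auto
  qed
  show "complete_integral_closure K D \<subseteq> V"
  proof
    fix x assume "x \<in> complete_integral_closure K D"
    then obtain c where x: "x \<in> carrier K" and c: "c \<in> A" "c \<noteq> \<zero>"
      and ci: "\<And>n::nat. n \<ge> 1 \<Longrightarrow> c \<otimes> x [^] n \<in> A"
      unfolding complete_integral_closure_def by auto
    show "x \<in> V"
    proof (rule ccontr)
      assume n: "x \<notin> V"
      note val = valuation[OF x n]
      obtain v where v: "v \<in> V" "inv x = p \<otimes> v" using M_E val(2) by blast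
      obtain m :: nat and e where e: "e \<in> U" "c = p [^] m \<otimes> e" using rep[of c] c by auto
      have pw: "inv x [^] k \<otimes> x [^] k = \<one>" for k :: nat
        using nat_pow_distrib[of "inv x" x k] x val by simp
      \<comment> \<open>With \<open>m\<close> the value of \<open>c\<close>, the power
        \<open>Suc m\<close> of the inverse of \<open>x\<close> already has value greater than
        \<open>m\<close>, and the other factor lies in \<open>A\<close>.\<close>
      have "c = inv x [^] Suc m \<otimes> (c \<otimes> x [^] Suc m)"
      proof -
        have "inv x [^] Suc m \<otimes> (c \<otimes> x [^] Suc m) = c \<otimes> (inv x [^] Suc m \<otimes> x [^] Suc m)"
          using x val c by (simp add: m_ac del: nat_pow_Suc)
        then show ?thesis using pw[of "Suc m"] c by simp
      qed
      also have "inv x [^] Suc m = p [^] m \<otimes> (p \<otimes> v [^] Suc m)"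
        unfolding v(2) using nat_pow_distrib[of p v "Suc m"] v(1) by (simp add: m_ac)
      finally have "p [^] m \<otimes> e = p [^] m \<otimes> ((p \<otimes> v [^] Suc m) \<otimes> (c \<otimes> x [^] Suc m))"
        using e(2) v(1) c x by (simp add: m_assoc)
      moreover have cV: "c \<otimes> x [^] Suc m \<in> V" using ci[of "Suc m"] by simp
      ultimately have "e = (p \<otimes> v [^] Suc m) \<otimes> (c \<otimes> x [^] Suc m)"
        using m_lcancel[of "p [^] m" e "(p \<otimes> v [^] Suc m) \<otimes> (c \<otimes> x [^] Suc m)"] e(1) v(1) by simp
      moreover have "(p \<otimes> v [^] Suc m) \<otimes> (c \<otimes> x [^] Suc m) \<in> M"
        using M_mult_V[OF p_mult_M cV] v(1) by simp
      ultimately show False using U_notin_M e(1) by simp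
    qed
  qed
qed

lemma PIdl_V_p: "PIdl\<^bsub>K\<lparr>carrier := V\<rparr>\<^esub> p = M"
proof -
  have "PIdl\<^bsub>K\<lparr>carrier := V\<rparr>\<^esub> p = {v \<otimes> p | v. v \<in> V}" unfolding cgenideal_def by simp
  also have "\<dots> = M"
  proof -
    have eq: "v \<otimes> p = p \<otimes> v" if "v \<in> V" for v using that m_comm[of v p] by simp
    show ?thesis unfolding M_eq by (intro Collect_cong) (metis eq)
  qed
  finally show ?thesis .
qed

lemma DVR_V: "DVR (K\<lparr>carrier := V\<rparr>)" "maximalideal M (K\<lparr>carrier := V\<rparr>)"
  using V.DVR_of_uniformizer[OF unif] PIdl_V_p by simp_all

lemma finitely_primary: "finitely_primary_rank_one K D"
  unfolding finitely_primary_rank_one_def complete_integral_closure_D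
proof (intro conjI)
  show "domain D" by (rule A.domain_axioms)
  show "local_ring D" unfolding local_ring_def using A.is_cring A.max A.unique_max by blast
  have "p \<in> conductor K D"
    unfolding conductor_def complete_integral_closure_D using p_M p_mult_M by simp
  then show "conductor K D \<noteq> {\<zero>\<^bsub>D\<^esub>}" using p_nonzero by auto
qed (use krull_dim_one DVR_V in simp_all)

lemma colon_M: "colon K M M = V"
proof
  show "V \<subseteq> colon K M M" 
  proof
    fix x assume x: "x \<in> V"
    have "x \<otimes> t \<in> M" if "t \<in> M" for t
      using M_mult_V[OF that x] m_comm[of x t] x that by simp
    then show "x \<in> colon K M M" unfolding colon_def using x by simp
  qed
  show "colon K M M \<subseteq> V"
  proof
    fix x assume "x \<in> colon K M M"
    then have x: "x \<in> carrier K" "x \<otimes> p \<in> M" unfolding colon_def using p_M by auto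
    then obtain v where v: "v \<in> V" "x \<otimes> p = p \<otimes> v" using M_E by blast
    then have "x \<otimes> p = v \<otimes> p" using m_comm by simp
    then have "x = v" using m_rcancel[OF p_nonzero, of x v] x v by simp
    then show "x \<in> V" using v by simp
  qed
qed

end

context dvr_overring
begin

text \<open>\<open>D\<close> is a C-domain through \<open>F = V - {0}\<close>: as \<open>yV \<subseteq> M \<subseteq> D\<close> for \<open>y \<in> M\<close>, all nonunits of \<open>F\<close> are
  equivalent.\<close>

abbreviation "VV \<equiv> mult_of (K\<lparr>carrier := V\<rparr>)"

lemma carrier_VV: "carrier VV = V - {\<zero>}" and mult_VV: "monoid.mult VV = monoid.mult K"
  and one_VV: "\<one>\<^bsub>VV\<^esub> = \<one>"
  unfolding mult_of_def by simp_all

lemma Units_VV: "Units VV = U"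
  using V.Units_mult_eq_Units Units_V by simp

text \<open>A nonzero element of \<open>V\<close> is divisible by \<open>p \<otimes> e\<close>
  exactly if it lies in \<open>M\<close>, and a product of two units of \<open>V\<close> does not.
  All associates of \<open>p\<close> are covered because a product of primes has no separate unit
  factor.\<close>

lemma prime_VV:
  assumes e: "e \<in> U" shows "prime VV (p \<otimes> e)"
  unfolding prime_def
proof (intro conjI ballI impI)
  show "p \<otimes> e \<notin> Units VV" unfolding Units_VV using p_mult_M[of e] U_notin_M[of "p \<otimes> e"] e by auto
  fix a b assume a: "a \<in> carrier VV" and b: "b \<in> carrier VV"
    and d: "p \<otimes> e divides\<^bsub>VV\<^esub> a \<otimes>\<^bsub>VV\<^esub> b"
  have ab: "a \<in> V" "a \<noteq> \<zero>" "b \<in> V" "b \<noteq> \<zero>" using a b carrier_VV by auto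
  have dvd: "p \<otimes> e divides\<^bsub>VV\<^esub> x" if x: "x \<in> M" "x \<noteq> \<zero>" for x
  proof -
    obtain v where v: "v \<in> V" "x = p \<otimes> v" using M_E x by blast
    have "p \<otimes> e \<otimes> (inv e \<otimes> v) = p \<otimes> (e \<otimes> inv e) \<otimes> v" using e v by (simp add: m_ac del: U_cancel)
    then have "x = p \<otimes> e \<otimes> (inv e \<otimes> v)" using v e by simp
    moreover have "v \<noteq> \<zero>" using v x by auto
    then have "inv e \<otimes> v \<in> V - {\<zero>}" using v e U_nonzero[OF U_inv[OF e]] by (simp add: integral_iff)
    ultimately show ?thesis unfolding factor_def carrier_VV mult_VV by blast
  qed
  obtain c where c: "c \<in> V" "a \<otimes> b = p \<otimes> e \<otimes> c"
    using d unfolding factor_def carrier_VV mult_VV by blast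
  have abM: "a \<otimes> b \<in> M" using p_mult_M[of "e \<otimes> c"] c e by (simp add: m_assoc)
  have "a \<in> M \<or> b \<in> M"
  proof (rule ccontr)
    assume "\<not> ?thesis"
    then have u: "a \<in> U" "b \<in> U" using V_cases ab by blast+
    have "a \<otimes> b \<otimes> inv b \<in> M" using M_mult_V[OF abM] u by simp
    then have "a \<in> M" using u by (simp add: m_assoc)
    then show False using u U_notin_M by blast
  qed
  then show "p \<otimes> e divides\<^bsub>VV\<^esub> a \<or> p \<otimes> e divides\<^bsub>VV\<^esub> b" using dvd ab by blast
qed

lemma prime_factorial_VV: "prime_factorial_monoid VV"
  unfolding prime_factorial_monoid_def
proof (intro conjI ballI)
  show "comm_monoid_cancel VV" by (rule V.mult_of.comm_monoid_cancel_axioms)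
  fix a assume "a \<in> carrier VV - Units VV"
  then have a: "a \<in> V" "a \<noteq> \<zero>" "a \<notin> U" using carrier_VV Units_VV by auto
  then obtain n :: nat and e where e: "e \<in> U" "a = p [^] Suc n \<otimes> e" using V_cases M_rep by blast
  \<comment> \<open>The unit \<open>e\<close> is absorbed by the last prime.\<close>
  let ?ps = "replicate n p @ [p \<otimes> e]"
  have "foldr (\<otimes>) (replicate k p @ [p \<otimes> e]) \<one> = p [^] Suc k \<otimes> e" for k :: nat
    by (induction k) (use e(1) in \<open>simp_all add: m_ac\<close>)
  then have "foldr (\<otimes>\<^bsub>VV\<^esub>) ?ps \<one>\<^bsub>VV\<^esub> = a" using e(2) mult_VV one_VV by simp
  moreover have "prime VV p" using prime_VV[OF one_U] by simp
  then have "\<forall>q\<in>set ?ps. prime VV q" using prime_VV e(1) by auto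
  moreover have "set ?ps \<subseteq> carrier VV"
    unfolding carrier_VV using e(1) p_nonzero U_nonzero by (auto simp: integral_iff)
  ultimately show "\<exists>ps. set ps \<subseteq> carrier VV \<and> (\<forall>p\<in>set ps. prime VV p) \<and>
      foldr (\<otimes>\<^bsub>VV\<^esub>) ps \<one>\<^bsub>VV\<^esub> = a" by blast
qed

lemma C_domain_D: "C_domain D"
  unfolding C_domain_def C_monoid_def
proof (intro conjI exI)
  let ?H = "mult_of D"
  show "domain D" by (rule A.domain_axioms)
  show "comm_monoid_cancel ?H" by (rule A.mult_of.comm_monoid_cancel_axioms)
  show "prime_factorial_monoid VV" by (rule prime_factorial_VV)
  have H: "carrier ?H = A - {\<zero>}" by simp
  show "submonoid_of ?H VV"
    unfolding submonoid_of_def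
  proof (intro conjI)
    show "submonoid (carrier ?H) VV"
    proof
      show "carrier ?H \<subseteq> carrier VV" unfolding H carrier_VV using A_subset_V by blast
      show "x \<otimes>\<^bsub>VV\<^esub> y \<in> carrier ?H" if "x \<in> carrier ?H" "y \<in> carrier ?H" for x y
        using that unfolding H mult_VV by (auto simp: integral_iff)
      show "\<one>\<^bsub>VV\<^esub> \<in> carrier ?H" unfolding H one_VV by simp
    qed
  qed (simp_all add: mult_of_def)
  have "Units ?H = {e \<in> A. e \<noteq> \<zero> \<and> inv e \<in> A}"
    using A.Units_mult_eq_Units Units_A by simp
  moreover have "x \<in> U \<longleftrightarrow> x \<noteq> \<zero> \<and> inv x \<in> A" if "x \<in> A" for x
    using U_A_inv[OF _ that] A_V[OF that] A_V[of "inv x"] unfolding U_def by blast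
  ultimately show "carrier ?H \<inter> Units VV = Units ?H"
    unfolding H Units_VV by blast
  show "finite (reduced_class_semigroup ?H VV)"
  proof (rule finite_subset)
    have full: "{x \<in> carrier VV. x \<otimes>\<^bsub>VV\<^esub> y \<in> carrier ?H} = carrier VV" if y: "y \<in> M" "y \<noteq> \<zero>" for y
    proof -
      have "x \<otimes> y \<in> A - {\<zero>}" if "x \<in> V - {\<zero>}" for x
        using M_mult_V[OF y(1), of x] that y m_comm[of x y] by (simp add: integral_iff)
      then show ?thesis unfolding H carrier_VV mult_VV by auto
    qed
    have "H_class ?H VV y = H_class ?H VV p" if "y \<in> carrier VV - Units VV" for y
    proof -
      have y: "y \<in> M" "y \<noteq> \<zero>" using that V_cases[of y] carrier_VV Units_VV by auto
      show ?thesis unfolding H_class_def H_equivalent_def full[OF y] full[OF p_M p_nonzero] ..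
    qed
    then show "reduced_class_semigroup ?H VV \<subseteq> {H_class ?H VV p, H_class ?H VV \<one>\<^bsub>VV\<^esub>}"
      unfolding reduced_class_semigroup_def by blast
  qed simp
qed

text \<open>For \<open>a \<in> I\<close> of least valuation, either \<open>I = aD\<close> or the inverse of \<open>I\<close>, and with it \<open>I\<^sub>v\<close>, depends
  on \<open>a\<close> only. In an ascending chain the least valuation becomes constant.\<close>

lemma inverse_set_nonprincipal:
  assumes I: "ideal I D" and a: "a \<in> I" "a \<noteq> \<zero>" and aV: "\<And>y. y \<in> I \<Longrightarrow> \<exists>v\<in>V. y = a \<otimes> v"
    and np: "I \<noteq> PIdl\<^bsub>D\<^esub> a"
  shows "inverse_set K D I = {x \<in> carrier K. x \<otimes> a \<in> M}"
proof
  have IA: "I \<subseteq> A" by (rule A.ideal_subset[OF I])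
  have aA: "a \<in> A" using a IA by blast
  show "inverse_set K D I \<subseteq> {x \<in> carrier K. x \<otimes> a \<in> M}"
  proof
    fix x assume "x \<in> inverse_set K D I"
    then have x: "x \<in> carrier K" "\<And>t. t \<in> I \<Longrightarrow> x \<otimes> t \<in> A" unfolding inverse_set_def colon_def by auto
    \<comment> \<open>Otherwise \<open>u = x \<otimes> a\<close> is a unit of \<open>A\<close>, and
      each \<open>y\<close> in \<open>I\<close> equals
      \<open>inv u \<otimes> (x \<otimes> y) \<otimes> a\<close>, a multiple of \<open>a\<close> in
      \<open>A\<close>; then \<open>I\<close> would be principal.\<close>
    have "x \<otimes> a \<in> M"
    proof (rule ccontr)
      assume n: "x \<otimes> a \<notin> M"
      define u where "u = x \<otimes> a"
      have u: "u \<in> A" "u \<notin> M" unfolding u_def using x(2)[OF a(1)] n by auto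
      then have uU: "u \<in> U" using V_cases[of u] by auto
      have "I \<subseteq> PIdl\<^bsub>D\<^esub> a"
      proof
        fix y assume y: "y \<in> I"
        have yK: "y \<in> carrier K" using y IA by auto
        have "inv u \<otimes> (x \<otimes> y) \<otimes> a = (inv u \<otimes> u) \<otimes> y"
          using uU yK x(1) aA unfolding u_def by (simp add: m_ac del: U_cancel)
        then have "y = inv u \<otimes> (x \<otimes> y) \<otimes> a" using uU yK by simp
        moreover have "inv u \<otimes> (x \<otimes> y) \<in> A" using U_A_inv[OF uU u(1)] x(2)[OF y] by simp
        ultimately show "y \<in> PIdl\<^bsub>D\<^esub> a" using A.in_PIdl_iff by blast
      qed
      then show False using np A.cgenideal_minimal[OF I a(1)] by blast
    qed
    then show "x \<in> {x \<in> carrier K. x \<otimes> a \<in> M}" using x by blast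
  qed
  show "{x \<in> carrier K. x \<otimes> a \<in> M} \<subseteq> inverse_set K D I"
  proof
    fix x assume "x \<in> {x \<in> carrier K. x \<otimes> a \<in> M}"
    then have x: "x \<in> carrier K" "x \<otimes> a \<in> M" by auto
    have "x \<otimes> y \<in> A" if y: "y \<in> I" for y
    proof -
      obtain v where v: "v \<in> V" "y = a \<otimes> v" using aV y by blast
      then have "x \<otimes> y = x \<otimes> a \<otimes> v" using x(1) aA by (simp add: m_assoc)
      then show ?thesis using M_mult_V[OF x(2) v(1)] by simp
    qed
    then show "x \<in> inverse_set K D I" unfolding inverse_set_def colon_def using x by simp
  qed
qed

lemma Mori_D: "Mori_domain K D"
  unfolding Mori_domain_def
proof (intro conjI allI impI)
  show "domain D" by (rule A.domain_axioms)
  fix I :: "nat \<Rightarrow> 'a set"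
  assume div: "\<forall>n. divisorial_ideal K D (I n)" and inc: "\<forall>n. I n \<subseteq> I (Suc n)"
  have Ii: "ideal (I n) D" and Iv: "v_closure K D (I n) = I n" for n
    using div unfolding divisorial_ideal_def by blast+
  have IA: "I n \<subseteq> A" for n by (rule A.ideal_subset[OF Ii])
  have mono: "I m \<subseteq> I n" if "m \<le> n" for m n
    using lift_Suc_mono_le[of I m n] inc that by blast
  show "\<exists>N. \<forall>n\<ge>N. I n = I N"
  proof (cases "\<exists>x. x \<in> (\<Union>n. I n) \<and> x \<noteq> \<zero>")
    case False
    then have "I n = {\<zero>}" for n using A.ideal_zero[OF Ii[of n]] by blast
    then show ?thesis by simp
  next
    case True
    then obtain x where x: "x \<in> (\<Union>n. I n)" "x \<noteq> \<zero>" by blast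
    have SV: "(\<Union>n. I n) \<subseteq> V" using IA A_subset_V by blast
    obtain m :: nat and e where e: "e \<in> U" "p [^] m \<otimes> e \<in> (\<Union>n. I n)" and
      min: "\<And>y. y \<in> (\<Union>n. I n) \<Longrightarrow> \<exists>v\<in>V. y = p [^] m \<otimes> v" using minimal_element[OF SV x] by blast
    define a where "a = p [^] m \<otimes> e"
    obtain N where N: "a \<in> I N" using e(2) unfolding a_def by blast
    have aI: "a \<in> I n" if "N \<le> n" for n using mono[OF that] N by blast
    have anz: "a \<noteq> \<zero>" unfolding a_def using e(1) U_nonzero by (simp add: integral_iff)
    have aV: "\<exists>v\<in>V. y = a \<otimes> v" if y: "y \<in> I n" for y n
    proof -
      obtain v where v: "v \<in> V" "y = p [^] m \<otimes> v" using min y by blast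
      have "a \<otimes> (inv e \<otimes> v) = p [^] m \<otimes> (e \<otimes> inv e) \<otimes> v"
        unfolding a_def using e(1) v(1) by (simp add: m_ac del: U_cancel)
      then have "y = a \<otimes> (inv e \<otimes> v)" using e(1) v by simp
      then show ?thesis using v(1) e(1) by (intro bexI[of _ "inv e \<otimes> v"]) simp_all
    qed
    show ?thesis
    proof (cases "\<forall>n\<ge>N. I n = PIdl\<^bsub>D\<^esub> a")
      case True then show ?thesis by blast
    next
      case False
      then obtain k where k: "N \<le> k" "I k \<noteq> PIdl\<^bsub>D\<^esub> a" by blast
      \<comment> \<open>Once the chain has left the principal ideal of \<open>a\<close> it cannot
        return: that ideal is contained in \<open>I k\<close>, and \<open>I k\<close> in
        \<open>I n\<close>.\<close>
      have np: "I n \<noteq> PIdl\<^bsub>D\<^esub> a" if "k \<le> n" for n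
        using mono[OF that] k A.cgenideal_minimal[OF Ii[of k] aI[OF k(1)]] by blast
      have "inverse_set K D (I n) = {x \<in> carrier K. x \<otimes> a \<in> M}" if "k \<le> n" for n
        using inverse_set_nonprincipal[OF Ii aI anz aV np[OF that]] k(1) that by simp
      then have "I n = I k" if "k \<le> n" for n
        using Iv[of n] Iv[of k] that unfolding v_closure_def by simp
      then show ?thesis by blast
    qed
  qed
qed

end
section \<open>Existence of the overring\<close>

lemma (in field) overring_of_DVR:
  assumes A: "subring A R" and W: "subring W R" and AW: "A \<subseteq> W"
    and fraction: "\<And>x. x \<in> carrier R \<Longrightarrow> \<exists>a\<in>A. \<exists>b\<in>A - {\<zero>}. x = a \<otimes> inv b"
    and loc: "local_domain (R\<lparr>carrier := A\<rparr>) M"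
    and dvr: "DVR (R\<lparr>carrier := W\<rparr>)" "maximalideal M (R\<lparr>carrier := W\<rparr>)"
  shows "\<exists>p. dvr_overring R A W M p"
proof -
  interpret A: local_domain "R\<lparr>carrier := A\<rparr>" M by (rule loc)
  obtain p where p: "domain.uniformizer (R\<lparr>carrier := W\<rparr>) p" "M = PIdl\<^bsub>R\<lparr>carrier := W\<rparr>\<^esub> p"
    using uniformizer_of_DVR[OF dvr] by blast
  have Wc: "W \<subseteq> carrier R" using subringE(1)[OF W] .
  have pW: "p \<in> carrier (R\<lparr>carrier := W\<rparr>)"
    using p(1) domain.uniformizer_def[OF subring_is_domain[OF W]] by blast
  have M: "M = {v \<otimes> p | v. v \<in> W}" unfolding p(2) cgenideal_def by simp
  have eq: "v \<otimes> p = p \<otimes> v" if "v \<in> W" for v using that pW Wc m_comm by auto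
  have "M = {p \<otimes> v | v. v \<in> W}" unfolding M by (intro Collect_cong) (metis eq)
  moreover have "M \<subseteq> A" using A.M_carr by auto
  ultimately have "dvr_overring R A W M p"
    using A W AW fraction loc p(1)
    by (intro dvr_overring.intro dvr_overring_axioms.intro field_axioms) auto
  then show ?thesis ..
qed

lemma (in field) colon_subring:
  assumes "subring A R" "ideal M (R\<lparr>carrier := A\<rparr>)"
  shows "subring (colon R M M) R" "A \<subseteq> colon R M M"
proof -
  note A = subringE[OF assms(1)]
  have MA: "M \<subseteq> A" using ideal.Icarr[OF assms(2)] by auto
  have Mc: "x \<in> carrier R" if "x \<in> M" for x using that MA A(1) by blast
  have Madd: "x \<oplus> y \<in> M" if "x \<in> M" "y \<in> M" for x y
    using additive_subgroup.a_closed[OF ideal.axioms(1)[OF assms(2)]] that by auto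
  have Mmult: "x \<otimes> y \<in> M" if "x \<in> A" "y \<in> M" for x y
    using ideal.I_l_closed[OF assms(2) that(2)] that by auto
  have in_colon: "x \<in> colon R M M \<longleftrightarrow> x \<in> carrier R \<and> (\<forall>t\<in>M. x \<otimes> t \<in> M)" for x
    unfolding colon_def by blast
  show "subring (colon R M M) R"
  proof (rule subringI)
    show "colon R M M \<subseteq> carrier R" unfolding colon_def by blast
    show "\<one> \<in> colon R M M" unfolding in_colon using Mc by simp
    fix x assume x: "x \<in> colon R M M"
    have "\<ominus> x \<otimes> t \<in> M" if t: "t \<in> M" for t
    proof -
      have "\<ominus> x \<otimes> t = \<ominus> \<one> \<otimes> (x \<otimes> t)" using x t Mc unfolding in_colon by (simp add: l_minus)
      then show ?thesis using Mmult[of "\<ominus> \<one>" "x \<otimes> t"] A(3,5) x t unfolding in_colon by simp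
    qed
    then show "\<ominus> x \<in> colon R M M" using x unfolding in_colon by simp
    fix y assume y: "y \<in> colon R M M"
    show "x \<otimes> y \<in> colon R M M" using x y Mc unfolding in_colon by (simp add: m_assoc)
    show "x \<oplus> y \<in> colon R M M" using x y Mc Madd unfolding in_colon by (simp add: l_distr)
  qed
  show "A \<subseteq> colon R M M" using Mmult A(1) unfolding in_colon by (auto simp: in_colon)
qed

text \<open>For irreducible \<open>u\<close> and \<open>m\<close>, \<open>t\<close> in
  \<open>M\<close>, universality gives \<open>m t = r u\<close>. Here \<open>r\<close> is a nonunit,
  as otherwise \<open>u\<close> would be a product of two nonunits; hence \<open>m / u\<close> lies
  in \<open>(M : M)\<close>. So any two irreducible elements differ by a unit of this ring, one of
  them serves as uniformizer, and lengths of factorizations become exponents.\<close>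

lemma (in field) overring_of_universal:
  assumes A: "subring A R"
    and fraction: "\<And>x. x \<in> carrier R \<Longrightarrow> \<exists>a\<in>A. \<exists>b\<in>A - {\<zero>}. x = a \<otimes> inv b"
    and loc: "local_domain (R\<lparr>carrier := A\<rparr>) M"
    and atomic: "atomic_domain (R\<lparr>carrier := A\<rparr>)" and univ: "universal_square (R\<lparr>carrier := A\<rparr>) M"
  shows "\<exists>p. dvr_overring R A (colon R M M) M p"
proof -
  let ?D = "R\<lparr>carrier := A\<rparr>" and ?W = "colon R M M"
  interpret A: local_domain ?D M
    rewrites "carrier ?D = A" and "monoid.mult ?D = monoid.mult R" and "monoid.one ?D = monoid.one R"
      and "ring.zero ?D = ring.zero R" and "ring.add ?D = ring.add R"
    using loc by simp_all
  have W: "subring ?W R" and AW: "A \<subseteq> ?W" using colon_subring[OF A A.ideal_M] by blast+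
  note Wr = subringE[OF W]
  have Wc [simp]: "x \<in> carrier R" if "x \<in> ?W" for x using that Wr(1) by blast
  have Ac [simp]: "x \<in> carrier R" if "x \<in> A" for x using that AW by auto
  have Mc [simp]: "x \<in> carrier R" "x \<in> A" if "x \<in> M" for x using that A.M_carr by auto
  have WM: "v \<otimes> t \<in> M" if "v \<in> ?W" "t \<in> M" for v t using that unfolding colon_def by blast
  have gen: "\<exists>v\<in>?W. m = u \<otimes> v" if u: "u \<in> A" "ring_irreducible\<^bsub>?D\<^esub> u" and m: "m \<in> M" for u m
  proof -
    have irr: "u \<noteq> \<zero>" "\<And>a b. a \<in> M \<Longrightarrow> b \<in> M \<Longrightarrow> u \<noteq> a \<otimes> b"
      using A.ring_irreducible_iff[OF u(1)] u(2) by auto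
    have inv: "inv u \<in> carrier R" "u \<otimes> inv u = \<one>" using irr(1) u(1) field_Units by auto
    define x where "x = m \<otimes> inv u"
    have xc: "x \<in> carrier R" unfolding x_def using m inv by simp
    have "x \<otimes> t \<in> M" if t: "t \<in> M" for t
    proof -
      have "m \<otimes> t \<in> ideal_prod ?D M M" using ideal_prod.prod[OF m t, of ?D] by simp
      then have "m \<otimes> t \<in> PIdl\<^bsub>?D\<^esub> u" using univ u unfolding universal_square_def by auto
      then obtain r where r: "r \<in> A" "m \<otimes> t = r \<otimes> u" using A.in_PIdl_iff by blast
      have "x \<otimes> t = (m \<otimes> t) \<otimes> inv u" unfolding x_def using m t inv by (simp add: m_ac)
      also have "\<dots> = r" unfolding r(2) using r(1) u(1) inv by (simp add: m_assoc)
      finally have xt: "x \<otimes> t = r" .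
      have "r \<in> M"
      proof (rule ccontr)
        assume "r \<notin> M"
        then have rU: "r \<in> Units ?D" using A.in_M_iff[OF r(1)] by blast
        have "inv\<^bsub>?D\<^esub> r \<otimes> (m \<otimes> t) = (inv\<^bsub>?D\<^esub> r \<otimes> r) \<otimes> u"
          unfolding r(2) using r(1) u(1) A.Units_inv_closed[OF rU] by (simp add: m_assoc)
        then have "u = (inv\<^bsub>?D\<^esub> r \<otimes> m) \<otimes> t"
          using A.Units_l_inv[OF rU] u(1) m t A.Units_inv_closed[OF rU] by (simp add: m_assoc)
        then show False using irr(2)[of "inv\<^bsub>?D\<^esub> r \<otimes> m" t] t A.M_mult(2)[OF m A.Units_inv_closed[OF rU]] by blast
      qed
      then show ?thesis using xt by simp
    qed
    then have "x \<in> ?W" unfolding colon_def using xc by blast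
    moreover have "u \<otimes> x = (u \<otimes> inv u) \<otimes> m" unfolding x_def using u(1) m inv(1) by (simp add: m_ac)
    then have "m = u \<otimes> x" using inv(2) m by simp
    ultimately show ?thesis by blast
  qed
  obtain m where m: "m \<in> M" "m \<noteq> \<zero>" using A.not_field A.ideal_zero[OF A.ideal_M] by blast
  have fact: "\<exists>us. irreducible_factorization ?D us x" if "x \<in> M" "x \<noteq> \<zero>" for x
  proof -
    have "x \<in> carrier ?D - {\<zero>\<^bsub>?D\<^esub>} - Units ?D"
    proof -
      have xA: "x \<in> A" by (rule Mc(2)[OF that(1)])
      then have "x \<notin> Units ?D" using A.in_M_iff[OF xA] that(1) by blast
      then show ?thesis using xA that(2) by simp
    qed
    then show ?thesis using atomic unfolding atomic_domain_def by blast
  qed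
  obtain us where us: "irreducible_factorization ?D us m" using fact[OF m] by blast
  have "us \<noteq> []" using us m A.one_notin_M unfolding irreducible_factorization_def by auto
  then obtain p where "p \<in> set us" by (meson list.set_sel(1))
  then have p: "p \<in> A" "ring_irreducible\<^bsub>?D\<^esub> p" using us unfolding irreducible_factorization_def by auto
  have pM: "p \<in> M" "p \<noteq> \<zero>" using A.ring_irreducible_iff[OF p(1)] p(2) by auto
  interpret W: domain "R\<lparr>carrier := ?W\<rparr>"
    rewrites "carrier (R\<lparr>carrier := ?W\<rparr>) = ?W" and "monoid.mult (R\<lparr>carrier := ?W\<rparr>) = monoid.mult R"
      and "monoid.one (R\<lparr>carrier := ?W\<rparr>) = monoid.one R"
      and "ring.zero (R\<lparr>carrier := ?W\<rparr>) = ring.zero R" and "ring.add (R\<lparr>carrier := ?W\<rparr>) = ring.add R"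
    using subring_is_domain[OF W] by simp_all
  let ?U = "Units (R\<lparr>carrier := ?W\<rparr>)"
  have U: "e \<in> ?U \<longleftrightarrow> e \<in> ?W \<and> (\<exists>f\<in>?W. e \<otimes> f = \<one>)" for e
    using W.m_comm unfolding Units_def by auto
  have irr_unit: "\<exists>e\<in>?U. u = p \<otimes> e" if u: "u \<in> A" "ring_irreducible\<^bsub>?D\<^esub> u" for u
  proof -
    have uM: "u \<in> M" "u \<noteq> \<zero>" using A.ring_irreducible_iff[OF u(1)] u(2) by auto
    obtain v where v: "v \<in> ?W" "u = p \<otimes> v" using gen[OF p uM(1)] by blast
    obtain w where w: "w \<in> ?W" "p = u \<otimes> w" using gen[OF u pM(1)] by blast
    have "p \<otimes> (v \<otimes> w) = u \<otimes> w" using v pM(1) w(1) by (simp add: m_assoc)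
    then have "p \<otimes> (v \<otimes> w) = p \<otimes> \<one>" using w(2) pM(1) by simp
    then have "v \<otimes> w = \<one>" using m_lcancel[OF pM(2), of "v \<otimes> w" \<one>] v(1) w(1) pM(1) by simp
    then show ?thesis using U v w by blast
  qed
  have len: "irreducible_factorization ?D us a \<Longrightarrow> \<exists>e\<in>?U. a = p [^] length us \<otimes> e" for us a
  proof (induction us arbitrary: a)
    case Nil
    then have "a = \<one>" unfolding irreducible_factorization_def by simp
    moreover have "\<one> \<in> ?U" using U by force
    ultimately show ?case by (intro bexI[of _ \<one>]) simp_all
  next
    case (Cons u us)
    define b where "b = foldr (\<otimes>) us \<one>"
    have h: "u \<in> A" "ring_irreducible\<^bsub>?D\<^esub> u" "irreducible_factorization ?D us b" "a = u \<otimes> b"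
      using Cons.prems unfolding irreducible_factorization_def b_def by auto
    obtain e where e: "e \<in> ?U" "u = p \<otimes> e" using h irr_unit by blast
    obtain f where f: "f \<in> ?U" "b = p [^] length us \<otimes> f" using Cons.IH[OF h(3)] by blast
    have "e \<otimes> f \<in> ?U" using W.Units_m_closed[OF e(1) f(1)] .
    moreover have "a = p [^] length (u # us) \<otimes> (e \<otimes> f)"
      unfolding h(4) e(2) f(2) using e(1) f(1) U pM(1) by (simp add: m_ac)
    ultimately show ?case by blast
  qed
  have pnU: "p \<notin> ?U"
  proof
    assume "p \<in> ?U"
    then obtain f where f: "f \<in> ?W" "p \<otimes> f = \<one>" using U by blast
    then have "f \<otimes> p = \<one>" using pM(1) m_comm by simp
    then show False using WM[OF f(1) pM(1)] A.one_notin_M by simp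
  qed
  \<comment> \<open>Elements of \<open>?W\<close> need not have factorizations in \<open>A\<close>,
    but \<open>x \<otimes> p\<close> lies in \<open>M\<close> and has one of positive length; one
    factor \<open>p\<close> is cancelled afterwards.\<close>
  have rep: "\<exists>n::nat. \<exists>e\<in>?U. x = p [^] n \<otimes> e" if x: "x \<in> ?W" "x \<noteq> \<zero>" for x
  proof -
    have "x \<otimes> p \<in> M" "x \<otimes> p \<noteq> \<zero>" using WM[OF x(1) pM(1)] x pM by (auto simp: integral_iff)
    then obtain vs where vs: "irreducible_factorization ?D vs (x \<otimes> p)" using fact by blast
    obtain e where e: "e \<in> ?U" "x \<otimes> p = p [^] length vs \<otimes> e" using len[OF vs] by blast
    have "vs \<noteq> []"
    proof
      assume "vs = []"
      then have "\<one> \<in> M" using vs \<open>x \<otimes> p \<in> M\<close> unfolding irreducible_factorization_def by simp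
      then show False using A.one_notin_M by blast
    qed
    then obtain n where n: "length vs = Suc n" by (cases vs) auto
    have "x \<otimes> p = (p [^] n \<otimes> e) \<otimes> p" unfolding e(2) n using e(1) U pM(1) by (simp add: m_ac)
    then have "x = p [^] n \<otimes> e" using m_rcancel[OF pM(2), of x "p [^] n \<otimes> e"] x e(1) U pM(1) by simp
    then show ?thesis using e(1) by blast
  qed
  have "W.uniformizer p"
    unfolding W.uniformizer_def using pM AW pnU rep by (auto simp flip: nat_pow_consistent)
  moreover have "M = {p \<otimes> v | v. v \<in> ?W}"
  proof
    show "M \<subseteq> {p \<otimes> v | v. v \<in> ?W}" using gen[OF p] by blast
    show "{p \<otimes> v | v. v \<in> ?W} \<subseteq> M"
    proof
      fix y assume "y \<in> {p \<otimes> v | v. v \<in> ?W}"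
      then obtain v where v: "v \<in> ?W" "y = p \<otimes> v" by blast
      then have "y = v \<otimes> p" using pM(1) m_comm by simp
      then show "y \<in> M" using WM[OF v(1) pM(1)] by simp
    qed
  qed
  moreover have "M \<subseteq> A" using A.M_carr by blast
  ultimately have "dvr_overring R A ?W M p"
    using A W AW fraction loc
    by (intro dvr_overring.intro dvr_overring_axioms.intro field_axioms) auto
  then show ?thesis ..
qed

text \<open>The maximal ideal \<open>N\<close> of \<open>W\<close> has to be brought down into
  \<open>A\<close>. A nonzero conductor contains \<open>p\<close>^\<open>k\<close> \<open>W\<close>
  for some \<open>k\<close>, so high powers of any element of \<open>N\<close> lie in
  \<open>A\<close>, and seminormality descends to the element itself. Then \<open>N\<close> is a
  nonzero prime of \<open>A\<close>, and dimension one forces \<open>N = M\<close>.\<close>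

lemma (in field) seminormal_finitely_primary_overring:
  assumes A: "subring A R" and loc: "local_domain (R\<lparr>carrier := A\<rparr>) M"
    and sn: "seminormal R (R\<lparr>carrier := A\<rparr>)" and fp: "finitely_primary_rank_one R (R\<lparr>carrier := A\<rparr>)"
  defines "W \<equiv> complete_integral_closure R (R\<lparr>carrier := A\<rparr>)"
  shows "subring W R" "A \<subseteq> W" "DVR (R\<lparr>carrier := W\<rparr>)" "maximalideal M (R\<lparr>carrier := W\<rparr>)"
proof -
  let ?D = "R\<lparr>carrier := A\<rparr>" and ?W = "R\<lparr>carrier := W\<rparr>"
  interpret A: local_domain ?D M
    rewrites "carrier ?D = A" and "monoid.mult ?D = monoid.mult R" and "monoid.one ?D = monoid.one R"
      and "ring.zero ?D = ring.zero R" and "ring.add ?D = ring.add R"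
    using loc by simp_all
  note Ar = subringE[OF A]
  show dvr: "DVR ?W" using fp unfolding finitely_primary_rank_one_def W_def by blast
  have dim: "\<And>P. primeideal P ?D \<Longrightarrow> P = {\<zero>} \<or> P = M"
    using fp A.krull_dim_one_iff unfolding finitely_primary_rank_one_def by auto
  have Wcarr: "W \<subseteq> carrier R" unfolding W_def complete_integral_closure_def by blast
  have dom: "domain ?W" using dvr principal_domain.axioms(1) unfolding DVR_def by blast
  \<comment> \<open>Closure of \<open>W\<close> under the ring operations is not computed; it is
    contained in the hypothesis that \<open>W\<close> carries a DVR.\<close>
  then show W: "subring W R"
    using ring_incl_imp_subring[OF Wcarr] by (simp add: domain_def cring_def)
  show AW: "A \<subseteq> W"
  proof
    fix x assume x: "x \<in> A"
    have pow: "x [^] (n::nat) \<in> A" for n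
      by (induction n) (use Ar(3,6) x in auto)
    have "\<one> \<otimes> x [^] (n::nat) \<in> A" for n using pow[of n] Ar(1) x by auto
    moreover have "\<one> \<in> A - {\<zero>}" using Ar(3) by simp
    ultimately show "x \<in> W"
      unfolding W_def complete_integral_closure_def using x Ar(1) by fastforce
  qed
  obtain N where N: "maximalideal N ?W" using dvr unfolding DVR_def local_ring_def by blast
  obtain p where p: "domain.uniformizer ?W p" "N = PIdl\<^bsub>?W\<^esub> p" using uniformizer_of_DVR[OF dvr N] by blast
  interpret W: local_domain ?W N
    rewrites "carrier ?W = W" and "monoid.mult ?W = monoid.mult R" and "monoid.one ?W = monoid.one R"
      and "ring.zero ?W = ring.zero R" and "ring.add ?W = ring.add R"
    using local_domainI[OF dom _ N] dvr unfolding DVR_def by simp_all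
  have Wc [simp]: "x \<in> carrier R" if "x \<in> W" for x using that Wcarr by blast
  have pW: "p \<in> W" "p \<noteq> \<zero>"
    and rep: "\<And>x. x \<in> W \<Longrightarrow> x \<noteq> \<zero> \<Longrightarrow> \<exists>n::nat. \<exists>e\<in>Units ?W. x = p [^] n \<otimes> e"
    using p(1) unfolding W.uniformizer_def by (auto simp flip: nat_pow_consistent)
  have Wpow [simp]: "x [^] (n::nat) \<in> W" if "x \<in> W" for x n
    by (induction n) (use that in simp_all)
  obtain f where f: "f \<in> A" "f \<noteq> \<zero>" "\<And>y. y \<in> W \<Longrightarrow> f \<otimes> y \<in> A"
  proof -
    have c: "conductor R ?D \<noteq> {\<zero>}" using fp unfolding finitely_primary_rank_one_def by simp
    have "\<zero> \<in> conductor R ?D" unfolding conductor_def using Ar(2) Wcarr unfolding W_def by auto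
    then obtain f where "f \<in> conductor R ?D" "f \<noteq> \<zero>" using c by blast
    then show ?thesis using that unfolding conductor_def W_def by auto
  qed
  obtain k :: nat and e where e: "e \<in> Units ?W" "f = p [^] k \<otimes> e" using rep[of f] f AW by blast
  have eW: "e \<in> W" "inv\<^bsub>?W\<^esub> e \<in> W" "e \<otimes> inv\<^bsub>?W\<^esub> e = \<one>"
    using W.Units_closed[OF e(1)] W.Units_inv_closed[OF e(1)] W.Units_r_inv[OF e(1)] by auto
  have pk: "p [^] k \<otimes> y \<in> A" if y: "y \<in> W" for y
  proof -
    have "f \<otimes> (inv\<^bsub>?W\<^esub> e \<otimes> y) = p [^] k \<otimes> (e \<otimes> inv\<^bsub>?W\<^esub> e) \<otimes> y"
      unfolding e(2) using eW(1,2) pW(1) y by (simp add: m_ac)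
    then have "f \<otimes> (inv\<^bsub>?W\<^esub> e \<otimes> y) = p [^] k \<otimes> y" using eW(3) pW(1) y by simp
    then show ?thesis using f(3)[of "inv\<^bsub>?W\<^esub> e \<otimes> y"] eW(2) y by simp
  qed
  \<comment> \<open>The bound drops from \<open>Suc m\<close> to \<open>m\<close>: for positive
    \<open>m\<close> the exponents \<open>2m\<close> and \<open>3m\<close> are at least
    \<open>Suc m\<close>, so seminormality applies to the \<open>m\<close>-th power. For
    \<open>m = 0\<close> the first power is already covered.\<close>
  have descend: "(\<And>n. n \<ge> m \<Longrightarrow> x [^] n \<in> A) \<Longrightarrow> x \<in> A" if x: "x \<in> carrier R" for x and m :: nat
  proof (induction m)
    case 0 then show ?case using 0[of 1] x by simp
  next
    case (Suc m)
    show ?case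
    proof (cases "m = 0")
      case True then show ?thesis using Suc.prems[of 1] x by simp
    next
      case False
      have "(x [^] m) [^] (2::nat) \<in> A" "(x [^] m) [^] (3::nat) \<in> A"
        using Suc.prems[of "m * 2"] Suc.prems[of "m * 3"] False x by (simp_all add: nat_pow_pow)
      then have xm: "x [^] m \<in> A"
        using sn[unfolded seminormal_def, rule_format, of "x [^] m"] x by simp
      have "x [^] n \<in> A" if "n \<ge> m" for n
        using that xm Suc.prems[of n] by (cases "n = m") auto
      then show ?thesis using Suc.IH by blast
    qed
  qed
  have NW: "N \<subseteq> W" using W.M_carr by blast
  have NA: "N \<subseteq> A"
  proof
    fix x assume "x \<in> N"
    then obtain w where w: "w \<in> W" "x = w \<otimes> p" unfolding p(2) W.in_PIdl_iff by blast
    have xc: "x \<in> carrier R" using w pW(1) by simp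
    have "x [^] n \<in> A" if n: "n \<ge> k" for n
    proof -
      obtain j where j: "n = k + j" using n le_Suc_ex by blast
      have "x [^] n = w [^] n \<otimes> p [^] n" unfolding w(2) using nat_pow_distrib w(1) pW(1) by simp
      also have "p [^] n = p [^] k \<otimes> p [^] j" unfolding j using nat_pow_mult[of p k j] pW(1) by simp
      finally have "x [^] n = p [^] k \<otimes> (p [^] j \<otimes> w [^] n)" using w(1) pW(1) by (simp add: m_ac)
      then show ?thesis using pk[of "p [^] j \<otimes> w [^] n"] w(1) pW(1) by simp
    qed
    then show "x \<in> A" using descend[OF xc] by blast
  qed
  have pN: "p \<in> N" using W.cgenideal_self[OF pW(1)] p(2) by simp
  have "primeideal N ?D"
  proof (rule primeidealI[OF _ A.is_cring])
    show "ideal N ?D"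
    proof (rule A.ideal_closedI[OF NA])
      show "\<zero> \<in> N" by (rule W.ideal_zero[OF W.ideal_M])
      show "x \<oplus> y \<in> N" if "x \<in> N" "y \<in> N" for x y using W.M_add that .
      show "x \<otimes> y \<in> N" if "x \<in> A" "y \<in> N" for x y using W.M_mult(2)[OF that(2)] that(1) AW by blast
    qed
    show "carrier ?D \<noteq> N" using W.one_notin_M Ar(3) by auto
    show "a \<in> N \<or> b \<in> N" if "a \<in> carrier ?D" "b \<in> carrier ?D" "a \<otimes>\<^bsub>?D\<^esub> b \<in> N" for a b
      using primeideal.I_prime[OF W.M_prime, of a b] that AW by auto
  qed
  then have "N = M" using dim pN pW(2) by blast
  then show "maximalideal M ?W" using N by simp
qed

theorem theorem4p1:
  fixes K D :: "('a, 'b) ring_scheme" and M :: "'a set"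
  assumes "domain D" and "quotient_field K D"
    and "local_ring D" and "maximalideal M D"
    and "\<not> field D"
  shows "(OAF_domain D \<longleftrightarrow> TAF_domain D)
    \<and> (TAF_domain D \<longleftrightarrow>
        krull_dim D = 1 \<and>
        (\<forall>I. principalideal I D \<and> proper_ideal I D \<longrightarrow> has_OA_factorization I D))
    \<and> ((krull_dim D = 1 \<and>
        (\<forall>I. principalideal I D \<and> proper_ideal I D \<longrightarrow> has_OA_factorization I D)) \<longleftrightarrow>
       (krull_dim D = 1 \<and> atomic_domain D \<and>
        (\<forall>u \<in> carrier D. ring_irreducible\<^bsub>D\<^esub> u \<longrightarrow> OA_ideal (PIdl\<^bsub>D\<^esub> u) D)))
    \<and> ((krull_dim D = 1 \<and> atomic_domain D \<and>
        (\<forall>u \<in> carrier D. ring_irreducible\<^bsub>D\<^esub> u \<longrightarrow> OA_ideal (PIdl\<^bsub>D\<^esub> u) D)) \<longleftrightarrow>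
       (atomic_domain D \<and> universal_square D M))
    \<and> ((atomic_domain D \<and> universal_square D M) \<longleftrightarrow>
       (DVR (K\<lparr>carrier := colon K M M\<rparr>) \<and> maximalideal M (K\<lparr>carrier := colon K M M\<rparr>)))
    \<and> ((DVR (K\<lparr>carrier := colon K M M\<rparr>) \<and> maximalideal M (K\<lparr>carrier := colon K M M\<rparr>)) \<longleftrightarrow>
       (seminormal K D \<and> finitely_primary_rank_one K D))
    \<and> (OAF_domain D \<longrightarrow> half_factorial_domain D \<and> C_domain D \<and> Mori_domain K D)"
proof -
  have K: "field K" and A: "subring (carrier D) K" and D: "K\<lparr>carrier := carrier D\<rparr> = D"
    and fraction: "\<And>x. x \<in> carrier K \<Longrightarrow>
      \<exists>a\<in>carrier D. \<exists>b\<in>carrier D - {\<zero>\<^bsub>K\<^esub>}. x = a \<otimes>\<^bsub>K\<^esub> inv\<^bsub>K\<^esub> b"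
  proof -
    have q: "field K" "subring (carrier D) K" "D = K\<lparr>carrier := carrier D\<rparr>"
      "\<forall>x\<in>carrier K. \<exists>a\<in>carrier D. \<exists>b\<in>carrier D - {\<zero>\<^bsub>D\<^esub>}. x = a \<otimes>\<^bsub>K\<^esub> inv\<^bsub>K\<^esub> b"
      using assms(2) unfolding quotient_field_def by blast+
    then show "field K" "subring (carrier D) K" "K\<lparr>carrier := carrier D\<rparr> = D" by simp_all
    have "\<zero>\<^bsub>D\<^esub> = \<zero>\<^bsub>K\<^esub>" using arg_cong[OF q(3), of ring.zero] by simp
    then show "\<And>x. x \<in> carrier K \<Longrightarrow>
      \<exists>a\<in>carrier D. \<exists>b\<in>carrier D - {\<zero>\<^bsub>K\<^esub>}. x = a \<otimes>\<^bsub>K\<^esub> inv\<^bsub>K\<^esub> b" using q(4) by simp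
  qed
  interpret K: field K by (rule K)
  interpret D: local_domain D M by (rule local_domainI) (use assms in blast)+
  have loc: "local_domain (K\<lparr>carrier := carrier D\<rparr>) M" unfolding D by (rule D.local_domain_axioms)
  let ?W = "colon K M M"
  let ?over = "\<exists>V p. dvr_overring K (carrier D) V M p"
  let ?s3 = "krull_dim D = 1 \<and>
        (\<forall>I. principalideal I D \<and> proper_ideal I D \<longrightarrow> has_OA_factorization I D)"
  let ?s4 = "krull_dim D = 1 \<and> atomic_domain D \<and>
        (\<forall>u \<in> carrier D. ring_irreducible\<^bsub>D\<^esub> u \<longrightarrow> OA_ideal (PIdl\<^bsub>D\<^esub> u) D)"
  let ?s5 = "atomic_domain D \<and> universal_square D M"
  let ?s6 = "DVR (K\<lparr>carrier := ?W\<rparr>) \<and> maximalideal M (K\<lparr>carrier := ?W\<rparr>)"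
  let ?s7 = "seminormal K D \<and> finitely_primary_rank_one K D"
  \<comment> \<open>The remaining statements follow from \<open>OAF_domain D\<close> by
    \<open>s12\<close>, \<open>s23\<close> and \<open>s35\<close>, so they are not listed
    here.\<close>
  have over: "OAF_domain D \<and> ?s4 \<and> ?s6 \<and> ?s7 \<and> half_factorial_domain D \<and> C_domain D \<and> Mori_domain K D"
    if ex: ?over
  proof -
    obtain V p where "dvr_overring K (carrier D) V M p" using ex by blast
    then interpret O: dvr_overring K "carrier D" V M p .
    have "OA_ideal (PIdl\<^bsub>D\<^esub> u) D" if "u \<in> carrier D" "ring_irreducible\<^bsub>D\<^esub> u" for u
      using O.irreducible_OA[of u] that unfolding D by blast
    then show ?thesis
      using O.OAF O.krull_dim_one O.atomic O.seminormal_D O.finitely_primary O.DVR_V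
        O.half_factorial O.C_domain_D O.Mori_D
      unfolding D O.colon_M by blast
  qed
  have s12: "OAF_domain D \<Longrightarrow> TAF_domain D" by (rule D.OAF_imp_TAF)
  have s23: "TAF_domain D \<Longrightarrow> ?s3" using D.TAF_imp_one_dim_OAF by blast
  have s35: "?s3 \<Longrightarrow> ?s5" using D.principal_OA_imp_atomic_universal by blast
  have s45: "?s4 \<Longrightarrow> ?s5" using D.irreducible_OA_imp_universal by blast
  have s5: "?s5 \<Longrightarrow> ?over"
    using K.overring_of_universal[OF A fraction loc] unfolding D by blast
  have s6: "?s6 \<Longrightarrow> ?over"
    using K.overring_of_DVR[OF A K.colon_subring(1)[OF A] K.colon_subring(2)[OF A] fraction loc] D.ideal_M
    unfolding D by blast
  have s7: "?s7 \<Longrightarrow> ?over"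
    using K.seminormal_finitely_primary_overring[OF A loc] K.overring_of_DVR[OF A _ _ fraction loc]
    unfolding D by blast
  show ?thesis using over s12 s23 s35 s45 s5 s6 s7 by argo
qed
end
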